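(* Let $X$ be a simplicial set, let $h\colon X\rightarrow \mathrm{R}$ be a height function, and for $q\ge 0$ let $\mathcal{G}_q$ be its $q$th Reeb complex. The section spectral sequence associated to $h$ has $\mathrm{H}_p\mathcal{G}_q$ as the $(p,q)$th entry of its second page, $\mathrm{E}^2_{p,q}\simeq \mathrm{H}_p\mathcal{G}_q$, and it converges to the homology of $X$: \[ \mathrm{H}_p\mathcal{G}_q\Rightarrow \mathrm{H}_{p+q}X . \]
   Context: Homology is taken with coefficients in a fixed field $k$. Simplicial real line: $\mathrm{R}=\mathrm{N}(\mathbb{R},\leq)$, the nerve of the poset $(\mathbb{R},\le)$; an $n$-simplex is a non-decreasing sequence $\bar a=(a_0,\dots,a_n)$ of real numbers, equivalently a simplicial map $\bar a\colon\Delta^n\to \mathrm{R}$. A height function on a simplicial set $X$ is a simplicial map $h\colon X\to \mathrm{R}$. Section complex: for $\bar a\in \mathrm{R}_p$, let $\mathcal{S}_h[\bar a]$ be the simplicial set whose $q$-simplices are the simplicial maps $\rho\colon\Delta^p\times\Delta^q\to X$ with $h\circ\rho=\bar a\circ \mathrm{pr}_0$, where $\mathrm{pr}_0\colon\Delta^p\times\Delta^q\to\Delta^p$ is the projection. Put $(\mathcal{S}_h)_p=\coprod_{\bar a\in \mathrm{R}_p}\mathcal{S}_h[\bar a]$. The section complex $\mathcal{S}_h$ is the bisimplicial set with $(p,q)$-simplices $(\mathcal{S}_h)_{p,q}$ (the $q$-simplices of $(\mathcal{S}_h)_p$). Its horizontal face and degeneracy maps $d^h_i,s^h_j$ are given by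 precomposing $\rho$ with $\delta^i\times\mathrm{id}$ and $\sigma^j\times\mathrm{id}$, and its vertical ones $d^v_i,s^v_j$ by precomposing with $\mathrm{id}\times\delta^i$ and $\mathrm{id}\times\sigma^j$, where $\delta^i,\sigma^j$ are the coface and codegeneracy maps between standard simplices. Reeb complex: for $q\ge0$, $p\mapsto \mathrm{H}_q((\mathcal{S}_h)_p)$ with the maps induced by $d^h_i,s^h_j$ is a simplicial vector space $\mathrm{H}_q\mathcal{S}_h$. For a simplicial vector space $V$ let $\mathrm{C}V$ be the Moore complex, $\mathrm{C}V_p=V_p$ with differential $\sum(-1)^id_i$, and let $\mathrm{D}V\subset\mathrm{C}V$ be the subcomplex spanned by degenerate simplices. Then $\mathcal{G}_q=\mathrm{C}(\mathrm{H}_q\mathcal{S}_h)/\mathrm{D}(\mathrm{H}_q\mathcal{S}_h)$; explicitly $(\mathcal{G}_q)_p\cong\bigoplus\mathrm{H}_q\mathcal{S}_h[\bar a]$ over strictly increasing sequences $\bar a=(a_0,\dots,a_p)$. Section spectral sequence: the first-quadrant spectral sequence of the double complex $C_{p,q}=k\langle(\mathcal{S}_h)_{p,q}\rangle$ (free vector spaces) with commuting differentials $\partial_h=\sum(-1)^id^h_i$ and $\partial_v=\sum(-1)^id^v_i$. It has $\mathrm{E}^0_{p,q}=C_{p,q}$ with differential $\partial_v$, $\mathrm{E}^1_{p,q}=\mathrm{H}_q((\mathcal{S}_h)_p)$ with differential induced by $\partial_h$, and $\partial^r\colon \mathrm{E}^r_{p,q}\to \mathrm{E}^r_{p-r,q+r-1}$.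 Convergence to $\mathrm{H}_{p+q}X$ means that $\mathrm{H}_nX\simeq\bigoplus_{p+q=n}\mathrm{E}^\infty_{p,q}$, as graded pieces of a filtration of $\mathrm{H}_n$. *)

theory Defs
  imports Complex_Main "HOL-Library.FuncSet" "HOL-Library.Poly_Mapping"
    "HOL-Algebra.Module" "HOL-Algebra.AbelCoset"
begin

section \<open>Simplicial sets\<close>

text \<open>\<open>face X n i\<close> is $d_i$ on \<open>n\<close>-simplices (relevant for \<open>i \<le> n\<close>, \<open>n \<ge> 1\<close>) and
  \<open>degen X n j\<close> is $s_j$ on \<open>n\<close>-simplices (relevant for \<open>j \<le> n\<close>).\<close>

record 'a sset =
  cells :: "nat \<Rightarrow> 'a set"
  face :: "nat \<Rightarrow> nat \<Rightarrow> 'a \<Rightarrow> 'a"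
  degen :: "nat \<Rightarrow> nat \<Rightarrow> 'a \<Rightarrow> 'a"

locale simplicial_set =
  fixes X :: "'a sset"
  assumes face_closed:
      "\<And>n i x. \<lbrakk>x \<in> cells X (Suc n); i \<le> Suc n\<rbrakk> \<Longrightarrow> face X (Suc n) i x \<in> cells X n"
    and degen_closed:
      "\<And>n j x. \<lbrakk>x \<in> cells X n; j \<le> n\<rbrakk> \<Longrightarrow> degen X n j x \<in> cells X (Suc n)"
    and face_face:
      "\<And>n i j x. \<lbrakk>x \<in> cells X (Suc (Suc n)); i < j; j \<le> Suc (Suc n)\<rbrakk> \<Longrightarrow>
        face X (Suc n) i (face X (Suc (Suc n)) j x)
          = face X (Suc n) (j - 1) (face X (Suc (Suc n)) i x)"
    and face_degen_less:
      "\<And>n i j x. \<lbrakk>x \<in> cells X (Suc n); i < j; j \<le> Suc n\<rbrakk> \<Longrightarrow>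
        face X (Suc (Suc n)) i (degen X (Suc n) j x) = degen X n (j - 1) (face X (Suc n) i x)"
    and face_degen_same:
      "\<And>n j x. \<lbrakk>x \<in> cells X n; j \<le> n\<rbrakk> \<Longrightarrow> face X (Suc n) j (degen X n j x) = x"
    and face_degen_Suc:
      "\<And>n j x. \<lbrakk>x \<in> cells X n; j \<le> n\<rbrakk> \<Longrightarrow> face X (Suc n) (Suc j) (degen X n j x) = x"
    and face_degen_greater:
      "\<And>n i j x. \<lbrakk>x \<in> cells X (Suc n); Suc j < i; i \<le> Suc (Suc n)\<rbrakk> \<Longrightarrow>
        face X (Suc (Suc n)) i (degen X (Suc n) j x) = degen X n j (face X (Suc n) (i - 1) x)"
    and degen_degen:
      "\<And>n i j x. \<lbrakk>x \<in> cells X n; i \<le> j; j \<le> n\<rbrakk> \<Longrightarrow>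
        degen X (Suc n) i (degen X n j x) = degen X (Suc n) (Suc j) (degen X n i x)"

definition simplicial_map :: "'a sset \<Rightarrow> 'b sset \<Rightarrow> (nat \<Rightarrow> 'a \<Rightarrow> 'b) \<Rightarrow> bool" where
  "simplicial_map X Y f \<longleftrightarrow>
    (\<forall>n. \<forall>x\<in>cells X n. f n x \<in> cells Y n) \<and>
    (\<forall>n. \<forall>x\<in>cells X (Suc n). \<forall>i\<le>Suc n.
        f n (face X (Suc n) i x) = face Y (Suc n) i (f (Suc n) x)) \<and>
    (\<forall>n. \<forall>x\<in>cells X n. \<forall>j\<le>n.
        f (Suc n) (degen X n j x) = degen Y n j (f n x))"

text \<open>The set of simplicial maps. Its members are required to be \<open>undefined\<close> off the
  simplices of \<open>X\<close>, so that equality in this set is equality of simplicial maps.\<close>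

definition sset_hom :: "'a sset \<Rightarrow> 'b sset \<Rightarrow> (nat \<Rightarrow> 'a \<Rightarrow> 'b) set" where
  "sset_hom X Y = {f. simplicial_map X Y f \<and> (\<forall>n. f n \<in> extensional (cells X n))}"

definition sset_comp ::
    "'a sset \<Rightarrow> (nat \<Rightarrow> 'b \<Rightarrow> 'c) \<Rightarrow> (nat \<Rightarrow> 'a \<Rightarrow> 'b) \<Rightarrow> nat \<Rightarrow> 'a \<Rightarrow> 'c" where
  "sset_comp X g f = (\<lambda>n. \<lambda>x\<in>cells X n. g n (f n x))"

definition sset_prod :: "'a sset \<Rightarrow> 'b sset \<Rightarrow> ('a \<times> 'b) sset" where
  "sset_prod X Y = \<lparr>cells = \<lambda>n. cells X n \<times> cells Y n,
    face = \<lambda>n i. map_prod (face X n i) (face Y n i),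
    degen = \<lambda>n j. map_prod (degen X n j) (degen Y n j)\<rparr>"

text \<open>An \<open>n\<close>-simplex $a_0 \le \dots \le a_n$ of the nerve is a list of length \<open>n + 1\<close>; the face
  map omits an entry and the degeneracy map repeats one.\<close>

definition nerve :: "'a::order set \<Rightarrow> 'a list sset" where
  "nerve A = \<lparr>cells = \<lambda>n. {xs. length xs = Suc n \<and> set xs \<subseteq> A \<and> sorted_wrt (\<le>) xs},
    face = \<lambda>n i xs. take i xs @ drop (Suc i) xs,
    degen = \<lambda>n j xs. take (Suc j) xs @ drop j xs\<rparr>"

definition real_line :: "real list sset" where
  "real_line = nerve UNIV"

definition std_simplex :: "nat \<Rightarrow> nat list sset" where
  "std_simplex n = nerve {..n}"

definition coface :: "nat \<Rightarrow> nat \<Rightarrow> nat" where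
  "coface i k = (if k < i then k else Suc k)"

definition codegen :: "nat \<Rightarrow> nat \<Rightarrow> nat" where
  "codegen j k = (if k \<le> j then k else k - 1)"

definition height_function :: "'a sset \<Rightarrow> (nat \<Rightarrow> 'a \<Rightarrow> real list) \<Rightarrow> bool" where
  "height_function X h \<longleftrightarrow> simplicial_map X real_line h"


section \<open>The section complex\<close>

text \<open>Horizontal operators act on the first index \<open>p\<close>, vertical ones on the second index \<open>q\<close>;
  \<open>hface B p q i\<close> and the others are defined on the \<open>(p, q)\<close>-simplices.\<close>

record 'b bisset =
  bicells :: "nat \<Rightarrow> nat \<Rightarrow> 'b set"
  hface :: "nat \<Rightarrow> nat \<Rightarrow> nat \<Rightarrow> 'b \<Rightarrow> 'b"
  hdegen :: "nat \<Rightarrow> nat \<Rightarrow> nat \<Rightarrow> 'b \<Rightarrow> 'b"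
  vface :: "nat \<Rightarrow> nat \<Rightarrow> nat \<Rightarrow> 'b \<Rightarrow> 'b"
  vdegen :: "nat \<Rightarrow> nat \<Rightarrow> nat \<Rightarrow> 'b \<Rightarrow> 'b"

definition bisset_column :: "'b bisset \<Rightarrow> nat \<Rightarrow> 'b sset" where
  "bisset_column B p = \<lparr>cells = bicells B p, face = vface B p, degen = vdegen B p\<rparr>"

definition bisset_row :: "'b bisset \<Rightarrow> nat \<Rightarrow> 'b sset" where
  "bisset_row B q = \<lparr>cells = \<lambda>p. bicells B p q, face = \<lambda>p. hface B p q,
    degen = \<lambda>p. hdegen B p q\<rparr>"

abbreviation prism :: "nat \<Rightarrow> nat \<Rightarrow> (nat list \<times> nat list) sset" where
  "prism p q \<equiv> sset_prod (std_simplex p) (std_simplex q)"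

text \<open>The \<open>q\<close>-simplices of the space of sections over the \<open>p\<close>-simplex \<open>a\<close> of the real line. As a
  simplicial map out of the standard simplex, \<open>a\<close> sends $(i_0,\dots,i_n)$ to
  $(a_{i_0},\dots,a_{i_n})$, which is the list \<open>map ((!) a) s\<close> for \<open>s\<close> the list of indices.\<close>

definition sections ::
    "'a sset \<Rightarrow> (nat \<Rightarrow> 'a \<Rightarrow> real list) \<Rightarrow> nat \<Rightarrow> real list \<Rightarrow> nat
      \<Rightarrow> (nat \<Rightarrow> nat list \<times> nat list \<Rightarrow> 'a) set" where
  "sections X h p a q = {\<rho> \<in> sset_hom (prism p q) X.
    \<forall>n. \<forall>(s, t) \<in> cells (prism p q) n. h n (\<rho> n (s, t)) = map ((!) a) s}"

text \<open>The coproduct over \<open>a\<close> is a set of pairs \<open>(a, \<rho>)\<close>.\<close>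

definition section_complex ::
    "'a sset \<Rightarrow> (nat \<Rightarrow> 'a \<Rightarrow> real list)
      \<Rightarrow> (real list \<times> (nat \<Rightarrow> nat list \<times> nat list \<Rightarrow> 'a)) bisset" where
  "section_complex X h = \<lparr>
    bicells = \<lambda>p q. SIGMA a : cells real_line p. sections X h p a q,
    hface = \<lambda>p q i (a, \<rho>). (face real_line p i a,
      sset_comp (prism (p - 1) q) \<rho> (\<lambda>n. map_prod (map (coface i)) id)),
    hdegen = \<lambda>p q j (a, \<rho>). (degen real_line p j a,
      sset_comp (prism (Suc p) q) \<rho> (\<lambda>n. map_prod (map (codegen j)) id)),
    vface = \<lambda>p q i (a, \<rho>). (a,
      sset_comp (prism p (q - 1)) \<rho> (\<lambda>n. map_prod id (map (coface i)))),
    vdegen = \<lambda>p q j (a, \<rho>). (a,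
      sset_comp (prism p (Suc q)) \<rho> (\<lambda>n. map_prod id (map (codegen j))))\<rparr>"


section \<open>Vector spaces\<close>

text \<open>The field of coefficients is a type \<open>'k\<close> of class \<open>field\<close>. A vector space is a
  \<open>module\<close> record over the ring record \<open>scalars\<close> of this field. The components \<open>mult\<close> and \<open>one\<close> of a \<open>module\<close> record play no role.\<close>

definition scalars :: "'k::field ring" where
  "scalars = \<lparr>carrier = UNIV, mult = (*), one = 1, zero = 0, add = (+)\<rparr>"

abbreviation subspace_of :: "'v set \<Rightarrow> ('k::field, 'v) module \<Rightarrow> bool" where
  "subspace_of W M \<equiv> submodule W (scalars :: 'k ring) M"

definition span_in :: "('k::field, 'v) module \<Rightarrow> 'v set \<Rightarrow> 'v set" where
  "span_in M S = \<Inter> {W. subspace_of W M \<and> S \<subseteq> W}"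

definition vs_iso :: "('k::field, 'v) module \<Rightarrow> ('k, 'w) module \<Rightarrow> bool" where
  "vs_iso M N \<longleftrightarrow> (\<exists>f. bij_betw f (carrier M) (carrier N) \<and>
    (\<forall>x\<in>carrier M. \<forall>y\<in>carrier M. f (x \<oplus>\<^bsub>M\<^esub> y) = f x \<oplus>\<^bsub>N\<^esub> f y) \<and>
    (\<forall>c. \<forall>x\<in>carrier M. f (c \<odot>\<^bsub>M\<^esub> x) = c \<odot>\<^bsub>N\<^esub> f x))"

text \<open>The quotient \<open>Z / B\<close> for subspaces \<open>B \<subseteq> Z\<close> of \<open>M\<close>, with cosets as elements. In the
  scalar multiplication the union makes \<open>c \<odot> (x + B)\<close> equal to \<open>c \<odot> x + B\<close> also for \<open>c = 0\<close>.\<close>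

definition subquotient :: "('k::field, 'v) module \<Rightarrow> 'v set \<Rightarrow> 'v set \<Rightarrow> ('k, 'v set) module" where
  "subquotient M Z B = \<lparr>carrier = (\<lambda>z. B +>\<^bsub>M\<^esub> z) ` Z, mult = undefined, one = undefined,
    zero = B, add = set_add M, smult = \<lambda>c A. \<Union>x\<in>A. B +>\<^bsub>M\<^esub> (c \<odot>\<^bsub>M\<^esub> x)\<rparr>"

text \<open>The map into a quotient by \<open>B \<subseteq> N\<close> induced on cosets by a linear map \<open>f\<close> into \<open>N\<close>.\<close>

definition induced_map :: "('k::field, 'w) module \<Rightarrow> 'w set \<Rightarrow> ('v \<Rightarrow> 'w) \<Rightarrow> 'v set \<Rightarrow> 'w set" where
  "induced_map N B f A = (\<Union>x\<in>A. B +>\<^bsub>N\<^esub> f x)"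

text \<open>The direct sum over a finite index set \<open>I\<close>.\<close>

definition direct_sum :: "'i set \<Rightarrow> ('i \<Rightarrow> ('k::field, 'v) module) \<Rightarrow> ('k, 'i \<Rightarrow> 'v) module" where
  "direct_sum I M = \<lparr>carrier = (\<Pi>\<^sub>E i\<in>I. carrier (M i)), mult = undefined, one = undefined,
    zero = (\<lambda>i\<in>I. \<zero>\<^bsub>M i\<^esub>), add = (\<lambda>x y. \<lambda>i\<in>I. x i \<oplus>\<^bsub>M i\<^esub> y i),
    smult = (\<lambda>c x. \<lambda>i\<in>I. c \<odot>\<^bsub>M i\<^esub> x i)\<rparr>"

text \<open>The vector space with basis \<open>S\<close>: finitely supported \<open>'k\<close>-valued functions
  with support in \<open>S\<close>.\<close>

definition free_vs :: "'k::field itself \<Rightarrow> 's set \<Rightarrow> ('k, 's \<Rightarrow>\<^sub>0 'k) module" where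
  "free_vs K S = \<lparr>carrier = {x. Poly_Mapping.keys x \<subseteq> S}, mult = undefined, one = undefined,
    zero = 0, add = (+), smult = (\<lambda>c. Poly_Mapping.map ((*) c))\<rparr>"

definition free_map :: "('s \<Rightarrow> 't) \<Rightarrow> ('s \<Rightarrow>\<^sub>0 'k::field) \<Rightarrow> ('t \<Rightarrow>\<^sub>0 'k)" where
  "free_map f x = (\<Sum>s\<in>Poly_Mapping.keys x. Poly_Mapping.single (f s) (Poly_Mapping.lookup x s))"


section \<open>Chain complexes and simplicial vector spaces\<close>

text \<open>In a chain complex \<open>C\<close> the map \<open>bdry C n\<close> goes from \<open>chains C n\<close> to \<open>chains C (n - 1)\<close>;
  the value of \<open>bdry C 0\<close> is irrelevant, every element of degree \<open>0\<close> being a cycle.\<close>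

record ('k, 'v) chain_complex =
  chains :: "nat \<Rightarrow> ('k, 'v) module"
  bdry :: "nat \<Rightarrow> 'v \<Rightarrow> 'v"

definition cycles :: "('k::field, 'v) chain_complex \<Rightarrow> nat \<Rightarrow> 'v set" where
  "cycles C n = {x \<in> carrier (chains C n). n = 0 \<or> bdry C n x = \<zero>\<^bsub>chains C (n - 1)\<^esub>}"

definition boundaries :: "('k::field, 'v) chain_complex \<Rightarrow> nat \<Rightarrow> 'v set" where
  "boundaries C n = bdry C (Suc n) ` carrier (chains C (Suc n))"

definition homology :: "('k::field, 'v) chain_complex \<Rightarrow> nat \<Rightarrow> ('k, 'v set) module" where
  "homology C n = subquotient (chains C n) (cycles C n) (boundaries C n)"

record ('k, 'v) simplicial_vs =
  vspace :: "nat \<Rightarrow> ('k, 'v) module"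
  vs_face :: "nat \<Rightarrow> nat \<Rightarrow> 'v \<Rightarrow> 'v"
  vs_degen :: "nat \<Rightarrow> nat \<Rightarrow> 'v \<Rightarrow> 'v"

definition moore_complex :: "('k::field, 'v) simplicial_vs \<Rightarrow> ('k, 'v) chain_complex" where
  "moore_complex V = \<lparr>chains = vspace V,
    bdry = \<lambda>n x. (\<Oplus>\<^bsub>vspace V (n - 1)\<^esub> i \<in> {..n}. (-1) ^ i \<odot>\<^bsub>vspace V (n - 1)\<^esub> vs_face V n i x)\<rparr>"

definition degenerate_part :: "('k::field, 'v) simplicial_vs \<Rightarrow> nat \<Rightarrow> 'v set" where
  "degenerate_part V n =
    span_in (vspace V n) (\<Union>j<n. vs_degen V (n - 1) j ` carrier (vspace V (n - 1)))"

definition normalized_complex :: "('k::field, 'v) simplicial_vs \<Rightarrow> ('k, 'v set) chain_complex" where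
  "normalized_complex V = \<lparr>
    chains = \<lambda>n. subquotient (vspace V n) (carrier (vspace V n)) (degenerate_part V n),
    bdry = \<lambda>n. induced_map (vspace V (n - 1)) (degenerate_part V (n - 1))
      (bdry (moore_complex V) n)\<rparr>"

definition free_simplicial_vs ::
    "'k::field itself \<Rightarrow> 'a sset \<Rightarrow> ('k, 'a \<Rightarrow>\<^sub>0 'k) simplicial_vs" where
  "free_simplicial_vs K X = \<lparr>vspace = \<lambda>n. free_vs K (cells X n),
    vs_face = \<lambda>n i. free_map (face X n i), vs_degen = \<lambda>n j. free_map (degen X n j)\<rparr>"

definition sset_chains :: "'k::field itself \<Rightarrow> 'a sset \<Rightarrow> ('k, 'a \<Rightarrow>\<^sub>0 'k) chain_complex" where
  "sset_chains K X = moore_complex (free_simplicial_vs K X)"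


section \<open>The Reeb complex\<close>

text \<open>The simplicial vector space $p \mapsto H_q(B_{p,*})$ of a bisimplicial set \<open>B\<close>.\<close>

definition column_homology ::
    "'k::field itself \<Rightarrow> 'b bisset \<Rightarrow> nat \<Rightarrow> ('k, ('b \<Rightarrow>\<^sub>0 'k) set) simplicial_vs" where
  "column_homology K B q = (let C = (\<lambda>p. sset_chains K (bisset_column B p)) in \<lparr>
    vspace = \<lambda>p. homology (C p) q,
    vs_face = \<lambda>p i. induced_map (chains (C (p - 1)) q) (boundaries (C (p - 1)) q)
      (free_map (hface B p q i)),
    vs_degen = \<lambda>p j. induced_map (chains (C (Suc p)) q) (boundaries (C (Suc p)) q)
      (free_map (hdegen B p q j))\<rparr>)"

definition reeb_complex ::
    "'k::field itself \<Rightarrow> 'a sset \<Rightarrow> (nat \<Rightarrow> 'a \<Rightarrow> real list) \<Rightarrow> nat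
      \<Rightarrow> ('k, ((real list \<times> (nat \<Rightarrow> nat list \<times> nat list \<Rightarrow> 'a)) \<Rightarrow>\<^sub>0 'k) set set) chain_complex" where
  "reeb_complex K X h q = normalized_complex (column_homology K (section_complex X h) q)"


section \<open>The spectral sequence of a double complex\<close>

record ('k, 'v) double_complex =
  bichains :: "nat \<Rightarrow> nat \<Rightarrow> ('k, 'v) module"
  hbdry :: "nat \<Rightarrow> nat \<Rightarrow> 'v \<Rightarrow> 'v"
  vbdry :: "nat \<Rightarrow> nat \<Rightarrow> 'v \<Rightarrow> 'v"

text \<open>The horizontal and the vertical differential commute, so the total differential is
  $\partial_h + (-1)^p \partial_v$ on the component $(p,q)$. An element of total degree \<open>n\<close> is the
  family of its components \<open>x i\<close> of bidegree \<open>(i, n - i)\<close>. In degree \<open>0\<close> the total differential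
  is zero by convention, and the value of \<open>tot_bdry C 0\<close> is irrelevant.\<close>

definition tot :: "('k::field, 'v) double_complex \<Rightarrow> nat \<Rightarrow> ('k, nat \<Rightarrow> 'v) module" where
  "tot C n = direct_sum {..n} (\<lambda>i. bichains C i (n - i))"

definition tot_bdry :: "('k::field, 'v) double_complex \<Rightarrow> nat \<Rightarrow> (nat \<Rightarrow> 'v) \<Rightarrow> nat \<Rightarrow> 'v" where
  "tot_bdry C n x = (\<lambda>i\<in>{..<n}.
    hbdry C (Suc i) (n - Suc i) (x (Suc i)) \<oplus>\<^bsub>bichains C i (n - Suc i)\<^esub>
    (-1) ^ i \<odot>\<^bsub>bichains C i (n - Suc i)\<^esub> vbdry C i (n - i) (x i))"

text \<open>The filtration by columns, indexed by all integers.\<close>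

definition filt :: "('k::field, 'v) double_complex \<Rightarrow> int \<Rightarrow> nat \<Rightarrow> (nat \<Rightarrow> 'v) set" where
  "filt C p n = {x \<in> carrier (tot C n). \<forall>i\<le>n. p < int i \<longrightarrow> x i = \<zero>\<^bsub>bichains C i (n - i)\<^esub>}"

text \<open>With $F_p$ the filtration and
  $A^r_p = \{x \in F_p \mid \partial x \in F_{p-r}\}$ in total degree $n = p + q$, the pages are
  $E^r_{p,q} = Z^r_{p,q} / B^r_{p,q}$ where $Z^r_{p,q} = A^r_p + F_{p-1}$ and
  $B^r_{p,q} = \partial A^{r-1}_{p+r-1} + F_{p-1}$. In particular $E^0_{p,q} = F_p / F_{p-1}$. The
  $Z^r$ decrease and the $B^r$ increase with $r$.\<close>

definition approx_cycles ::
    "('k::field, 'v) double_complex \<Rightarrow> int \<Rightarrow> int \<Rightarrow> nat \<Rightarrow> (nat \<Rightarrow> 'v) set" where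
  "approx_cycles C r p n = {x \<in> filt C p n. n = 0 \<or> tot_bdry C n x \<in> filt C (p - r) (n - 1)}"

definition page_cycles ::
    "('k::field, 'v) double_complex \<Rightarrow> nat \<Rightarrow> nat \<Rightarrow> nat \<Rightarrow> (nat \<Rightarrow> 'v) set" where
  "page_cycles C r p q =
    approx_cycles C (int r) (int p) (p + q) <+>\<^bsub>tot C (p + q)\<^esub> filt C (int p - 1) (p + q)"

definition page_boundaries ::
    "('k::field, 'v) double_complex \<Rightarrow> nat \<Rightarrow> nat \<Rightarrow> nat \<Rightarrow> (nat \<Rightarrow> 'v) set" where
  "page_boundaries C r p q =
    tot_bdry C (Suc (p + q)) ` approx_cycles C (int r - 1) (int p + int r - 1) (Suc (p + q))
      <+>\<^bsub>tot C (p + q)\<^esub> filt C (int p - 1) (p + q)"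

definition ss_page ::
    "('k::field, 'v) double_complex \<Rightarrow> nat \<Rightarrow> nat \<Rightarrow> nat \<Rightarrow> ('k, (nat \<Rightarrow> 'v) set) module" where
  "ss_page C r p q = subquotient (tot C (p + q)) (page_cycles C r p q) (page_boundaries C r p q)"

definition ss_infty ::
    "('k::field, 'v) double_complex \<Rightarrow> nat \<Rightarrow> nat \<Rightarrow> ('k, (nat \<Rightarrow> 'v) set) module" where
  "ss_infty C p q =
    subquotient (tot C (p + q)) (\<Inter>r. page_cycles C r p q) (\<Union>r. page_boundaries C r p q)"

text \<open>Convergence: \<open>H n\<close> is the direct sum of the limit terms of total degree \<open>n\<close>, and these are
  the graded pieces of a filtration of \<open>H n\<close> with $F_{-1} = 0$ and $F_n = H_n$.\<close>

definition ss_converges ::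
    "('k::field, 'v) double_complex \<Rightarrow> (nat \<Rightarrow> ('k, 'w) module) \<Rightarrow> bool" where
  "ss_converges C H \<longleftrightarrow> (\<forall>n.
    vs_iso (H n) (direct_sum {..n} (\<lambda>p. ss_infty C p (n - p))) \<and>
    (\<exists>F :: int \<Rightarrow> 'w set.
      (\<forall>p. subspace_of (F p) (H n)) \<and> mono F \<and>
      F (-1) = {\<zero>\<^bsub>H n\<^esub>} \<and> F (int n) = carrier (H n) \<and>
      (\<forall>p\<le>n. vs_iso (subquotient (H n) (F (int p)) (F (int p - 1))) (ss_infty C p (n - p)))))"

definition bisset_double_complex ::
    "'k::field itself \<Rightarrow> 'b bisset \<Rightarrow> ('k, 'b \<Rightarrow>\<^sub>0 'k) double_complex" where
  "bisset_double_complex K B = \<lparr>bichains = \<lambda>p q. free_vs K (bicells B p q),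
    hbdry = \<lambda>p q. bdry (sset_chains K (bisset_row B q)) p,
    vbdry = \<lambda>p q. bdry (sset_chains K (bisset_column B p)) q\<rparr>"

definition section_double_complex ::
    "'k::field itself \<Rightarrow> 'a sset \<Rightarrow> (nat \<Rightarrow> 'a \<Rightarrow> real list)
      \<Rightarrow> ('k, (real list \<times> (nat \<Rightarrow> nat list \<times> nat list \<Rightarrow> 'a)) \<Rightarrow>\<^sub>0 'k) double_complex" where
  "section_double_complex K X h = bisset_double_complex K (section_complex X h)"

end

theory Submission
  imports Defs "HOL-Library.Function_Algebras"
begin

text \<open>The second page is $H_p$ of the unnormalized Moore complex of $p \mapsto H_q((S_h)_p)$; since the
  degenerate part is acyclic, this agrees with the homology of the normalized complex. For the
  limit, filter by rows instead: the \<open>q\<close>-th row consists of the maps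
  $\Delta^p \times \Delta^q \to X$ whose height factors through $\Delta^p$, and contracting $\Delta^q$ onto its last
  vertex does not change heights, so each row is homotopy equivalent to row \<open>0\<close>, which is \<open>X\<close> by the
  Yoneda lemma. Under these equivalences the vertical differentials become alternately zero and
  the identity, so the inclusion of row \<open>0\<close> into the total complex is a quasi-isomorphism.\<close>

section \<open>Presentations of vector spaces\<close>

text \<open>For fixed \<open>q\<close>, the \<open>(p, q)\<close>-simplices are the
  \<open>p\<close>-simplices of a simplicial subset of the mapping space from \<Delta>^q to
  \<open>X\<close>: those whose height does not vary along \<Delta>^q. A homotopy of \<Delta>^q
  therefore acts in the direction of \<open>p\<close>, and it stays inside this subset because the
  height depends only on the coordinate in \<Delta>^p. The last vertex is chosen because it lies
  above every other vertex, so that switching from a vertex to it is monotone. After the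
  contraction, the vertical boundary from row q+1 to row q is an alternating sum of q+2 equal maps,
  hence the identity for odd q and zero for even q. The rows are not compared through a second
  spectral sequence: a total chain is pushed into row 0 by subtracting boundaries, one column at a
  time, which yields both surjectivity and injectivity on homology.\<close>

abbreviation sumset :: "'v::plus set \<Rightarrow> 'v set \<Rightarrow> 'v set" where
  "sumset U V \<equiv> {u + v |u v. u \<in> U \<and> v \<in> V}"

text \<open>All modules occurring in the statement are quotients of subspaces of a few vector spaces
  whose addition is that of a type class. A presentation exhibits \<open>M\<close> as \<open>A / B\<close>, so that
  computations in iterated quotients are carried out on representatives.\<close>

locale presentation = vector_space s
  for s :: "'k::field \<Rightarrow> 'v::ab_group_add \<Rightarrow> 'v" +
  fixes A B :: "'v set" and \<pi> :: "'v \<Rightarrow> 'w" and M :: "('k, 'w) module"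
  assumes subspace_A: "subspace A"
    and subspace_B: "subspace B"
    and B_subset: "B \<subseteq> A"
    and carrier_eq: "carrier M = \<pi> ` A"
    and proj_add: "\<And>x y. x \<in> A \<Longrightarrow> y \<in> A \<Longrightarrow> \<pi> (x + y) = \<pi> x \<oplus>\<^bsub>M\<^esub> \<pi> y"
    and proj_scale: "\<And>c x. x \<in> A \<Longrightarrow> \<pi> (s c x) = c \<odot>\<^bsub>M\<^esub> \<pi> x"
    and proj_eq_zero: "\<And>x. x \<in> A \<Longrightarrow> \<pi> x = \<zero>\<^bsub>M\<^esub> \<longleftrightarrow> x \<in> B"
begin

lemma proj_zero: "\<pi> 0 = \<zero>\<^bsub>M\<^esub>"
  using proj_eq_zero[of 0] subspace_0[OF subspace_A] subspace_0[OF subspace_B] by simp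

lemma abelian_group_M: "abelian_group M"
proof (rule abelian_groupI)
  fix x y z assume "x \<in> carrier M" "y \<in> carrier M" "z \<in> carrier M"
  then obtain a b c where *: "x = \<pi> a" "y = \<pi> b" "z = \<pi> c" "a \<in> A" "b \<in> A" "c \<in> A"
    by (auto simp: carrier_eq)
  show "x \<oplus>\<^bsub>M\<^esub> y \<in> carrier M"
    using * subspace_add[OF subspace_A] by (auto simp: carrier_eq proj_add[symmetric])
  show "x \<oplus>\<^bsub>M\<^esub> y \<oplus>\<^bsub>M\<^esub> z = x \<oplus>\<^bsub>M\<^esub> (y \<oplus>\<^bsub>M\<^esub> z)"
    using * subspace_add[OF subspace_A] by (simp add: proj_add[symmetric] add.assoc)
  show "x \<oplus>\<^bsub>M\<^esub> y = y \<oplus>\<^bsub>M\<^esub> x"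
    using * by (simp add: proj_add[symmetric] add.commute)
next
  fix x assume "x \<in> carrier M"
  then obtain a where *: "x = \<pi> a" "a \<in> A" by (auto simp: carrier_eq)
  show "\<zero>\<^bsub>M\<^esub> \<oplus>\<^bsub>M\<^esub> x = x"
    using * subspace_0[OF subspace_A] by (simp add: proj_zero[symmetric] proj_add[symmetric])
  show "\<exists>y\<in>carrier M. y \<oplus>\<^bsub>M\<^esub> x = \<zero>\<^bsub>M\<^esub>"
  proof
    show "\<pi> (- a) \<in> carrier M" using * subspace_neg[OF subspace_A] by (simp add: carrier_eq)
    show "\<pi> (- a) \<oplus>\<^bsub>M\<^esub> x = \<zero>\<^bsub>M\<^esub>"
      using * subspace_neg[OF subspace_A] by (simp add: proj_zero[symmetric] proj_add[symmetric])
  qed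
next
  show "\<zero>\<^bsub>M\<^esub> \<in> carrier M"
    using subspace_0[OF subspace_A] by (simp add: proj_zero[symmetric] carrier_eq)
qed

lemma proj_neg: "x \<in> A \<Longrightarrow> \<pi> (- x) = \<ominus>\<^bsub>M\<^esub> \<pi> x"
  using subspace_neg[OF subspace_A]
  by (intro abelian_group.minus_equality[OF abelian_group_M, symmetric])
     (auto simp: carrier_eq proj_add[symmetric] proj_zero)

lemma proj_eq_iff:
  assumes "x \<in> A" "y \<in> A" shows "\<pi> x = \<pi> y \<longleftrightarrow> x - y \<in> B"
proof -
  interpret M: abelian_group M by (rule abelian_group_M)
  have eq: "\<pi> (x - y) = \<pi> x \<ominus>\<^bsub>M\<^esub> \<pi> y"
    using assms subspace_neg[OF subspace_A]
    by (simp only: diff_conv_add_uminus proj_add proj_neg a_minus_def)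
  have c: "\<pi> x \<in> carrier M" "\<pi> y \<in> carrier M" using assms by (auto simp: carrier_eq)
  have "\<pi> x = \<pi> y \<longleftrightarrow> \<pi> x \<ominus>\<^bsub>M\<^esub> \<pi> y = \<zero>\<^bsub>M\<^esub>"
    using c by (metis M.minus_equality M.minus_minus a_minus_def M.a_inv_closed M.r_neg)
  then show ?thesis
    using proj_eq_zero[of "x - y"] assms subspace_diff[OF subspace_A] eq by simp
qed

lemma subspace_of_image:
  assumes "subspace W" "W \<subseteq> A"
  shows "subspace_of (\<pi> ` W) M"
proof (unfold_locales)
  show "\<pi> ` W \<subseteq> carrier (add_monoid M)" using assms by (auto simp: carrier_eq)
  show "x \<otimes>\<^bsub>add_monoid M\<^esub> y \<in> \<pi> ` W" if "x \<in> \<pi> ` W" "y \<in> \<pi> ` W" for x y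
    using that assms subspace_add[OF assms(1)]
    by (auto simp: proj_add[symmetric] subset_eq)
  show "\<one>\<^bsub>add_monoid M\<^esub> \<in> \<pi> ` W"
    using subspace_0[OF assms(1)] by (auto simp: proj_zero[symmetric])
  show "inv\<^bsub>add_monoid M\<^esub> x \<in> \<pi> ` W" if x: "x \<in> \<pi> ` W" for x
  proof -
    obtain w where w: "w \<in> W" "x = \<pi> w" using x by auto
    have "\<ominus>\<^bsub>M\<^esub> x \<in> \<pi> ` W"
      using w assms subspace_neg[OF assms(1)] by (auto simp: proj_neg[symmetric] subset_eq)
    then show ?thesis by (simp add: a_inv_def)
  qed
  show "c \<odot>\<^bsub>M\<^esub> x \<in> \<pi> ` W" if "x \<in> \<pi> ` W" for c x
    using that assms subspace_scale[OF assms(1)]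
    by (auto simp: proj_scale[symmetric] subset_eq)
qed

lemma subspace_preimage:
  assumes "subspace_of W M"
  shows "subspace {x \<in> A. \<pi> x \<in> W}"
proof -
  interpret W: submodule W "scalars :: 'k ring" M by (rule assms)
  have "\<zero>\<^bsub>M\<^esub> \<in> W" using W.one_closed by simp
  moreover have "x \<oplus>\<^bsub>M\<^esub> y \<in> W" if "x \<in> W" "y \<in> W" for x y using W.m_closed that by simp
  moreover have "c \<odot>\<^bsub>M\<^esub> x \<in> W" if "x \<in> W" for c x
    using that by (intro W.smult_closed) (auto simp: scalars_def)
  ultimately show ?thesis
    using subspace_A
    by (intro subspaceI) (auto simp: proj_zero proj_add proj_scale subspace_0 subspace_add subspace_scale)
qed

text \<open>A subspace of \<open>M\<close> containing the images pulls back to a subspace of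
  \<open>A\<close> containing \<open>T\<close>, hence containing \<open>span T\<close>. This lets
  the degenerate part of a quotient be computed on representatives.\<close>

lemma span_in_image:
  assumes "T \<subseteq> A"
  shows "span_in M (\<pi> ` T) = \<pi> ` span T"
proof
  have "span T \<subseteq> A" using assms subspace_A by (rule span_minimal)
  then have "subspace_of (\<pi> ` span T) M" by (intro subspace_of_image subspace_span)
  then show "span_in M (\<pi> ` T) \<subseteq> \<pi> ` span T"
    unfolding span_in_def by (intro Inter_lower) (auto intro: span_base)
  show "\<pi> ` span T \<subseteq> span_in M (\<pi> ` T)"
    unfolding span_in_def
  proof (intro Inter_greatest)
    fix W assume "W \<in> {W. subspace_of W M \<and> \<pi> ` T \<subseteq> W}"
    then have "span T \<subseteq> {x \<in> A. \<pi> x \<in> W}"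
      using assms by (intro span_minimal subspace_preimage) auto
    then show "\<pi> ` span T \<subseteq> W" by auto
  qed
qed

lemma finsum_proj:
  assumes "finite I" "\<And>i. i \<in> I \<Longrightarrow> g i \<in> A"
  shows "(\<Oplus>\<^bsub>M\<^esub> i \<in> I. c i \<odot>\<^bsub>M\<^esub> \<pi> (g i)) = \<pi> (\<Sum>i\<in>I. s (c i) (g i))"
  using assms
proof (induction I)
  case empty
  interpret M: abelian_group M by (rule abelian_group_M)
  show ?case by (simp add: proj_zero)
next
  case (insert i I)
  interpret M: abelian_group M by (rule abelian_group_M)
  have cl: "c j \<odot>\<^bsub>M\<^esub> \<pi> (g j) \<in> carrier M" if "j \<in> insert i I" for j
    using that insert.prems subspace_scale[OF subspace_A]
    by (auto simp: proj_scale[symmetric] carrier_eq)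
  have "(\<Oplus>\<^bsub>M\<^esub> i \<in> insert i I. c i \<odot>\<^bsub>M\<^esub> \<pi> (g i))
      = c i \<odot>\<^bsub>M\<^esub> \<pi> (g i) \<oplus>\<^bsub>M\<^esub> (\<Oplus>\<^bsub>M\<^esub> i \<in> I. c i \<odot>\<^bsub>M\<^esub> \<pi> (g i))"
    using insert.hyps cl by (intro M.finsum_insert) auto
  also have "\<dots> = \<pi> (s (c i) (g i)) \<oplus>\<^bsub>M\<^esub> \<pi> (\<Sum>i\<in>I. s (c i) (g i))"
    using insert by (simp add: proj_scale)
  also have "\<dots> = \<pi> (\<Sum>i\<in>insert i I. s (c i) (g i))"
    using insert.hyps insert.prems
    by (subst proj_add[symmetric])
       (auto intro!: subspace_scale[OF subspace_A] subspace_sum[OF subspace_A])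
  finally show ?case .
qed

lemma coset_proj:
  assumes "B1 \<subseteq> A" "x \<in> A"
  shows "(\<pi> ` B1) +>\<^bsub>M\<^esub> \<pi> x = (\<lambda>b. \<pi> (b + x)) ` B1"
  using assms by (auto simp: a_r_coset_def' proj_add subset_eq)

lemma set_add_proj:
  assumes "U \<subseteq> A" "V \<subseteq> A"
  shows "(\<pi> ` U) <+>\<^bsub>M\<^esub> (\<pi> ` V) = \<pi> ` (sumset U V)"
  using assms by (fastforce simp: set_add_def' proj_add[symmetric] subset_eq)

lemma subspace_relative_sum:
  assumes "subspace A1" "subspace B1"
  shows "subspace (A1 \<inter> sumset B1 B)"
  using assms subspace_B by (intro subspace_inter subspace_sums)

text \<open>Flattens a quotient of a quotient: a representative in \<open>A1\<close> dies exactly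
  when it agrees modulo \<open>B\<close> with an element of \<open>B1\<close>. Since
  \<open>A1\<close> may fail to contain \<open>B\<close>, the sum is cut back to
  \<open>A1\<close>.\<close>

lemma presentation_subquotient:
  assumes A1: "subspace A1" "A1 \<subseteq> A" and B1: "subspace B1" "B1 \<subseteq> A1"
  shows "presentation s A1 (A1 \<inter> sumset B1 B)
    (\<lambda>x. (\<pi> ` B1) +>\<^bsub>M\<^esub> \<pi> x) (subquotient M (\<pi> ` A1) (\<pi> ` B1))"
proof (unfold_locales)
  note cp = coset_proj[OF order.trans[OF B1(2) A1(2)]]
  have inA: "x \<in> A" if "x \<in> A1" for x using that A1 by auto
  have B1A: "b \<in> A" if "b \<in> B1" for b using that A1 B1 by auto
  show "subspace A1" by fact
  show "subspace (A1 \<inter> sumset B1 B)"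
    by (intro subspace_relative_sum A1 B1)
  show "carrier (subquotient M (\<pi> ` A1) (\<pi> ` B1)) = (\<lambda>x. \<pi> ` B1 +>\<^bsub>M\<^esub> \<pi> x) ` A1"
    by (simp add: subquotient_def image_image)
  fix x assume x: "x \<in> A1"
  show "\<pi> ` B1 +>\<^bsub>M\<^esub> \<pi> (x + y) = (\<pi> ` B1 +>\<^bsub>M\<^esub> \<pi> x) \<oplus>\<^bsub>subquotient M (\<pi> ` A1) (\<pi> ` B1)\<^esub> (\<pi> ` B1 +>\<^bsub>M\<^esub> \<pi> y)"
    if y: "y \<in> A1" for y
  proof -
    have "(\<pi> ` B1 +>\<^bsub>M\<^esub> \<pi> x) <+>\<^bsub>M\<^esub> (\<pi> ` B1 +>\<^bsub>M\<^esub> \<pi> y)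
        = (\<pi> ` (\<lambda>b. b + x) ` B1) <+>\<^bsub>M\<^esub> (\<pi> ` (\<lambda>b. b + y) ` B1)"
      using x y inA by (simp add: cp image_image)
    also have "\<dots> = \<pi> ` (sumset ((\<lambda>b. b + x) ` B1) ((\<lambda>b. b + y) ` B1))"
      using x y B1 subspace_add[OF A1(1)] by (intro set_add_proj) (auto intro!: inA)
    also have "sumset ((\<lambda>b. b + x) ` B1) ((\<lambda>b. b + y) ` B1) = (\<lambda>b. b + (x + y)) ` B1"
    proof (intro equalityI subsetI)
      fix z assume "z \<in> sumset ((\<lambda>b. b + x) ` B1) ((\<lambda>b. b + y) ` B1)"
      then obtain b c where bc: "b \<in> B1" "c \<in> B1" and z: "z = (b + x) + (c + y)" by auto
      have "z = (b + c) + (x + y)" by (simp add: z algebra_simps)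
      then show "z \<in> (\<lambda>b. b + (x + y)) ` B1" using subspace_add[OF B1(1)] bc by blast
    next
      fix z assume "z \<in> (\<lambda>b. b + (x + y)) ` B1"
      then obtain b where b: "b \<in> B1" and z: "z = (b + x) + (0 + y)" by (auto simp: algebra_simps)
      then show "z \<in> sumset ((\<lambda>b. b + x) ` B1) ((\<lambda>b. b + y) ` B1)"
        using subspace_0[OF B1(1)] by blast
    qed
    also have "\<pi> ` (\<lambda>b. b + (x + y)) ` B1 = \<pi> ` B1 +>\<^bsub>M\<^esub> \<pi> (x + y)"
      using x y inA subspace_add[OF A1(1)] by (simp add: cp image_image)
    finally show ?thesis by (simp add: subquotient_def)
  qed
  show "\<pi> ` B1 +>\<^bsub>M\<^esub> \<pi> (s c x) = c \<odot>\<^bsub>subquotient M (\<pi> ` A1) (\<pi> ` B1)\<^esub> (\<pi> ` B1 +>\<^bsub>M\<^esub> \<pi> x)" for c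
  proof -
    have "(\<Union>z\<in>\<pi> ` B1 +>\<^bsub>M\<^esub> \<pi> x. \<pi> ` B1 +>\<^bsub>M\<^esub> (c \<odot>\<^bsub>M\<^esub> z))
        = (\<Union>b\<in>B1. \<pi> ` B1 +>\<^bsub>M\<^esub> \<pi> (s c (b + x)))"
      using x inA B1A subspace_add[OF subspace_A] by (simp add: cp proj_scale)
    also have "\<dots> = (\<Union>b\<in>B1. (\<lambda>b'. \<pi> (b' + s c (b + x))) ` B1)"
      using x inA B1A subspace_add[OF subspace_A] subspace_scale[OF subspace_A]
      by (simp add: cp)
    \<comment> \<open>The components \<open>b' + s c b\<close> run over all of \<open>B1\<close>,
      also for \<open>c = 0\<close>, where \<open>b'\<close> alone does so.\<close>
    also have "\<dots> = (\<lambda>b'. \<pi> (b' + s c x)) ` B1"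
    proof (intro equalityI subsetI)
      fix z assume "z \<in> (\<Union>b\<in>B1. (\<lambda>b'. \<pi> (b' + s c (b + x))) ` B1)"
      then obtain b b' where b: "b \<in> B1" "b' \<in> B1" "z = \<pi> ((b' + s c b) + s c x)"
        by (auto simp: scale_right_distrib add.assoc)
      then show "z \<in> (\<lambda>b'. \<pi> (b' + s c x)) ` B1"
        using subspace_add[OF B1(1)] subspace_scale[OF B1(1)] by blast
    next
      fix z assume "z \<in> (\<lambda>b'. \<pi> (b' + s c x)) ` B1"
      then obtain b' where "b' \<in> B1" "z = \<pi> (b' + s c (0 + x))" by auto
      then show "z \<in> (\<Union>b\<in>B1. (\<lambda>b'. \<pi> (b' + s c (b + x))) ` B1)"
        using subspace_0[OF B1(1)] by blast
    qed
    also have "\<dots> = \<pi> ` B1 +>\<^bsub>M\<^esub> \<pi> (s c x)"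
      using x inA subspace_scale[OF subspace_A] by (simp add: cp)
    finally show ?thesis by (simp add: subquotient_def)
  qed
  show "\<pi> ` B1 +>\<^bsub>M\<^esub> \<pi> x = \<zero>\<^bsub>subquotient M (\<pi> ` A1) (\<pi> ` B1)\<^esub> \<longleftrightarrow> x \<in> A1 \<inter> sumset B1 B"
  proof -
    have "(\<lambda>b. \<pi> (b + x)) ` B1 = \<pi> ` B1 \<longleftrightarrow> (\<exists>b1\<in>B1. x - b1 \<in> B)"
    proof
      assume eq: "(\<lambda>b. \<pi> (b + x)) ` B1 = \<pi> ` B1"
      have "\<pi> (0 + x) \<in> (\<lambda>b. \<pi> (b + x)) ` B1" using subspace_0[OF B1(1)] by blast
      then have "\<pi> x \<in> \<pi> ` B1" by (simp add: eq)
      then show "\<exists>b1\<in>B1. x - b1 \<in> B" using x inA B1A by (auto simp: proj_eq_iff)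
    next
      assume "\<exists>b1\<in>B1. x - b1 \<in> B"
      then obtain b1 where b1: "b1 \<in> B1" "x - b1 \<in> B" by auto
      have px: "\<pi> (b + x) = \<pi> (b + b1)" if "b \<in> B1" for b
        using that b1 x inA B1A subspace_add[OF subspace_A] by (simp add: proj_eq_iff)
      have "(\<lambda>b. \<pi> (b + x)) ` B1 = (\<lambda>b. \<pi> (b + b1)) ` B1" using px by (intro image_cong) auto
      also have "\<dots> = \<pi> ` B1"
      proof (intro equalityI subsetI)
        fix z assume "z \<in> \<pi> ` B1"
        then obtain b where "b \<in> B1" "z = \<pi> ((b - b1) + b1)" by auto
        then show "z \<in> (\<lambda>b. \<pi> (b + b1)) ` B1" using subspace_diff[OF B1(1)] b1 by blast
      qed (use subspace_add[OF B1(1)] b1 in auto)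
      finally show "(\<lambda>b. \<pi> (b + x)) ` B1 = \<pi> ` B1" .
    qed
    also have "\<dots> \<longleftrightarrow> x \<in> A1 \<inter> sumset B1 B"
    proof -
      have "(x - b1 \<in> B) = (\<exists>b\<in>B. x = b1 + b)" for b1
        by (auto intro: bexI[of _ "x - b1"])
      then show ?thesis using x by auto
    qed
    finally show ?thesis using x inA by (simp add: cp subquotient_def)
  qed
qed (auto simp: subspace_0)

end

section \<open>Comparison of presentations\<close>

text \<open>Choosing a representative of \<open>m\<close> and projecting it to \<open>N\<close> is
  independent of the choice because both sides divide by the same \<open>B\<close>. All isomorphisms
  of the statement arise by presenting both sides with the same pair.\<close>

lemma presentation_same_iso:
  assumes "presentation s A B \<pi> M" "presentation s A B \<rho> N"
  shows "vs_iso M N"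
proof -
  interpret M: presentation s A B \<pi> M by fact
  interpret N: presentation s A B \<rho> N by fact
  define f where "f m = \<rho> (SOME x. x \<in> A \<and> \<pi> x = m)" for m
  have f: "f (\<pi> x) = \<rho> x" if "x \<in> A" for x
  proof -
    define y where "y = (SOME y. y \<in> A \<and> \<pi> y = \<pi> x)"
    have y: "y \<in> A \<and> \<pi> y = \<pi> x"
      unfolding y_def using that someI[of "\<lambda>y. y \<in> A \<and> \<pi> y = \<pi> x" x] by blast
    then have "y - x \<in> B" using that by (simp add: M.proj_eq_iff[symmetric])
    then have "\<rho> y = \<rho> x" using that y by (simp add: N.proj_eq_iff)
    then show ?thesis by (simp add: f_def y_def)
  qed
  show ?thesis unfolding vs_iso_def
  proof (intro exI[of _ f] conjI ballI allI)
    show "bij_betw f (carrier M) (carrier N)"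
      unfolding bij_betw_def inj_on_def M.carrier_eq N.carrier_eq image_image
      by (auto simp: f N.proj_eq_iff M.proj_eq_iff)
    show "f (x \<oplus>\<^bsub>M\<^esub> y) = f x \<oplus>\<^bsub>N\<^esub> f y" if "x \<in> carrier M" "y \<in> carrier M" for x y
      using that M.subspace_add[OF M.subspace_A]
      by (auto simp: M.carrier_eq M.proj_add[symmetric] N.proj_add[symmetric] f)
    show "f (c \<odot>\<^bsub>M\<^esub> x) = c \<odot>\<^bsub>N\<^esub> f x" if "x \<in> carrier M" for x c
      using that M.subspace_scale[OF M.subspace_A]
      by (auto simp: M.carrier_eq M.proj_scale[symmetric] N.proj_scale[symmetric] f)
  qed
qed

text \<open>The conditions make the map from \<open>A' / B'\<close> to \<open>A / B\<close> induced
  by \<open>f\<close> bijective, so composing with \<open>f\<close> moves the presentation to the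
  source.\<close>

lemma presentation_pullback:
  assumes "presentation s A B \<pi> M" "module_hom s' s f"
    and vs: "vector_space s'" and A': "module.subspace s' A'" and B': "module.subspace s' B'" "B' \<subseteq> A'"
    and im: "\<And>x. x \<in> A' \<Longrightarrow> f x \<in> A"
    and surj: "\<And>y. y \<in> A \<Longrightarrow> \<exists>x\<in>A'. y - f x \<in> B"
    and ker: "\<And>x. x \<in> A' \<Longrightarrow> f x \<in> B \<longleftrightarrow> x \<in> B'"
  shows "presentation s' A' B' (\<pi> \<circ> f) M"
proof -
  interpret vector_space s' by fact
  interpret M: presentation s A B \<pi> M by fact
  interpret f: module_hom s' s f by fact
  show ?thesis
  proof (unfold_locales)
    show "carrier M = (\<pi> \<circ> f) ` A'"
    proof (intro equalityI subsetI)
      fix m assume "m \<in> carrier M"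
      then obtain y where y: "y \<in> A" "m = \<pi> y" by (auto simp: M.carrier_eq)
      then obtain x where x: "x \<in> A'" "y - f x \<in> B" using surj by blast
      then have "m = \<pi> (f x)" using y im by (simp add: M.proj_eq_iff)
      then show "m \<in> (\<pi> \<circ> f) ` A'" using x by auto
    qed (auto simp: M.carrier_eq im)
  qed (use assms in \<open>auto simp: f.add f.scale M.proj_add M.proj_scale M.proj_eq_zero\<close>)
qed

text \<open>Here the presentation moves to the target of \<open>f\<close>. Preimages have to be
  chosen, so \<open>g\<close> is linear only modulo \<open>B'\<close>, a defect that
  \<open>\<pi>\<close> does not see.\<close>

lemma presentation_pushforward:
  assumes "presentation s' A' B' \<pi> M" "module_hom s' s f"
    and vs: "vector_space s" and A: "module.subspace s A" and B: "module.subspace s B" "B \<subseteq> A"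
    and im: "\<And>x. x \<in> A' \<Longrightarrow> f x \<in> A"
    and surj: "\<And>y. y \<in> A \<Longrightarrow> \<exists>x\<in>A'. y - f x \<in> B"
    and ker: "\<And>x. x \<in> A' \<Longrightarrow> f x \<in> B \<longleftrightarrow> x \<in> B'"
  shows "\<exists>\<rho>. presentation s A B \<rho> M"
proof -
  interpret vector_space s by fact
  interpret M: presentation s' A' B' \<pi> M by fact
  interpret f: module_hom s' s f by fact
  define g where "g y = (SOME x. x \<in> A' \<and> y - f x \<in> B)" for y
  have g: "g y \<in> A'" "y - f (g y) \<in> B" if "y \<in> A" for y
    using someI_ex[of "\<lambda>x. x \<in> A' \<and> y - f x \<in> B"] surj[OF that] unfolding g_def by blast+
  have g_eq: "\<pi> (g y) = \<pi> x" if "y \<in> A" "x \<in> A'" "y - f x \<in> B" for x y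
  proof -
    have "(y - f x) - (y - f (g y)) \<in> B" by (rule subspace_diff[OF B(1)]) (use g that in auto)
    then have "f (g y - x) \<in> B" by (simp add: f.diff)
    then show ?thesis
      using ker[of "g y - x"] that g M.subspace_diff[OF M.subspace_A] by (simp add: M.proj_eq_iff)
  qed
  have "presentation s A B (\<pi> \<circ> g) M"
  proof (unfold_locales)
    show "carrier M = (\<pi> \<circ> g) ` A"
    proof (intro equalityI subsetI)
      fix m assume "m \<in> carrier M"
      then obtain x where x: "x \<in> A'" "m = \<pi> x" by (auto simp: M.carrier_eq)
      then have "\<pi> (g (f x)) = m" using im B by (intro trans[OF g_eq]) (auto simp: subspace_0)
      then show "m \<in> (\<pi> \<circ> g) ` A" using x im by force
    qed (auto simp: M.carrier_eq g)
    fix x assume x: "x \<in> A"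
    show "(\<pi> \<circ> g) (x + y) = (\<pi> \<circ> g) x \<oplus>\<^bsub>M\<^esub> (\<pi> \<circ> g) y" if y: "y \<in> A" for y
    proof -
      have "(x - f (g x)) + (y - f (g y)) \<in> B" by (rule subspace_add[OF B(1)]) (use x y g in auto)
      then have "\<pi> (g (x + y)) = \<pi> (g x + g y)"
        using x y g A M.subspace_add[OF M.subspace_A]
        by (intro g_eq) (auto simp: f.add subspace_add algebra_simps)
      then show ?thesis using x y g by (simp add: M.proj_add)
    qed
    show "(\<pi> \<circ> g) (s c x) = c \<odot>\<^bsub>M\<^esub> (\<pi> \<circ> g) x" for c
    proof -
      have "s c (x - f (g x)) \<in> B" by (rule subspace_scale[OF B(1)]) (use x g in auto)
      then have "\<pi> (g (s c x)) = \<pi> (s' c (g x))"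
        using x g A M.subspace_scale[OF M.subspace_A]
        by (intro g_eq) (auto simp: f.scale subspace_scale scale_right_diff_distrib)
      then show ?thesis using x g by (simp add: M.proj_scale)
    qed
    have "g x \<in> B' \<longleftrightarrow> x \<in> B"
    proof -
      have "f (g x) \<in> B \<longleftrightarrow> x \<in> B"
      proof
        assume "f (g x) \<in> B"
        then have "(x - f (g x)) + f (g x) \<in> B"
          using subspace_add[OF B(1) g(2)[OF x]] by blast
        then show "x \<in> B" by simp
      next
        assume "x \<in> B"
        then have "x - (x - f (g x)) \<in> B"
          using subspace_diff[OF B(1) _ g(2)[OF x]] by blast
        then show "f (g x) \<in> B" by simp
      qed
      then show ?thesis using ker[of "g x"] g[OF x] by simp
    qed
    then show "(\<pi> \<circ> g) x = \<zero>\<^bsub>M\<^esub> \<longleftrightarrow> x \<in> B"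
      using g[OF x] by (simp add: M.proj_eq_zero)
  qed (use assms in auto)
  then show ?thesis by blast
qed

section \<open>Homology and induced maps on representatives\<close>

text \<open>A complex with terms \<open>A n / B n\<close> has its homology represented in
  \<open>A n\<close>: a cycle is an element whose lifted boundary falls into
  \<open>B (n - 1)\<close>. The lift \<open>d\<close> squares to zero only modulo
  \<open>B\<close>.\<close>

lemma presentation_homology:
  assumes pres: "\<And>n. presentation s (A n) (B n) (\<pi> n) (chains C n)"
    and hom: "\<And>n. module_hom s s (d n)"
    and dA: "\<And>n x. x \<in> A (Suc n) \<Longrightarrow> d (Suc n) x \<in> A n"
    and d_eq: "\<And>n x. x \<in> A (Suc n) \<Longrightarrow> bdry C (Suc n) (\<pi> (Suc n) x) = \<pi> n (d (Suc n) x)"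
    and dd: "\<And>n x. x \<in> A (Suc (Suc n)) \<Longrightarrow> d (Suc n) (d (Suc (Suc n)) x) \<in> B n"
  shows "presentation s {x \<in> A n. n = 0 \<or> d n x \<in> B (n - 1)}
      (sumset (d (Suc n) ` A (Suc n)) (B n))
      (\<lambda>x. boundaries C n +>\<^bsub>chains C n\<^esub> \<pi> n x) (homology C n)"
    and "boundaries C n = \<pi> n ` d (Suc n) ` A (Suc n)"
proof -
  interpret P: presentation s "A n" "B n" "\<pi> n" "chains C n" for n by (rule pres)
  interpret d: module_hom s s "d n" for n by (rule hom)
  let ?Z = "{x \<in> A n. n = 0 \<or> d n x \<in> B (n - 1)}"
  have Z: "P.subspace ?Z"
  proof (cases n)
    case 0
    then show ?thesis using P.subspace_A[of 0] by simp
  next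
    case (Suc m)
    have "P.subspace (A n \<inter> {x. d n x \<in> B m})"
      by (intro P.subspace_inter P.subspace_A d.subspace_linear_preimage P.subspace_B)
    moreover have "?Z = A n \<inter> {x. d n x \<in> B m}" using Suc by auto
    ultimately show ?thesis by simp
  qed
  have cyc: "cycles C n = \<pi> n ` ?Z"
  proof -
    have "n = 0 \<or> bdry C n (\<pi> n x) = \<zero>\<^bsub>chains C (n - 1)\<^esub> \<longleftrightarrow> n = 0 \<or> d n x \<in> B (n - 1)" if "x \<in> A n" for x
      using that by (cases n) (auto simp: d_eq dA P.proj_eq_zero)
    then show ?thesis unfolding cycles_def P.carrier_eq by auto
  qed
  show bd: "boundaries C n = \<pi> n ` d (Suc n) ` A (Suc n)"
    unfolding boundaries_def P.carrier_eq image_image by (intro image_cong refl d_eq)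
  have sub: "d (Suc n) ` A (Suc n) \<subseteq> ?Z"
    using dA dd by (cases n) auto
  have eq: "?Z \<inter> sumset (d (Suc n) ` A (Suc n)) (B n)
      = sumset (d (Suc n) ` A (Suc n)) (B n)" if "\<And>m x. n = Suc m \<Longrightarrow> x \<in> B n \<Longrightarrow> d n x \<in> B m"
  proof -
    have "B n \<subseteq> ?Z" using that P.B_subset[of n] by (cases n) auto
    then have "sumset (d (Suc n) ` A (Suc n)) (B n) \<subseteq> ?Z"
      using sub P.subspace_add[OF Z] by blast
    then show ?thesis by blast
  qed
  \<comment> \<open>An element of \<open>B n\<close> has the same projection as \<open>0\<close>,
    and \<open>bdry\<close> sees only the projection; hence \<open>d\<close> maps it into the next
    denominator.\<close>
  have dB: "d n x \<in> B m" if "n = Suc m" "x \<in> B n" for m x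
  proof -
    have "\<pi> m (d n x) = bdry C n (\<pi> n x)" using that d_eq[of x m] P.B_subset[of n] by auto
    also have "\<pi> n x = \<pi> n 0" using that P.B_subset[of n] by (metis P.proj_eq_zero P.proj_zero subsetD)
    also have "bdry C n (\<pi> n 0) = \<pi> m (d n 0)"
      using that d_eq[of 0 m] P.subspace_0[OF P.subspace_A] by simp
    finally have "\<pi> m (d n x) = \<zero>\<^bsub>chains C m\<^esub>" by (simp add: P.proj_zero)
    then show ?thesis using that dA[of x m] P.B_subset[of n] by (auto simp: P.proj_eq_zero)
  qed
  have "presentation s ?Z (?Z \<inter> sumset (d (Suc n) ` A (Suc n)) (B n))
      (\<lambda>x. boundaries C n +>\<^bsub>chains C n\<^esub> \<pi> n x) (homology C n)"
    unfolding homology_def cyc bd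
    by (rule P.presentation_subquotient[OF Z _ d.subspace_image[OF P.subspace_A] sub]) auto
  then show "presentation s ?Z (sumset (d (Suc n) ` A (Suc n)) (B n))
      (\<lambda>x. boundaries C n +>\<^bsub>chains C n\<^esub> \<pi> n x) (homology C n)"
    using eq[OF dB] by simp
qed

text \<open>The union over a coset collapses to a single coset because \<open>g\<close> carries
  \<open>B1\<close> into \<open>B1'\<close>.\<close>

lemma induced_map_proj:
  assumes "presentation s A B \<pi> M" "presentation s' A' B' \<pi>' N"
    and hom: "module_hom s s' g"
    and A1: "A1 \<subseteq> A" and B1: "module.subspace s B1" "B1 \<subseteq> A"
    and B1': "module.subspace s' B1'" "B1' \<subseteq> A'"
    and f: "\<And>y. y \<in> A \<Longrightarrow> f (\<pi> y) = \<pi>' (g y)"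
    and g: "\<And>y. y \<in> A \<Longrightarrow> g y \<in> A'" "\<And>y. y \<in> B1 \<Longrightarrow> g y \<in> B1'"
    and x: "x \<in> A"
  shows "induced_map N (\<pi>' ` B1') f ((\<pi> ` B1) +>\<^bsub>M\<^esub> \<pi> x) = (\<pi>' ` B1') +>\<^bsub>N\<^esub> \<pi>' (g x)"
proof -
  interpret M: presentation s A B \<pi> M by fact
  interpret N: presentation s' A' B' \<pi>' N by fact
  interpret g: module_hom s s' g by fact
  have inA: "b + x \<in> A" if "b \<in> B1" for b using that B1 x M.subspace_add[OF M.subspace_A] by auto
  have "induced_map N (\<pi>' ` B1') f ((\<pi> ` B1) +>\<^bsub>M\<^esub> \<pi> x)
      = (\<Union>b\<in>B1. (\<lambda>b'. \<pi>' (b' + g (b + x))) ` B1')"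
    using inA x B1 B1' g unfolding induced_map_def by (simp add: M.coset_proj f N.coset_proj)
  also have "\<dots> = (\<lambda>b'. \<pi>' (b' + g x)) ` B1'"
  proof (intro equalityI subsetI)
    fix z assume "z \<in> (\<Union>b\<in>B1. (\<lambda>b'. \<pi>' (b' + g (b + x))) ` B1')"
    then obtain b b' where "b \<in> B1" "b' \<in> B1'" "z = \<pi>' ((b' + g b) + g x)"
      by (auto simp: g.add add.assoc)
    then show "z \<in> (\<lambda>b'. \<pi>' (b' + g x)) ` B1'" using N.subspace_add[OF B1'(1)] g(2) by blast
  next
    fix z assume "z \<in> (\<lambda>b'. \<pi>' (b' + g x)) ` B1'"
    then obtain b' where "b' \<in> B1'" "z = \<pi>' (b' + g (0 + x))" by auto
    then show "z \<in> (\<Union>b\<in>B1. (\<lambda>b'. \<pi>' (b' + g (b + x))) ` B1')"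
      using M.subspace_0[OF B1(1)] by blast
  qed
  finally show ?thesis using B1' x g by (simp add: N.coset_proj)
qed

section \<open>Finite direct sums and graded pieces of filtrations\<close>

definition fun_scale :: "('k \<Rightarrow> 'v \<Rightarrow> 'v) \<Rightarrow> 'k \<Rightarrow> ('i \<Rightarrow> 'v) \<Rightarrow> 'i \<Rightarrow> 'v" where
  "fun_scale s c x = (\<lambda>i. s c (x i))"

lemma fun_scale_apply [simp]: "fun_scale s c x i = s c (x i)"
  by (simp add: fun_scale_def)

lemma fun_minus_apply [simp]: "(x - y) i = x i - (y i :: 'v::ab_group_add)"
  by (simp add: fun_diff_def)

lemma fun_sum_apply [simp]: "sum f I i = (\<Sum>j\<in>I. f j i :: 'v::ab_group_add)"
  by (induction I rule: infinite_finite_induct) auto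

lemma vector_space_fun_scale: "vector_space s \<Longrightarrow> vector_space (fun_scale s)"
  unfolding vector_space_def by (auto simp: fun_eq_iff)

lemma (in vector_space) vector_space_scale: "vector_space scale"
  by unfold_locales

text \<open>Vanishing beyond \<open>n\<close>, instead of being \<open>undefined\<close> there,
  makes these families closed under the pointwise operations.\<close>

abbreviation families :: "nat \<Rightarrow> (nat \<Rightarrow> 'v::zero set) \<Rightarrow> (nat \<Rightarrow> 'v) set" where
  "families n A \<equiv> {x. (\<forall>i\<le>n. x i \<in> A i) \<and> (\<forall>i>n. x i = 0)}"

lemma presentation_direct_sum:
  fixes n :: nat
  assumes pres: "\<And>i. i \<le> n \<Longrightarrow> presentation s (A i) (B i) (\<pi> i) (M i)"
  shows "presentation (fun_scale s) (families n A)
    (families n B) (\<lambda>x. \<lambda>i\<in>{..n}. \<pi> i (x i)) (direct_sum {..n} M)"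
proof -
  interpret vector_space s using pres[of 0] by (simp add: presentation_def)
  interpret F: vector_space "fun_scale s :: 'a \<Rightarrow> (nat \<Rightarrow> 'b) \<Rightarrow> nat \<Rightarrow> 'b"
    by (rule vector_space_fun_scale[OF vector_space_scale])
  note P = presentation.subspace_A[OF pres] presentation.subspace_B[OF pres]
    presentation.B_subset[OF pres] presentation.carrier_eq[OF pres]
    presentation.proj_add[OF pres] presentation.proj_scale[OF pres]
    presentation.proj_eq_zero[OF pres]
  have sub: "F.subspace (families n A)"
    if "\<And>i. i \<le> n \<Longrightarrow> subspace (A i)" for A
    using that by (intro F.subspaceI) (auto simp: subspace_0 subspace_add subspace_scale)
  show ?thesis
  proof unfold_locales
    show "carrier (direct_sum {..n} M)
        = (\<lambda>x. \<lambda>i\<in>{..n}. \<pi> i (x i)) ` families n A"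
    proof (intro equalityI subsetI)
      fix m assume "m \<in> carrier (direct_sum {..n} M)"
      then have m: "m \<in> (\<Pi>\<^sub>E i\<in>{..n}. carrier (M i))" by (simp add: direct_sum_def)
      have "\<forall>i\<in>{..n}. \<exists>x\<in>A i. m i = \<pi> i x" using m P(4) by fastforce
      then obtain g where g: "\<forall>i\<in>{..n}. g i \<in> A i \<and> m i = \<pi> i (g i)" by metis
      have "m = (\<lambda>i\<in>{..n}. \<pi> i ((\<lambda>i. if i \<le> n then g i else 0) i))"
        using g m by (auto simp: fun_eq_iff PiE_def extensional_def restrict_def)
      then show "m \<in> (\<lambda>x. \<lambda>i\<in>{..n}. \<pi> i (x i)) ` families n A"
        using g by (intro image_eqI[where x = "\<lambda>i. if i \<le> n then g i else 0"]) auto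
    qed (auto simp: direct_sum_def P(4) split: if_splits)
  qed (use P sub in \<open>auto simp: direct_sum_def fun_eq_iff restrict_def subset_eq\<close>)
qed

text \<open>Over a field the identity of \<open>B\<close> extends to a linear projection
  \<open>g\<close> onto \<open>B\<close>; the part of its kernel in \<open>A\<close> is the
  complement.\<close>

lemma (in vector_space) exists_complement:
  assumes "subspace A" "subspace B" "B \<subseteq> A"
  obtains U where "subspace U" "U \<subseteq> A" "U \<inter> B = {0}" "\<And>a. a \<in> A \<Longrightarrow> \<exists>u\<in>U. a - u \<in> B"
proof -
  interpret vector_space_pair scale scale by unfold_locales
  have "module_hom scale scale id" by unfold_locales auto
  then obtain g where g: "range g \<subseteq> B" "module_hom scale scale g" "\<And>v. v \<in> B \<Longrightarrow> g v = v"
    using linear_exists_left_inverse_on[of id B] assms(2)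
    by (auto simp: linear_iff_module_hom)
  interpret g: module_hom scale scale g by (rule g)
  show ?thesis
  proof
    show "subspace (A \<inter> {x. g x = 0})" by (intro subspace_inter assms g.subspace_kernel)
    show "(A \<inter> {x. g x = 0}) \<inter> B = {0}"
      using g(3) subspace_0[OF assms(1)] subspace_0[OF assms(2)] by fastforce
    fix a assume "a \<in> A"
    then have "a - g a \<in> A \<inter> {x. g x = 0}"
      using g assms subspace_diff[OF assms(1)] by (auto simp: g.diff subset_eq)
    moreover have "a - (a - g a) \<in> B" using g(1) by auto
    ultimately show "\<exists>u\<in>A \<inter> {x. g x = 0}. a - u \<in> B" by blast
  qed auto
qed

text \<open>A finite filtration of vector spaces splits: with complements \<open>U i\<close> of
  \<open>G i\<close> in \<open>G (Suc i)\<close>, adding up components identifies the families in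
  \<open>U\<close> with the top of the filtration modulo the bottom.\<close>

lemma vs_iso_direct_sum_graded:
  fixes n :: nat
  assumes sub: "\<And>i. module.subspace s (G i)" and mono: "\<And>i. G i \<subseteq> G (Suc i)"
    and M: "presentation s (G (Suc n)) (G 0) \<pi> M"
    and N: "\<And>i. i \<le> n \<Longrightarrow> presentation s (G (Suc i)) (G i) (\<rho> i) (N i)"
  shows "vs_iso M (direct_sum {..n} N)"
proof -
  interpret vector_space s using M by (simp add: presentation_def)
  interpret F: vector_space "fun_scale s :: 'a \<Rightarrow> (nat \<Rightarrow> 'b) \<Rightarrow> nat \<Rightarrow> 'b"
    by (rule vector_space_fun_scale[OF vector_space_scale])
  have "\<exists>U. subspace U \<and> U \<subseteq> G (Suc i) \<and> U \<inter> G i = {0} \<and> (\<forall>a\<in>G (Suc i). \<exists>u\<in>U. a - u \<in> G i)" for i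
    using exists_complement[OF sub sub mono] by metis
  then obtain U where U: "\<And>i. subspace (U i)" "\<And>i. U i \<subseteq> G (Suc i)" "\<And>i. U i \<inter> G i = {0}"
    "\<And>i a. a \<in> G (Suc i) \<Longrightarrow> \<exists>u\<in>U i. a - u \<in> G i"
    by metis
  have mono': "i \<le> j \<Longrightarrow> G i \<subseteq> G j" for i j using mono by (rule lift_Suc_mono_le)
  have hom_id: "module_hom s s id" by unfold_locales auto
  have "presentation s (U i) {0} (\<rho> i \<circ> id) (N i)" if "i \<le> n" for i
    using U(1,2,4) U(3)[of i] subspace_0[OF sub] subspace_0[OF U(1)]
    by (intro presentation_pullback[OF N[OF that] hom_id vector_space_scale]) auto
  then have pres: "presentation (fun_scale s) (families n U)
      (families n (\<lambda>_. {0})) (\<lambda>x. \<lambda>i\<in>{..n}. (\<rho> i \<circ> id) (x i)) (direct_sum {..n} N)"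
    by (rule presentation_direct_sum)
  have hom: "module_hom (fun_scale s) s (\<lambda>x. \<Sum>i\<le>n. x i)"
    by unfold_locales (auto simp: sum.distrib scale_sum_right)
  \<comment> \<open>Peel off the component in \<open>U m\<close> and continue with the remainder,
    which lies one filtration step lower.\<close>
  have surj: "\<exists>x. (\<forall>i\<le>n. x i \<in> U i) \<and> (\<forall>i>n. x i = 0) \<and> (\<forall>i\<ge>m. x i = 0) \<and> y - (\<Sum>i\<le>n. x i) \<in> G 0"
    if "m \<le> Suc n" "y \<in> G m" for m y
    using that
  proof (induction m arbitrary: y)
    case 0
    then show ?case using U(1) by (intro exI[of _ "\<lambda>_. 0"]) (auto simp: subspace_0)
  next
    case (Suc m)
    then obtain u where u: "u \<in> U m" "y - u \<in> G m" using U(4) by blast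
    then obtain x where x: "\<forall>i\<le>n. x i \<in> U i" "\<forall>i>n. x i = 0" "\<forall>i\<ge>m. x i = 0"
      "(y - u) - (\<Sum>i\<le>n. x i) \<in> G 0" using Suc by force
    have "(\<Sum>i\<le>n. (x(m := u)) i) = u + (\<Sum>i\<in>{..n}-{m}. (x(m := u)) i)"
      using Suc.prems by (subst sum.remove[of _ m]) auto
    also have "(\<Sum>i\<in>{..n}-{m}. (x(m := u)) i) = (\<Sum>i\<in>{..n}-{m}. x i)" by (intro sum.cong) auto
    also have "\<dots> = (\<Sum>i\<le>n. x i)" using x Suc.prems by (subst sum.remove[of "{..n}" m]) auto
    finally have "y - (\<Sum>i\<le>n. (x(m := u)) i) \<in> G 0" using x by (simp add: diff_diff_eq)
    then show ?case using x u Suc.prems by (intro exI[of _ "x(m := u)"]) auto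
  qed
  \<comment> \<open>Read from the top: once all components above \<open>m\<close> vanish,
    \<open>x m\<close> lies in \<open>G m\<close> as well as in the complement
    \<open>U m\<close>.\<close>
  have ker: "x = 0"
    if x: "\<forall>i\<le>n. x i \<in> U i" "\<forall>i>n. x i = 0" "(\<Sum>i\<le>n. x i) \<in> G 0" for x
  proof -
    have "\<forall>i\<ge>m. x i = 0" if "m \<le> Suc n" for m using that
    proof (induction m rule: inc_induct)
      case base
      then show ?case using x by auto
    next
      case (step m)
      have "(\<Sum>i\<le>n. x i) = (\<Sum>i\<le>m. x i)"
        using step by (intro sum.mono_neutral_right) auto
      also have "\<dots> = x m + (\<Sum>i<m. x i)" by (simp add: lessThan_Suc_atMost[symmetric] add.commute)
      finally have "x m = (\<Sum>i\<le>n. x i) - (\<Sum>i<m. x i)" by (simp add: algebra_simps)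
      moreover have "(\<Sum>i<m. x i) \<in> G m"
      proof (rule subspace_sum[OF sub])
        fix i assume "i \<in> {..<m}"
        then have "i \<le> n" "Suc i \<le> m" using step by auto
        then show "x i \<in> G m" using x(1) U(2)[of i] mono'[of "Suc i" m] by blast
      qed
      ultimately have "x m \<in> G m" using x(3) mono'[of 0 m] subspace_diff[OF sub] by auto
      then have "x m = 0" using x(1) step U(3)[of m] by auto
      then have "x i = 0" if "m \<le> i" for i using step that by (cases "i = m") auto
      then show ?case by simp
    qed
    then show ?thesis by (auto simp: fun_eq_iff)
  qed
  have "\<exists>\<sigma>. presentation s (G (Suc n)) (G 0) \<sigma> (direct_sum {..n} N)"
  proof (rule presentation_pushforward[OF pres hom vector_space_scale])
    fix x assume "x \<in> families n U"
    then have "x i \<in> G (Suc n)" if "i \<le> n" for i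
      using that U(2)[of i] mono'[of "Suc i" "Suc n"] by blast
    then show "(\<Sum>i\<le>n. x i) \<in> G (Suc n)" by (intro subspace_sum[OF sub]) auto
  next
    fix x assume x: "x \<in> families n U"
    then show "(\<Sum>i\<le>n. x i) \<in> G 0 \<longleftrightarrow> x \<in> families n (\<lambda>_. {0})"
      using ker[of x] subspace_0[OF sub[of 0]] by auto
  next
    fix y assume "y \<in> G (Suc n)"
    then show "\<exists>x\<in>families n U. y - (\<Sum>i\<le>n. x i) \<in> G 0"
      using surj[of "Suc n" y] by auto
  next
    show "subspace (G (Suc n))" "subspace (G 0)" by (rule sub)+
    show "G 0 \<subseteq> G (Suc n)" by (rule mono') simp
  qed
  then obtain \<sigma> where "presentation s (G (Suc n)) (G 0) \<sigma> (direct_sum {..n} N)" ..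
  with M show ?thesis by (rule presentation_same_iso)
qed

section \<open>Free vector spaces\<close>

abbreviation pscale :: "'k::field \<Rightarrow> ('s \<Rightarrow>\<^sub>0 'k) \<Rightarrow> 's \<Rightarrow>\<^sub>0 'k" where
  "pscale c \<equiv> Poly_Mapping.map ((*) c)"

lemma lookup_pscale [simp]: "Poly_Mapping.lookup (pscale c x) i = c * Poly_Mapping.lookup x i"
  by (simp add: Poly_Mapping.map.rep_eq when_def)

interpretation pscale: vector_space pscale
  by unfold_locales (auto intro!: poly_mapping_eqI simp: lookup_add algebra_simps)

definition supported :: "'s set \<Rightarrow> ('s \<Rightarrow>\<^sub>0 'k::field) set" where
  "supported S = {x. Poly_Mapping.keys x \<subseteq> S}"

lemma subspace_supported: "pscale.subspace (supported S :: ('s \<Rightarrow>\<^sub>0 'k::field) set)"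
proof (rule pscale.subspaceI)
  fix x y :: "'s \<Rightarrow>\<^sub>0 'k::field" assume "x \<in> supported S" "y \<in> supported S"
  then show "x + y \<in> supported S" using keys_add[of x y] by (auto simp: supported_def)
qed (auto simp: supported_def in_keys_iff)

lemma presentation_free_vs: "presentation pscale (supported S) {0} id (free_vs K S)"
  by unfold_locales (use subspace_supported pscale.subspace_0[OF subspace_supported] in
    \<open>auto simp: free_vs_def supported_def\<close>)

text \<open>The support of a sum or multiple may shrink by cancellation; a fixed finite superset
  makes linearity a termwise matter.\<close>

lemma free_map_eq:
  assumes "finite S" "Poly_Mapping.keys x \<subseteq> S"
  shows "free_map f x = (\<Sum>a\<in>S. Poly_Mapping.single (f a) (Poly_Mapping.lookup x a))"
  unfolding free_map_def using assms
  by (intro sum.mono_neutral_left) (auto simp: in_keys_iff)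

lemma module_hom_free_map: "module_hom pscale pscale (free_map f :: ('s \<Rightarrow>\<^sub>0 'k::field) \<Rightarrow> 't \<Rightarrow>\<^sub>0 'k)"
proof unfold_locales
  fix x y :: "'s \<Rightarrow>\<^sub>0 'k" and c
  let ?S = "Poly_Mapping.keys x \<union> Poly_Mapping.keys y"
  show "free_map f (x + y) = free_map f x + free_map f y"
    using keys_add[of x y]
    by (simp add: free_map_eq[of ?S] lookup_add single_add sum.distrib)
  have "Poly_Mapping.keys (pscale c x) \<subseteq> Poly_Mapping.keys x"
    by (auto simp: in_keys_iff)
  then show "free_map f (pscale c x) = pscale c (free_map f x)"
    by (simp add: free_map_eq[of "Poly_Mapping.keys x"] pscale.scale_sum_right map_single)
qed

interpretation free_map: module_hom pscale pscale "free_map f" for f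
  by (rule module_hom_free_map)

lemma free_map_single [simp]: "free_map f (Poly_Mapping.single a c) = Poly_Mapping.single (f a) c"
  by (simp add: free_map_def)

lemma free_map_free_map: "free_map f (free_map g x) = free_map (\<lambda>a. f (g a)) x"
  by (subst (2) free_map_def, subst (2) free_map_def) (simp add: free_map.sum)

lemma free_map_cong:
  "(\<And>a. a \<in> Poly_Mapping.keys x \<Longrightarrow> f a = g a) \<Longrightarrow> free_map f x = free_map g x"
  unfolding free_map_def by (intro sum.cong) auto

lemma free_map_ident:
  assumes "\<And>a. a \<in> Poly_Mapping.keys x \<Longrightarrow> f a = a"
  shows "free_map f x = x"
proof -
  have "free_map f x = free_map (\<lambda>a. a) x" by (rule free_map_cong) (rule assms)
  also have "\<dots> = x"
    by (rule poly_mapping_eqI)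
      (auto simp: free_map_def lookup_sum lookup_single when_def in_keys_iff if_distrib
        sum.delta' cong: if_cong)
  finally show ?thesis .
qed

lemma free_map_supported:
  assumes "x \<in> supported S" "\<And>a. a \<in> S \<Longrightarrow> f a \<in> T"
  shows "free_map f x \<in> supported T"
  unfolding free_map_def
  by (rule pscale.subspace_sum[OF subspace_supported]) (use assms in \<open>auto simp: supported_def\<close>)

section \<open>Alternating sums\<close>

context vector_space
begin

text \<open>With \<open>T i j\<close> read as the double face \<open>d_i d_j\<close>, a term with
  \<open>i < j\<close> is matched with the term at \<open>(j - 1, i)\<close>, whose sign is
  opposite.\<close>

lemma alternating_sum_zero:
  fixes n :: nat
  assumes "\<And>i j. i < j \<Longrightarrow> j \<le> Suc n \<Longrightarrow> T i j = T (j - 1) i"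
  shows "(\<Sum>i\<le>n. \<Sum>j\<le>Suc n. (-1) ^ (i + j) *s T i j) = 0"
proof -
  let ?f = "\<lambda>(i, j). (-1) ^ (i + j) *s T i j"
  let ?L = "{(i, j). i < j \<and> j \<le> Suc n}" and ?R = "{(i, j). j \<le> i \<and> i \<le> n}"
  have fin: "finite ?L" "finite ?R"
    by (rule finite_subset[of _ "{..Suc n} \<times> {..Suc n}"]; auto)+
  have "(\<Sum>i\<le>n. \<Sum>j\<le>Suc n. (-1) ^ (i + j) *s T i j) = sum ?f ({..n} \<times> {..Suc n})"
    by (rule sum.cartesian_product)
  also have "{..n} \<times> {..Suc n} = ?L \<union> ?R" by auto
  also have "sum ?f (?L \<union> ?R) = sum ?f ?L + sum ?f ?R"
    using fin by (intro sum.union_disjoint) auto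
  also have "sum ?f ?L = (\<Sum>x\<in>?R. - ?f x)"
  proof (rule sum.reindex_bij_witness[of _ "\<lambda>(i, j). (j, Suc i)" "\<lambda>(i, j). (j - 1, i)"])
    fix x assume "x \<in> ?L"
    then obtain i j where x: "x = (i, Suc j)" "i \<le> j" "j \<le> n"
      by (cases x; cases "snd x") auto
    then show "- ?f ((\<lambda>(i, j). (j - 1, i)) x) = ?f x"
      using assms[of i "Suc j"] by (simp add: add.commute)
  qed auto
  finally show ?thesis by (simp add: sum_negf)
qed

text \<open>Here \<open>T i j\<close> is the \<open>i\<close>-th face of the \<open>j\<close>-th
  prism and \<open>U i j\<close> a prism built on a face. Terms off the two diagonals
  \<open>i = j\<close> and \<open>i = Suc j\<close> become \<open>U\<close> terms after shifting one
  index, hence with one change of sign; the diagonals survive.\<close>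

lemma alternating_sum_homotopy:
  fixes p :: nat
  assumes L: "\<And>i j. i < j \<Longrightarrow> j \<le> p \<Longrightarrow> T i j = U i (j - 1)"
    and R: "\<And>i j. Suc j < i \<Longrightarrow> i \<le> Suc p \<Longrightarrow> T i j = U (i - 1) j"
  shows "(\<Sum>i\<le>Suc p. \<Sum>j\<le>p. (-1) ^ (i + j) *s T i j)
    = (\<Sum>j\<le>p. T j j - T (Suc j) j) - (\<Sum>i\<le>p. \<Sum>j<p. (-1) ^ (i + j) *s U i j)"
proof -
  let ?f = "\<lambda>(i, j). (-1) ^ (i + j) *s T i j" and ?g = "\<lambda>(i, j). (-1) ^ (i + j) *s U i j"
  let ?D = "(\<lambda>j. (j, j)) ` {..p}" and ?D' = "(\<lambda>j. (Suc j, j)) ` {..p}"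
  let ?L = "{(i, j). i < j \<and> j \<le> p}" and ?R = "{(i, j). Suc j < i \<and> i \<le> Suc p}"
  let ?L' = "{(i, j). i \<le> j \<and> j < p}" and ?R' = "{(i, j). j < i \<and> i \<le> p}"
  have fin: "finite ?L" "finite ?R" "finite ?L'" "finite ?R'"
    by (rule finite_subset[of _ "{..Suc p} \<times> {..Suc p}"]; auto)+
  have "(\<Sum>i\<le>Suc p. \<Sum>j\<le>p. (-1) ^ (i + j) *s T i j) = sum ?f ({..Suc p} \<times> {..p})"
    by (rule sum.cartesian_product)
  also have "{..Suc p} \<times> {..p} = (?D \<union> ?D') \<union> (?L \<union> ?R)"
  proof -
    have "(a, b) \<in> (?D \<union> ?D') \<union> (?L \<union> ?R)" if "b \<le> p" "a \<le> Suc p" for a b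
      using that by (cases "a = b"; cases "a = Suc b") (auto simp: image_iff)
    then show ?thesis by auto
  qed
  also have "sum ?f \<dots> = sum ?f ?D + sum ?f ?D' + (sum ?f ?L + sum ?f ?R)"
  proof -
    have "sum ?f (?D \<union> ?D') = sum ?f ?D + sum ?f ?D'" by (intro sum.union_disjoint) auto
    moreover have "sum ?f (?L \<union> ?R) = sum ?f ?L + sum ?f ?R"
      using fin by (intro sum.union_disjoint) auto
    ultimately show ?thesis using fin by (subst sum.union_disjoint) auto
  qed
  also have "sum ?f ?D = (\<Sum>j\<le>p. T j j)"
    by (subst sum.reindex) (auto simp: inj_on_def o_def simp flip: mult_2)
  also have "sum ?f ?D' = (\<Sum>j\<le>p. - T (Suc j) j)"
    by (subst sum.reindex) (auto simp: inj_on_def o_def simp flip: mult_2)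
  also have "sum ?f ?L = (\<Sum>x\<in>?L'. - ?g x)"
  proof (rule sum.reindex_bij_witness[of _ "\<lambda>(i, j). (i, Suc j)" "\<lambda>(i, j). (i, j - 1)"])
    fix x assume "x \<in> ?L"
    then obtain i j where "x = (i, Suc j)" "i \<le> j" "j < p"
      by (cases x; cases "snd x") auto
    then show "- ?g ((\<lambda>(i, j). (i, j - 1)) x) = ?f x" using L[of i "Suc j"] by simp
  qed auto
  also have "sum ?f ?R = (\<Sum>x\<in>?R'. - ?g x)"
  proof (rule sum.reindex_bij_witness[of _ "\<lambda>(i, j). (Suc i, j)" "\<lambda>(i, j). (i - 1, j)"])
    fix x assume "x \<in> ?R"
    then obtain i j where "x = (Suc i, j)" "j < i" "i \<le> p"
      by (cases x; cases "fst x") auto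
    then show "- ?g ((\<lambda>(i, j). (i - 1, j)) x) = ?f x" using R[of j "Suc i"] by simp
  qed auto
  also have "(\<Sum>x\<in>?L'. - ?g x) + (\<Sum>x\<in>?R'. - ?g x) = (\<Sum>x\<in>?L' \<union> ?R'. - ?g x)"
    using fin by (intro sum.union_disjoint[symmetric]) auto
  also have "?L' \<union> ?R' = {..p} \<times> {..<p}" by auto
  also have "(\<Sum>x\<in>{..p} \<times> {..<p}. - ?g x) = - (\<Sum>i\<le>p. \<Sum>j<p. (-1) ^ (i + j) *s U i j)"
    by (simp add: sum_negf sum.cartesian_product)
  finally show ?thesis by (simp add: sum_negf sum_subtractf)
qed

lemma sign_sign [simp]: "(-1) ^ i *s ((-1) ^ i *s x) = x"
  by (simp flip: power_add mult_2)

end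

section \<open>Normalization\<close>

text \<open>A simplicial vector space whose \<open>n\<close>-simplices are represented as \<open>A n / B n\<close>.\<close>

locale simplicial_quotient = vector_space s
  for s :: "'k::field \<Rightarrow> 'v::ab_group_add \<Rightarrow> 'v" (infixr \<open>*s\<close> 75) +
  fixes A B :: "nat \<Rightarrow> 'v set" and d t :: "nat \<Rightarrow> nat \<Rightarrow> 'v \<Rightarrow> 'v"
  assumes subspace_A: "subspace (A n)"
    and subspace_B: "subspace (B n)"
    and B_subset: "B n \<subseteq> A n"
    and hom_d: "module_hom s s (d n i)"
    and hom_t: "module_hom s s (t n i)"
    and d_A: "\<lbrakk>x \<in> A (Suc n); i \<le> Suc n\<rbrakk> \<Longrightarrow> d (Suc n) i x \<in> A n"
    and d_B: "\<lbrakk>x \<in> B (Suc n); i \<le> Suc n\<rbrakk> \<Longrightarrow> d (Suc n) i x \<in> B n"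
    and t_A: "\<lbrakk>x \<in> A n; j \<le> n\<rbrakk> \<Longrightarrow> t n j x \<in> A (Suc n)"
    and t_B: "\<lbrakk>x \<in> B n; j \<le> n\<rbrakk> \<Longrightarrow> t n j x \<in> B (Suc n)"
    and d_d: "\<lbrakk>x \<in> A (Suc (Suc n)); i < j; j \<le> Suc (Suc n)\<rbrakk> \<Longrightarrow>
        d (Suc n) i (d (Suc (Suc n)) j x) = d (Suc n) (j - 1) (d (Suc (Suc n)) i x)"
    and d_t_less: "\<lbrakk>x \<in> A (Suc n); i < j; j \<le> Suc n\<rbrakk> \<Longrightarrow>
        d (Suc (Suc n)) i (t (Suc n) j x) = t n (j - 1) (d (Suc n) i x)"
    and d_t_same: "\<lbrakk>x \<in> A n; j \<le> n\<rbrakk> \<Longrightarrow> d (Suc n) j (t n j x) = x"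
    and d_t_Suc: "\<lbrakk>x \<in> A n; j \<le> n\<rbrakk> \<Longrightarrow> d (Suc n) (Suc j) (t n j x) = x"
    and d_t_greater: "\<lbrakk>x \<in> A (Suc n); Suc j < i; i \<le> Suc (Suc n)\<rbrakk> \<Longrightarrow>
        d (Suc (Suc n)) i (t (Suc n) j x) = t n j (d (Suc n) (i - 1) x)"
    and t_t: "\<lbrakk>x \<in> A n; i \<le> j; j \<le> n\<rbrakk> \<Longrightarrow> t (Suc n) i (t n j x) = t (Suc n) (Suc j) (t n i x)"
begin

sublocale d: module_hom s s "d n i" for n i by (rule hom_d)
sublocale t: module_hom s s "t n i" for n i by (rule hom_t)

definition bd :: "nat \<Rightarrow> 'v \<Rightarrow> 'v" where
  "bd n x = (\<Sum>i\<le>n. (-1) ^ i *s d n i x)"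

sublocale bd: module_hom s s "bd n" for n
  by unfold_locales
    (auto simp: bd_def d.add d.scale scale_right_distrib sum.distrib scale_sum_right mult.commute)

lemma bd_A: "x \<in> A (Suc n) \<Longrightarrow> bd (Suc n) x \<in> A n"
  unfolding bd_def
  by (intro subspace_sum[OF subspace_A] subspace_scale[OF subspace_A] d_A) auto

lemma bd_B: "x \<in> B (Suc n) \<Longrightarrow> bd (Suc n) x \<in> B n"
  unfolding bd_def
  by (intro subspace_sum[OF subspace_B] subspace_scale[OF subspace_B] d_B) auto

lemma bd_bd:
  assumes "x \<in> A (Suc (Suc n))"
  shows "bd (Suc n) (bd (Suc (Suc n)) x) = 0"
proof -
  have "bd (Suc n) (bd (Suc (Suc n)) x)
      = (\<Sum>i\<le>Suc n. \<Sum>j\<le>Suc (Suc n). (-1) ^ (i + j) *s d (Suc n) i (d (Suc (Suc n)) j x))"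
    unfolding bd_def d.sum d.scale scale_sum_right by (simp add: power_add)
  also have "\<dots> = 0" using assms by (intro alternating_sum_zero d_d) auto
  finally show ?thesis .
qed

text \<open>The degenerate part is the case \<open>j = n\<close>; acyclicity is proved by induction on \<open>j\<close>.\<close>

definition degens :: "nat \<Rightarrow> nat \<Rightarrow> 'v set" where
  "degens j n = span (B n \<union> (\<Union>i\<in>{i. i < j \<and> i < n}. t (n - 1) i ` A (n - 1)))"

lemma subspace_degens: "subspace (degens j n)"
  by (simp add: degens_def)

lemma B_degens: "x \<in> B n \<Longrightarrow> x \<in> degens j n"
  by (auto simp: degens_def intro: span_base)

lemma t_degens: "\<lbrakk>x \<in> A n; i < j; i \<le> n\<rbrakk> \<Longrightarrow> t n i x \<in> degens j (Suc n)"
  unfolding degens_def by (intro span_base) auto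

lemma degens_mono: "j \<le> k \<Longrightarrow> degens j n \<subseteq> degens k n"
  unfolding degens_def by (intro span_mono Un_mono UN_mono) auto

lemma degens_0: "degens 0 n = B n"
  using subspace_B by (simp add: degens_def)

lemma degens_subset: "degens j n \<subseteq> A n"
  unfolding degens_def
proof (rule span_minimal[OF _ subspace_A])
  show "B n \<union> (\<Union>i\<in>{i. i < j \<and> i < n}. t (n - 1) i ` A (n - 1)) \<subseteq> A n"
    using B_subset t_A[of _ "n - 1"] by (cases n) auto
qed

lemma degens_induct:
  assumes "x \<in> degens j (Suc n)" "subspace {x. P x}"
    and "\<And>x. x \<in> B (Suc n) \<Longrightarrow> P x"
    and "\<And>x i. \<lbrakk>x \<in> A n; i < j; i \<le> n\<rbrakk> \<Longrightarrow> P (t n i x)"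
  shows "P x"
proof -
  have "degens j (Suc n) \<subseteq> {x. P x}"
    unfolding degens_def using assms(2-4) by (intro span_minimal) auto
  then show ?thesis using assms(1) by auto
qed

text \<open>The faces \<open>i\<close> and \<open>Suc i\<close> both undo \<open>t n i\<close> and
  carry opposite signs; all other faces pass to the inside. For \<open>n = 0\<close> both sums are
  empty, so the value of \<open>n - 1\<close> does not matter.\<close>

lemma bd_t:
  assumes x: "x \<in> A n" and i: "i \<le> n"
  shows "bd (Suc n) (t n i x) = (\<Sum>k<i. (-1) ^ k *s t (n - 1) (i - 1) (d n k x))
    - (\<Sum>k\<in>{i<..n}. (-1) ^ k *s t (n - 1) i (d n k x))"
proof -
  let ?f = "\<lambda>k. (-1) ^ k *s d (Suc n) k (t n i x)"
  have "bd (Suc n) (t n i x) = sum ?f ({..<i} \<union> {i, Suc i} \<union> Suc ` {i<..n})"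
  proof -
    have "k \<in> {..<i} \<union> {i, Suc i} \<union> Suc ` {i<..n}" if "k \<le> Suc n" for k
    proof -
      have "k < i \<or> k = i \<or> k = Suc i \<or> (k = Suc (k - 1) \<and> i < k - 1 \<and> k - 1 \<le> n)"
        using that by arith
      then show ?thesis by (auto simp: image_iff)
    qed
    then have "{..Suc n} = {..<i} \<union> {i, Suc i} \<union> Suc ` {i<..n}" using i by auto
    then show ?thesis by (simp only: bd_def)
  qed
  also have "\<dots> = sum ?f {..<i} + sum ?f {i, Suc i} + sum ?f (Suc ` {i<..n})"
    by (subst sum.union_disjoint; (subst sum.union_disjoint)?) auto
  also have "sum ?f {i, Suc i} = 0"
    using x i by (simp add: d_t_same d_t_Suc)
  also have "sum ?f {..<i} = (\<Sum>k<i. (-1) ^ k *s t (n - 1) (i - 1) (d n k x))"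
  proof (intro sum.cong refl)
    fix k assume k: "k \<in> {..<i}"
    then obtain m where "n = Suc m" using i by (cases n) auto
    then show "?f k = (-1) ^ k *s t (n - 1) (i - 1) (d n k x)"
      using k i x d_t_less[of x m k i] by simp
  qed
  also have "sum ?f (Suc ` {i<..n}) = (\<Sum>k\<in>{i<..n}. ?f (Suc k))"
    by (subst sum.reindex) auto
  also have "\<dots> = (\<Sum>k\<in>{i<..n}. - ((-1) ^ k *s t (n - 1) i (d n k x)))"
  proof (intro sum.cong refl)
    fix k assume k: "k \<in> {i<..n}"
    then obtain m where "n = Suc m" by (cases n) auto
    then show "?f (Suc k) = - ((-1) ^ k *s t (n - 1) i (d n k x))"
      using k i x d_t_greater[of x m i "Suc k"] by simp
  qed
  finally show ?thesis by (simp add: sum_negf)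
qed

text \<open>In \<open>bd_t\<close> the remaining degeneracies have index \<open>i - 1\<close> or
  \<open>i\<close>, both below \<open>j\<close>.\<close>

lemma bd_degens:
  assumes "x \<in> degens j (Suc n)"
  shows "bd (Suc n) x \<in> degens j n"
  using assms
proof (rule degens_induct)
  show "subspace {x. bd (Suc n) x \<in> degens j n}"
    by (intro bd.subspace_linear_preimage subspace_degens)
  show "bd (Suc n) x \<in> degens j n" if "x \<in> B (Suc n)" for x
    using that by (intro B_degens bd_B)
  fix x i assume x: "x \<in> A n" "i < j" "i \<le> n"
  show "bd (Suc n) (t n i x) \<in> degens j n"
  proof (cases n)
    case 0
    then show ?thesis using x subspace_0[OF subspace_degens] by (simp add: bd_t)
  next
    case (Suc m)
    then show ?thesis
      unfolding bd_t[OF x(1,3)] using x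
      by (intro subspace_diff[OF subspace_degens] subspace_sum[OF subspace_degens]
          subspace_scale[OF subspace_degens])
        (auto intro!: t_degens d_A)
  qed
qed

text \<open>Commuting the degeneracy \<open>j\<close> past a lower one leaves the lower one on the
  outside.\<close>

lemma t_last_degens:
  assumes "x \<in> degens j (Suc n)" "j \<le> Suc n"
  shows "t (Suc n) j x \<in> degens j (Suc (Suc n))"
  using assms(1)
proof (rule degens_induct)
  show "subspace {x. t (Suc n) j x \<in> degens j (Suc (Suc n))}"
    by (intro t.subspace_linear_preimage subspace_degens)
  show "t (Suc n) j x \<in> degens j (Suc (Suc n))" if "x \<in> B (Suc n)" for x
    using that assms(2) by (intro B_degens t_B)
  fix x i assume x: "x \<in> A n" "i < j" "i \<le> n"
  then have "t (Suc n) j (t n i x) = t (Suc n) i (t n (j - 1) x)"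
    using assms(2) t_t[of x n i "j - 1"] by simp
  also have "\<dots> \<in> degens j (Suc (Suc n))"
    using x assms(2) by (intro t_degens t_A) auto
  finally show "t (Suc n) j (t n i x) \<in> degens j (Suc (Suc n))" .
qed

text \<open>The degeneracy \<open>t n j\<close> is a contracting homotopy, up to sign, of the subquotient
  \<open>degens (Suc j) / degens j\<close>.\<close>

lemma degens_homotopy:
  assumes "z \<in> degens (Suc j) (Suc m)" "j \<le> m"
  shows "bd (Suc (Suc m)) (t (Suc m) j z) + t m j (bd (Suc m) z) - (-1) ^ j *s z \<in> degens j (Suc m)"
  using assms(1)
proof (rule degens_induct)
  let ?h = "\<lambda>z. bd (Suc (Suc m)) (t (Suc m) j z) + t m j (bd (Suc m) z) - (-1) ^ j *s z"
  interpret h: module_hom s s ?h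
    by unfold_locales
      (simp_all add: t.add t.scale bd.add bd.scale scale_right_distrib scale_right_diff_distrib
        scale_left_commute)
  show "subspace {z. ?h z \<in> degens j (Suc m)}"
    by (intro h.subspace_linear_preimage subspace_degens)
  note [intro!] = subspace_add[OF subspace_degens] subspace_diff[OF subspace_degens]
    subspace_scale[OF subspace_degens]
  show "?h z \<in> degens j (Suc m)" if "z \<in> B (Suc m)" for z
  proof -
    have "bd (Suc (Suc m)) (t (Suc m) j z) \<in> B (Suc m)" "t m j (bd (Suc m) z) \<in> B (Suc m)"
      using that assms(2) by (auto intro!: t_B bd_B)
    then show ?thesis using that by (auto intro: B_degens)
  qed
  fix x i assume x: "x \<in> A m" "i < Suc j" "i \<le> m"
  show "?h (t m i x) \<in> degens j (Suc m)"
  \<comment> \<open>For \<open>i < j\<close> the element lies in \<open>degens j\<close> already,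
    and so does every term of the homotopy formula. Only \<open>i = j\<close> is new.\<close>
  proof (cases "i = j")
    case False
    then have z: "t m i x \<in> degens j (Suc m)" using x by (intro t_degens) auto
    have "t m j (bd (Suc m) (t m i x)) \<in> degens j (Suc m)"
    proof (cases m)
      case 0
      then show ?thesis using False x assms(2) by auto
    next
      case (Suc m')
      then show ?thesis using bd_degens[OF z] assms(2) by (auto intro: t_last_degens)
    qed
    then show ?thesis using z assms(2) by (auto intro!: bd_degens t_last_degens)
  next
    case True
    let ?z = "t m j x"
    let ?S = "\<Sum>k\<in>{j<..m}. (-1) ^ k *s t m j (t (m - 1) j (d m k x))"
    let ?P = "\<Sum>k<j. (-1) ^ k *s t m (j - 1) (d (Suc m) k ?z)"
    let ?Q = "\<Sum>k<j. (-1) ^ k *s t m j (t (m - 1) (j - 1) (d m k x))"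
    have zA: "?z \<in> A (Suc m)" using x assms by (intro t_A)
    have cover: "k \<in> {Suc j} \<union> Suc ` {j<..m}" if "j < k" "k \<le> Suc m" for k
    proof -
      have "k = Suc j \<or> (k = Suc (k - 1) \<and> j < k - 1 \<and> k - 1 \<le> m)" using that by arith
      then show ?thesis by (auto simp: image_iff)
    qed
    have "{j<..Suc m} = {Suc j} \<union> Suc ` {j<..m}"
    proof (intro equalityI subsetI)
      show "k \<in> {Suc j} \<union> Suc ` {j<..m}" if "k \<in> {j<..Suc m}" for k
        using that by (intro cover) auto
    qed (use assms(2) in auto)
    \<comment> \<open>The face \<open>Suc j\<close> of \<open>t m j x\<close> gives back
      \<open>x\<close> and so produces the summand \<open>(-1) ^ j *s ?z\<close>; the faces beyond
      it produce \<open>?S\<close>, which occurs in \<open>t m j (bd (Suc m) ?z)\<close> with the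
      opposite sign.\<close>
    then have "(\<Sum>k\<in>{j<..Suc m}. (-1) ^ k *s t m j (d (Suc m) k ?z))
        = (-1) ^ Suc j *s t m j (d (Suc m) (Suc j) ?z)
          + (\<Sum>k\<in>{j<..m}. (-1) ^ Suc k *s t m j (d (Suc m) (Suc k) ?z))"
      by (simp only:, subst sum.union_disjoint) (auto simp: sum.reindex)
    also have "d (Suc m) (Suc j) ?z = x" using x True by (simp add: d_t_Suc)
    also have "(\<Sum>k\<in>{j<..m}. (-1) ^ Suc k *s t m j (d (Suc m) (Suc k) ?z)) = - ?S"
      unfolding sum_negf[symmetric]
    proof (intro sum.cong refl)
      fix k assume k: "k \<in> {j<..m}"
      then obtain m' where "m = Suc m'" by (cases m) auto
      then show "(-1) ^ Suc k *s t m j (d (Suc m) (Suc k) ?z)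
          = - ((-1) ^ k *s t m j (t (m - 1) j (d m k x)))"
        using k x d_t_greater[of x m' j "Suc k"] by simp
    qed
    finally have 1: "bd (Suc (Suc m)) (t (Suc m) j ?z) = ?P + (-1) ^ j *s ?z + ?S"
      using bd_t[OF zA] assms(2) by simp
    have 2: "t m j (bd (Suc m) ?z) = ?Q - ?S"
      using bd_t[OF x(1)] True x by (simp add: t.diff t.sum t.scale)
    have "?P \<in> degens j (Suc m)"
      using zA assms(2) by (auto intro!: subspace_sum[OF subspace_degens] t_degens d_A)
    moreover have "?Q \<in> degens j (Suc m)"
    proof (intro subspace_sum[OF subspace_degens] subspace_scale[OF subspace_degens])
      fix k assume k: "k \<in> {..<j}"
      then obtain m' where m: "m = Suc m'" using assms by (cases m) auto
      then have dx: "d m k x \<in> A m'" using x k assms(2) by (auto intro!: d_A)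
      have "t m j (t (m - 1) (j - 1) (d m k x)) = t m (j - 1) (t m' (j - 1) (d m k x))"
        using t_t[OF dx, of "j - 1" "j - 1"] m k assms by simp
      also have "\<dots> \<in> degens j (Suc m)"
        using m k assms dx by (intro t_degens) (auto intro!: t_A)
      finally show "t m j (t (m - 1) (j - 1) (d m k x)) \<in> degens j (Suc m)" .
    qed
    ultimately have "?P + ?Q \<in> degens j (Suc m)" by auto
    moreover have "?h ?z = ?P + ?Q" by (simp only: 1 2) simp
    ultimately show ?thesis using True by simp
  qed
qed

text \<open>Up to sign and the boundary of \<open>t n j z\<close>, a cycle modulo \<open>B\<close>
  in \<open>degens (Suc j)\<close> equals one in \<open>degens j\<close>, which bounds by the
  induction hypothesis. For \<open>j = 0\<close> only \<open>B n\<close> is left.\<close>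

lemma degens_acyclic:
  assumes "z \<in> degens j n" "n = 0 \<or> bd n z \<in> B (n - 1)"
  shows "\<exists>w\<in>degens j (Suc n). z - bd (Suc n) w \<in> B n"
  using assms
proof (induction j arbitrary: z)
  case 0
  then show ?case
    using subspace_0[OF subspace_B] by (intro bexI[of _ 0]) (auto simp: degens_0)
next
  case (Suc j)
  show ?case
  proof (cases "j < n")
    case False
    \<comment> \<open>No degeneracy of index \<open>n\<close> or more lands in degree
      \<open>n\<close>, so this step of the filtration is trivial.\<close>
    then have "{i. i < Suc j \<and> i < n} = {i. i < j \<and> i < n}" by auto
    then have "z \<in> degens j n" using Suc.prems by (simp add: degens_def)
    then show ?thesis using Suc.IH Suc.prems degens_mono[of j "Suc j"] by force
  next
    case True
    then obtain m where n: "n = Suc m" "j \<le> m" by (cases n) auto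
    define v where "v = (-1) ^ j *s z - bd (Suc n) (t n j z)"
    have zA: "z \<in> A n" using Suc.prems degens_subset by blast
    have bdz: "bd n z \<in> B m" using Suc.prems n by simp
    have "t m j (bd n z) - (bd (Suc n) (t n j z) + t m j (bd n z) - (-1) ^ j *s z) \<in> degens j n"
    proof (rule subspace_diff[OF subspace_degens])
      show "t m j (bd n z) \<in> degens j n" using bdz n t_B B_degens by simp
      show "bd (Suc n) (t n j z) + t m j (bd n z) - (-1) ^ j *s z \<in> degens j n"
        using degens_homotopy[of z j m] Suc.prems(1) n by simp
    qed
    then have v: "v \<in> degens j n" by (simp add: v_def)
    have "bd n (bd (Suc n) (t n j z)) = 0" using bd_bd[of "t n j z" m] zA n by (simp add: t_A)
    then have "bd n v \<in> B m"
      using bdz subspace_scale[OF subspace_B] by (simp add: v_def bd.diff bd.scale)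
    then obtain w where w: "w \<in> degens j (Suc n)" "v - bd (Suc n) w \<in> B n"
      using Suc.IH[OF v] n by auto
    show ?thesis
    proof (intro bexI)
      \<comment> \<open>The sign in the homotopy is its own inverse and is moved onto the bounding
        chain.\<close>
      have "z - bd (Suc n) ((-1) ^ j *s (t n j z + w)) = (-1) ^ j *s (v - bd (Suc n) w)"
        by (simp add: v_def bd.scale bd.add scale_right_diff_distrib scale_right_distrib)
      then show "z - bd (Suc n) ((-1) ^ j *s (t n j z + w)) \<in> B n"
        using subspace_scale[OF subspace_B] w by simp
      show "(-1) ^ j *s (t n j z + w) \<in> degens (Suc j) (Suc n)"
        using w degens_mono[of j "Suc j"] zA True
        by (intro subspace_scale[OF subspace_degens] subspace_add[OF subspace_degens] t_degens) auto
    qed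
  qed
qed

text \<open>The boundary of \<open>y\<close> is a degenerate cycle modulo \<open>B\<close>, hence
  bounded modulo \<open>B\<close> by a degenerate \<open>w\<close>; then \<open>y - w\<close> is a
  cycle before normalization and has the same normalized class.\<close>

lemma normalization_surj:
  assumes "y \<in> A n" "n = 0 \<or> bd n y \<in> degens (n - 1) (n - 1)"
  shows "\<exists>x\<in>A n. (n = 0 \<or> bd n x \<in> B (n - 1)) \<and> y - x \<in> degens n n"
proof (cases n)
  case 0
  then show ?thesis using assms subspace_0[OF subspace_degens] by (intro bexI[of _ y]) auto
next
  case (Suc m)
  then have y: "bd (Suc m) y \<in> degens m m" using assms by simp
  have "m = 0 \<or> bd m (bd (Suc m) y) \<in> B (m - 1)"
    using bd_bd assms(1) Suc subspace_0[OF subspace_B] by (cases m) auto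
  then obtain w where w: "w \<in> degens m (Suc m)" "bd (Suc m) y - bd (Suc m) w \<in> B m"
    using degens_acyclic[OF y] by blast
  have "w \<in> degens n n" using w degens_mono[of m n] Suc by auto
  then show ?thesis
    using w Suc assms(1) degens_subset subspace_diff[OF subspace_A]
    by (intro bexI[of _ "y - w"]) (auto simp: bd.diff subset_eq)
qed

text \<open>The degenerate error \<open>e\<close> is itself a cycle modulo \<open>B\<close>, so
  acyclicity turns it into a boundary. Together with \<open>normalization_surj\<close> this compares
  the two homologies.\<close>

lemma normalization_inj:
  assumes x: "x \<in> A n" "n = 0 \<or> bd n x \<in> B (n - 1)"
    and y: "y \<in> A (Suc n)" and e: "e \<in> degens n n" and eq: "x = bd (Suc n) y + e"
  shows "\<exists>y\<in>A (Suc n). \<exists>b\<in>B n. x = bd (Suc n) y + b"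
proof -
  have "n = 0 \<or> bd n e \<in> B (n - 1)"
  proof (cases n)
    case (Suc m)
    then have "bd n x = bd n e" using y by (simp add: eq bd.add bd_bd)
    then show ?thesis using x by simp
  qed simp
  then obtain w where w: "w \<in> degens n (Suc n)" "e - bd (Suc n) w \<in> B n"
    using degens_acyclic[OF e] by blast
  have "x = bd (Suc n) (y + w) + (e - bd (Suc n) w)" by (simp add: eq bd.add)
  moreover have "y + w \<in> A (Suc n)" using y w degens_subset subspace_add[OF subspace_A] by blast
  ultimately show ?thesis using w by blast
qed

end

section \<open>The spectral sequence of a double complex\<close>

locale bicomplex = vector_space s
  for s :: "'k::field \<Rightarrow> 'v::ab_group_add \<Rightarrow> 'v" (infixr \<open>*s\<close> 75) +
  fixes C :: "nat \<Rightarrow> nat \<Rightarrow> 'v set" and dh dv :: "nat \<Rightarrow> nat \<Rightarrow> 'v \<Rightarrow> 'v"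
  assumes subspace_C: "subspace (C p q)"
    and hom_dh: "module_hom s s (dh p q)"
    and hom_dv: "module_hom s s (dv p q)"
    and dh_C: "x \<in> C (Suc p) q \<Longrightarrow> dh (Suc p) q x \<in> C p q"
    and dv_C: "x \<in> C p (Suc q) \<Longrightarrow> dv p (Suc q) x \<in> C p q"
    and dh_dh: "x \<in> C (Suc (Suc p)) q \<Longrightarrow> dh (Suc p) q (dh (Suc (Suc p)) q x) = 0"
    and dv_dv: "x \<in> C p (Suc (Suc q)) \<Longrightarrow> dv p (Suc q) (dv p (Suc (Suc q)) x) = 0"
    and dh_dv: "x \<in> C (Suc p) (Suc q) \<Longrightarrow>
      dh (Suc p) q (dv (Suc p) (Suc q) x) = dv p (Suc q) (dh (Suc p) (Suc q) x)"
begin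

sublocale dh: module_hom s s "dh p q" for p q by (rule hom_dh)
sublocale dv: module_hom s s "dv p q" for p q by (rule hom_dv)

abbreviation fs :: "'k \<Rightarrow> (nat \<Rightarrow> 'v) \<Rightarrow> nat \<Rightarrow> 'v" where
  "fs \<equiv> fun_scale s"

sublocale F: vector_space fs
  by (rule vector_space_fun_scale[OF vector_space_scale])

text \<open>Elements of the total complex extended by zero, so that they form a subspace of a function
  type with pointwise operations.\<close>

definition T :: "nat \<Rightarrow> (nat \<Rightarrow> 'v) set" where
  "T n = families n (\<lambda>i. C i (n - i))"

text \<open>Components outside the range are zero, so \<open>D 0 = 0\<close> and everything in
  degree 0 is a cycle without a case distinction.\<close>

definition D :: "nat \<Rightarrow> (nat \<Rightarrow> 'v) \<Rightarrow> nat \<Rightarrow> 'v" where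
  "D n x = (\<lambda>i. if i < n then dh (Suc i) (n - Suc i) (x (Suc i)) + (-1) ^ i *s dv i (n - i) (x i) else 0)"

definition Fil :: "int \<Rightarrow> nat \<Rightarrow> (nat \<Rightarrow> 'v) set" where
  "Fil p n = {x \<in> T n. \<forall>i. p < int i \<longrightarrow> x i = 0}"

lemma subspace_T: "F.subspace (T n)"
  unfolding T_def
  by (intro F.subspaceI)
    (auto simp: subspace_0[OF subspace_C] subspace_add[OF subspace_C] subspace_scale[OF subspace_C])

lemma subspace_Fil: "F.subspace (Fil p n)"
  using subspace_T[of n]
  by (intro F.subspaceI) (auto simp: Fil_def F.subspace_0 F.subspace_add F.subspace_scale)

sublocale D: module_hom fs fs "D n" for n
  by unfold_locales
    (auto simp: D_def fun_eq_iff dh.add dv.add dh.scale dv.scale scale_right_distrib mult.commute)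

lemma T_0: "0 \<in> T n" by (rule F.subspace_0[OF subspace_T])

lemma D_0 [simp]: "D 0 x = 0"
  by (simp add: D_def fun_eq_iff)

lemma T_nth: "x \<in> T n \<Longrightarrow> i \<le> n \<Longrightarrow> x i \<in> C i (n - i)"
  by (simp add: T_def)

lemma D_T:
  assumes "x \<in> T (Suc n)" shows "D (Suc n) x \<in> T n"
proof -
  have "D (Suc n) x i \<in> C i (n - i)" if "i \<le> n" for i
  proof -
    have "x (Suc i) \<in> C (Suc i) (n - i)" "x i \<in> C i (Suc (n - i))"
      using T_nth[OF assms, of "Suc i"] T_nth[OF assms, of i] that by (auto simp: Suc_diff_le)
    then show ?thesis
      using that by (auto simp: D_def Suc_diff_le
          intro!: subspace_add[OF subspace_C] subspace_scale[OF subspace_C] dh_C dv_C)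
  qed
  then show ?thesis by (auto simp: T_def D_def)
qed

lemma D_T': "x \<in> T n \<Longrightarrow> D n x \<in> T (n - 1)"
  using D_T by (cases n) (auto intro: T_0)

text \<open>The mixed terms cancel because \<open>dh\<close> and \<open>dv\<close> commute while the
  sign changes from column \<open>i\<close> to column \<open>Suc i\<close>.\<close>

lemma D_D:
  assumes x: "x \<in> T (Suc n)" shows "D n (D (Suc n) x) = 0"
proof
  fix i
  show "D n (D (Suc n) x) i = 0 i"
  proof (cases "i < n")
    case True
    \<comment> \<open>Writing \<open>n\<close> as a sum removes the truncated subtractions from the
      bidegrees.\<close>
    then obtain m where n: "n = Suc (i + m)" using less_imp_Suc_add by auto
    have c: "x (Suc (Suc i)) \<in> C (Suc (Suc i)) m" "x (Suc i) \<in> C (Suc i) (Suc m)"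
      "x i \<in> C i (Suc (Suc m))"
      using T_nth[OF x, of "Suc (Suc i)"] T_nth[OF x, of "Suc i"] T_nth[OF x, of i] n
      by (auto simp: Suc_diff_le)
    then show ?thesis
      using n by (simp add: D_def Suc_diff_le dh.add dh.scale dh.diff dh_C dv.add dv.scale dh_dh dv_dv dh_dv
          scale_right_distrib)
  qed (simp add: D_def)
qed

lemma Fil_T: "x \<in> Fil p n \<Longrightarrow> x \<in> T n"
  by (simp add: Fil_def)

lemma Fil_mono: "p \<le> p' \<Longrightarrow> Fil p n \<subseteq> Fil p' n"
  by (auto simp: Fil_def)

lemma Fil_neg: "p < 0 \<Longrightarrow> Fil p n = {0}"
  using T_0 by (auto simp: Fil_def fun_eq_iff)

lemma Fil_large: "int n \<le> p \<Longrightarrow> Fil p n = T n"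
  by (auto simp: Fil_def T_def)

definition app :: "int \<Rightarrow> int \<Rightarrow> nat \<Rightarrow> (nat \<Rightarrow> 'v) set" where
  "app r p n = {x \<in> Fil p n. D n x \<in> Fil (p - r) (n - 1)}"

definition pcyc :: "nat \<Rightarrow> nat \<Rightarrow> nat \<Rightarrow> (nat \<Rightarrow> 'v) set" where
  "pcyc r p n = sumset (app (int r) (int p) n) (Fil (int p - 1) n)"

definition pbd :: "nat \<Rightarrow> nat \<Rightarrow> nat \<Rightarrow> (nat \<Rightarrow> 'v) set" where
  "pbd r p n = sumset (D (Suc n) ` app (int r - 1) (int p + int r - 1) (Suc n)) (Fil (int p - 1) n)"

lemma subspace_app: "F.subspace (app r p n)"
proof -
  have "app r p n = Fil p n \<inter> {x. D n x \<in> Fil (p - r) (n - 1)}" by (auto simp: app_def)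
  then show ?thesis
    using F.subspace_inter[OF subspace_Fil D.subspace_linear_preimage[OF subspace_Fil]] by simp
qed

lemma subspace_pcyc: "F.subspace (pcyc r p n)"
  unfolding pcyc_def by (intro F.subspace_sums subspace_app subspace_Fil)

lemma subspace_pbd: "F.subspace (pbd r p n)"
  unfolding pbd_def by (intro F.subspace_sums D.subspace_image subspace_app subspace_Fil)

lemma pcyc_T: "pcyc r p n \<subseteq> T n"
  using F.subspace_add[OF subspace_T] by (auto simp: pcyc_def app_def Fil_def)

text \<open>The filtration bounds match, since \<open>p + r - 1\<close> minus \<open>r - 1\<close>
  is \<open>p\<close>, and a second boundary is zero.\<close>

lemma pbd_pcyc: "pbd r p n \<subseteq> pcyc r p n"
proof -
  have "D (Suc n) x \<in> app (int r) (int p) n" if "x \<in> app (int r - 1) (int p + int r - 1) (Suc n)" for x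
    using that F.subspace_0[OF subspace_Fil] D_D[of x n] by (auto simp: app_def Fil_T)
  then show ?thesis unfolding pbd_def pcyc_def by blast
qed

definition Zc :: "nat \<Rightarrow> (nat \<Rightarrow> 'v) set" where
  "Zc n = {x \<in> T n. D n x = 0}"

definition Bc :: "nat \<Rightarrow> (nat \<Rightarrow> 'v) set" where
  "Bc n = D (Suc n) ` T (Suc n)"

lemma subspace_Zc: "F.subspace (Zc n)"
proof -
  have "Zc n = T n \<inter> {x. D n x = 0}" by (auto simp: Zc_def)
  then show ?thesis using F.subspace_inter[OF subspace_T D.subspace_kernel] by simp
qed

lemma subspace_Bc: "F.subspace (Bc n)"
  unfolding Bc_def by (intro D.subspace_image subspace_T)

lemma Bc_Zc: "Bc n \<subseteq> Zc n"
  by (auto simp: Bc_def Zc_def D_T D_D)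

text \<open>The cycles whose homology class lies in filtration step \<open>i - 1\<close>. The shift
  makes \<open>i = 0\<close> the zero step, so natural numbers index the filtration from
  \<open>Bc n\<close> to \<open>Zc n\<close>.\<close>

definition G :: "nat \<Rightarrow> nat \<Rightarrow> (nat \<Rightarrow> 'v) set" where
  "G n i = sumset (Zc n \<inter> Fil (int i - 1) n) (Bc n)"

lemma subspace_G: "F.subspace (G n i)"
  unfolding G_def by (intro F.subspace_sums F.subspace_inter subspace_Zc subspace_Fil subspace_Bc)

lemma G_mono: "G n i \<subseteq> G n (Suc i)"
proof -
  have "Fil (int i - 1) n \<subseteq> Fil (int (Suc i) - 1) n" by (rule Fil_mono) simp
  then show ?thesis unfolding G_def by blast
qed

lemma G_0: "G n 0 = Bc n"
proof -
  have "Zc n \<inter> {0} = {0}" using F.subspace_0[OF subspace_Zc] by auto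
  then show ?thesis by (simp add: G_def Fil_neg)
qed

lemma G_top: "G n (Suc n) = Zc n"
proof -
  have "Zc n \<inter> Fil (int n) n = Zc n" by (auto simp: Fil_large Zc_def)
  then show ?thesis
    using Bc_Zc[of n] F.subspace_add[OF subspace_Zc] F.subspace_0[OF subspace_Bc]
    by (auto simp: G_def) (metis add.right_neutral)
qed

text \<open>From \<open>r = p + 1\<close> on, the boundary has to lie in a negative filtration step,
  which is zero, so approximate cycles are genuine ones.\<close>

lemma Inter_pcyc:
  "(\<Inter>r. pcyc r p n) = sumset (Zc n \<inter> Fil (int p) n) (Fil (int p - 1) n)" (is "_ = ?Z")
proof
  have "app (int (Suc p)) (int p) n \<subseteq> Zc n \<inter> Fil (int p) n"
    by (auto simp: app_def Zc_def Fil_neg Fil_T)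
  then show "(\<Inter>r. pcyc r p n) \<subseteq> ?Z"
    unfolding pcyc_def by (blast dest: INT_D[of _ _ _ "Suc p"])
  have "Zc n \<inter> Fil (int p) n \<subseteq> app (int r) (int p) n" for r
    using F.subspace_0[OF subspace_Fil] by (auto simp: app_def Zc_def)
  then show "?Z \<subseteq> (\<Inter>r. pcyc r p n)"
    unfolding pcyc_def by blast
qed

text \<open>For \<open>r = n + 2\<close> the source step \<open>p + r - 1\<close> contains
  everything of total degree \<open>n + 1\<close>, while the condition on the boundary still reads
  membership in step \<open>p\<close>.\<close>

lemma Union_pbd:
  "(\<Union>r. pbd r p n) = sumset (Bc n \<inter> Fil (int p) n) (Fil (int p - 1) n)" (is "_ = ?B")
proof
  have "D (Suc n) ` app (int r - 1) (int p + int r - 1) (Suc n) \<subseteq> Bc n \<inter> Fil (int p) n" for r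
    by (auto simp: app_def Bc_def Fil_T)
  then show "(\<Union>r. pbd r p n) \<subseteq> ?B" unfolding pbd_def by blast
  have "Bc n \<inter> Fil (int p) n \<subseteq> D (Suc n) ` app (int (n + 2) - 1) (int p + int (n + 2) - 1) (Suc n)"
    by (auto simp: app_def Bc_def Fil_large)
  then have "?B \<subseteq> pbd (n + 2) p n" unfolding pbd_def by blast
  then show "?B \<subseteq> (\<Union>r. pbd r p n)" by blast
qed

end

section \<open>Pages and limit of the double complex record\<close>

locale bicomplex_record = bicomplex s C dh dv
  for s :: "'k::field \<Rightarrow> 'v::ab_group_add \<Rightarrow> 'v" (infixr \<open>*s\<close> 75) and C dh dv +
  fixes R :: "('k, 'v) double_complex"
  assumes bichains: "presentation s (C p q) {0} id (bichains R p q)"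
    and hbdry_eq: "x \<in> C (Suc p) q \<Longrightarrow> hbdry R (Suc p) q x = dh (Suc p) q x"
    and vbdry_eq: "x \<in> C p (Suc q) \<Longrightarrow> vbdry R p (Suc q) x = dv p (Suc q) x"
begin

text \<open>The record uses functions that are \<open>undefined\<close> beyond \<open>n\<close>;
  this translates from the extension by zero.\<close>

definition \<rho> :: "nat \<Rightarrow> (nat \<Rightarrow> 'v) \<Rightarrow> nat \<Rightarrow> 'v" where
  "\<rho> n x = restrict x {..n}"

lemma presentation_tot: "presentation fs (T n) {0} (\<rho> n) (tot R n)"
proof -
  have "presentation fs (T n) (families n (\<lambda>_. {0})) (\<lambda>x. \<lambda>i\<in>{..n}. id (x i))
      (direct_sum {..n} (\<lambda>i. bichains R i (n - i)))"
    unfolding T_def by (rule presentation_direct_sum) (rule bichains)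
  moreover have "families n (\<lambda>_. {0}) = {0 :: nat \<Rightarrow> 'v}"
    by (auto simp: fun_eq_iff) (metis not_le)
  moreover have "(\<lambda>x. \<lambda>i\<in>{..n}. id (x i)) = \<rho> n"
    by (simp add: \<rho>_def fun_eq_iff)
  ultimately show ?thesis by (simp add: tot_def)
qed

sublocale tot: presentation fs "T n" "{0}" "\<rho> n" "tot R n" for n
  by (rule presentation_tot)

lemma inj_\<rho>: "x \<in> T n \<Longrightarrow> y \<in> T n \<Longrightarrow> \<rho> n x = \<rho> n y \<longleftrightarrow> x = y"
  by (simp add: tot.proj_eq_iff)

lemma bichains_add: "x \<in> C p q \<Longrightarrow> y \<in> C p q \<Longrightarrow> x \<oplus>\<^bsub>bichains R p q\<^esub> y = x + y"
  using presentation.proj_add[OF bichains] by force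

lemma bichains_scale: "x \<in> C p q \<Longrightarrow> c \<odot>\<^bsub>bichains R p q\<^esub> x = c *s x"
  using presentation.proj_scale[OF bichains] by force

lemma bichains_zero: "\<zero>\<^bsub>bichains R p q\<^esub> = 0"
  using presentation.proj_zero[OF bichains] by force

lemma tot_bdry_\<rho>:
  assumes x: "x \<in> T (Suc n)"
  shows "tot_bdry R (Suc n) (\<rho> (Suc n) x) = \<rho> n (D (Suc n) x)"
proof
  fix i
  show "tot_bdry R (Suc n) (\<rho> (Suc n) x) i = \<rho> n (D (Suc n) x) i"
  proof (cases "i \<le> n")
    case True
    then have "x (Suc i) \<in> C (Suc i) (n - i)" "x i \<in> C i (Suc (n - i))"
      using T_nth[OF x, of "Suc i"] T_nth[OF x, of i] by (auto simp: Suc_diff_le)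
    then show ?thesis
      using True by (simp add: tot_bdry_def \<rho>_def D_def Suc_diff_le hbdry_eq vbdry_eq
          bichains_add bichains_scale dh_C dv_C subspace_scale[OF subspace_C])
  qed (auto simp: tot_bdry_def \<rho>_def)
qed

lemma filt_eq: "filt R p n = \<rho> n ` Fil p n"
proof -
  have "(\<forall>i\<le>n. p < int i \<longrightarrow> \<rho> n x i = 0) \<longleftrightarrow> (\<forall>i. p < int i \<longrightarrow> x i = 0)" if "x \<in> T n" for x
    using that by (auto simp: \<rho>_def T_def) (metis not_le)
  then show ?thesis
    unfolding filt_def tot.carrier_eq bichains_zero Fil_def by auto
qed

text \<open>In degree 0 both conditions on the boundary are void, the second because
  \<open>D 0 = 0\<close>. In positive degree injectivity of \<open>\<rho>\<close> recovers
  membership from the image.\<close>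

lemma approx_cycles_eq: "approx_cycles R r p n = \<rho> n ` app r p n"
proof -
  define P where "P y \<longleftrightarrow> n = 0 \<or> tot_bdry R n y \<in> filt R (p - r) (n - 1)" for y
  have P: "P (\<rho> n x) \<longleftrightarrow> D n x \<in> Fil (p - r) (n - 1)" if "x \<in> T n" for x
  proof (cases n)
    case 0
    then show ?thesis by (simp add: P_def F.subspace_0[OF subspace_Fil])
  next
    case (Suc m)
    have "\<rho> m (D n x) \<in> \<rho> m ` Fil (p - r) m \<longleftrightarrow> D n x \<in> Fil (p - r) m"
    proof
      assume "\<rho> m (D n x) \<in> \<rho> m ` Fil (p - r) m"
      then obtain y where "y \<in> Fil (p - r) m" "\<rho> m (D n x) = \<rho> m y" by auto
      then show "D n x \<in> Fil (p - r) m"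
        using that D_T Suc inj_\<rho>[of "D n x" m y] by (auto simp: Fil_T)
    qed auto
    then show ?thesis using that Suc by (simp add: P_def tot_bdry_\<rho> filt_eq)
  qed
  then show ?thesis
    unfolding approx_cycles_def app_def filt_eq[of p] P_def[symmetric] by (auto simp: Fil_T)
qed

lemma page_cycles_eq: "page_cycles R r p q = \<rho> (p + q) ` pcyc r p (p + q)"
  unfolding page_cycles_def approx_cycles_eq filt_eq pcyc_def
  by (rule tot.set_add_proj) (auto simp: app_def Fil_T)

lemma page_boundaries_eq: "page_boundaries R r p q = \<rho> (p + q) ` pbd r p (p + q)"
proof -
  let ?A = "app (int r - 1) (int p + int r - 1) (Suc (p + q))"
  have "tot_bdry R (Suc (p + q)) ` \<rho> (Suc (p + q)) ` ?A = \<rho> (p + q) ` D (Suc (p + q)) ` ?A"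
    unfolding image_image by (intro image_cong refl tot_bdry_\<rho>) (auto simp: app_def Fil_T)
  then show ?thesis
    unfolding page_boundaries_def approx_cycles_eq filt_eq pbd_def
    by (simp only:) (rule tot.set_add_proj; auto simp: app_def Fil_T D_T)
qed

lemma presentation_subquotient_tot:
  assumes "F.subspace A1" "A1 \<subseteq> T n" "F.subspace B1" "B1 \<subseteq> A1"
  shows "\<exists>\<sigma>. presentation fs A1 B1 \<sigma> (subquotient (tot R n) (\<rho> n ` A1) (\<rho> n ` B1))"
proof -
  have "A1 \<inter> sumset B1 {0} = B1" using assms by auto
  then show ?thesis using tot.presentation_subquotient[OF assms] by auto
qed

lemma presentation_ss_page:
  "\<exists>\<sigma>. presentation fs (pcyc r p (p + q)) (pbd r p (p + q)) \<sigma> (ss_page R r p q)"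
  unfolding ss_page_def page_cycles_eq page_boundaries_eq
  by (intro presentation_subquotient_tot subspace_pcyc subspace_pbd pcyc_T pbd_pcyc)

lemma module_hom_id_fs: "module_hom fs fs id"
  by unfold_locales (auto simp: fun_eq_iff scale_right_distrib)

text \<open>The numerator of the limit term is \<open>Zc n \<inter> Fil p n\<close> plus
  \<open>Fil (p - 1) n\<close>; dropping the second summand is the second isomorphism theorem. On
  cycles in \<open>Fil p n\<close> the old denominator and \<open>G n p\<close> cut out the same
  subspace.\<close>

lemma presentation_ss_infty:
  assumes "p \<le> n"
  shows "\<exists>\<sigma>. presentation fs (Zc n \<inter> Fil (int p) n) (Zc n \<inter> Fil (int p) n \<inter> G n p) \<sigma>
    (ss_infty R p (n - p))"
proof -
  have n: "p + (n - p) = n" using assms by simp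
  let ?Z = "\<Inter>r. pcyc r p n" and ?B = "\<Union>r. pbd r p n"
  \<comment> \<open>Taking images commutes with this intersection because \<open>\<rho> n\<close> is
    injective on \<open>T n\<close>: one representative serves all \<open>r\<close>.\<close>
  have "(\<Inter>r. page_cycles R r p (n - p)) = \<rho> n ` ?Z"
  proof
    show "(\<Inter>r. page_cycles R r p (n - p)) \<subseteq> \<rho> n ` ?Z"
    proof
      fix y assume "y \<in> (\<Inter>r. page_cycles R r p (n - p))"
      then have y: "\<forall>r. \<exists>x\<in>pcyc r p n. y = \<rho> n x" by (auto simp: page_cycles_eq n)
      then obtain x where x: "x \<in> pcyc 0 p n" "y = \<rho> n x" by blast
      have "x \<in> pcyc r p n" for r
      proof -
        obtain x' where x': "x' \<in> pcyc r p n" "y = \<rho> n x'" using y by blast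
        moreover have "x \<in> T n" "x' \<in> T n" using x x' pcyc_T by blast+
        ultimately have "x = x'" using x inj_\<rho>[of x n x'] by simp
        then show ?thesis using x' by simp
      qed
      then show "y \<in> \<rho> n ` ?Z" using x by blast
    qed
  qed (auto simp: page_cycles_eq n)
  moreover have "(\<Union>r. page_boundaries R r p (n - p)) = \<rho> n ` ?B"
    by (auto simp: page_boundaries_eq n)
  moreover have Z: "F.subspace ?Z" by (rule F.subspace_Int) (rule subspace_pcyc)
  moreover have ZT: "?Z \<subseteq> T n" using pcyc_T by blast
  moreover have B: "F.subspace ?B"
    unfolding Union_pbd by (intro F.subspace_sums F.subspace_inter subspace_Bc subspace_Fil)
  moreover have BZ: "?B \<subseteq> ?Z" unfolding Union_pbd Inter_pcyc using Bc_Zc by blast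
  ultimately obtain \<sigma> where "presentation fs ?Z ?B \<sigma> (ss_infty R p (n - p))"
    unfolding ss_infty_def n using presentation_subquotient_tot[of ?Z n ?B] by auto
  then have "presentation fs (Zc n \<inter> Fil (int p) n) (Zc n \<inter> Fil (int p) n \<inter> G n p) (\<sigma> \<circ> id) (ss_infty R p (n - p))"
  proof (rule presentation_pullback[OF _ module_hom_id_fs F.vector_space_scale])
    show "F.subspace (Zc n \<inter> Fil (int p) n)" "F.subspace (Zc n \<inter> Fil (int p) n \<inter> G n p)"
      by (intro F.subspace_inter subspace_Zc subspace_Fil subspace_G)+
    show "id x \<in> ?Z" if "x \<in> Zc n \<inter> Fil (int p) n" for x
    proof -
      have "x + 0 \<in> ?Z"
        unfolding Inter_pcyc using that F.subspace_0[OF subspace_Fil[of "int p - 1" n]] by blast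
      then show ?thesis by simp
    qed
    show "\<exists>x\<in>Zc n \<inter> Fil (int p) n. y - id x \<in> ?B" if y: "y \<in> ?Z" for y
    proof -
      obtain u v where u: "y = u + v" "u \<in> Zc n \<inter> Fil (int p) n" "v \<in> Fil (int p - 1) n"
        using y unfolding Inter_pcyc by auto
      have "0 + v \<in> ?B"
        unfolding Union_pbd using u F.subspace_0[OF subspace_Bc] F.subspace_0[OF subspace_Fil]
        by blast
      then show ?thesis using u by (intro bexI[of _ u]) auto
    qed
    fix x assume x: "x \<in> Zc n \<inter> Fil (int p) n"
    have "x \<in> ?B \<longleftrightarrow> x \<in> G n p"
    proof
      assume "x \<in> ?B"
      then obtain b v where b: "x = b + v" "b \<in> Bc n \<inter> Fil (int p) n" "v \<in> Fil (int p - 1) n"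
        unfolding Union_pbd by auto
      \<comment> \<open>Both \<open>x\<close> and the boundary \<open>b\<close> are cycles, so the
        remainder \<open>v\<close> is one too.\<close>
      have "x - b \<in> Zc n" using x b Bc_Zc by (intro F.subspace_diff[OF subspace_Zc]) auto
      then have "v \<in> Zc n" using b by simp
      then have "v + b \<in> G n p" using b unfolding G_def by blast
      then show "x \<in> G n p" using b by (simp add: add.commute)
    next
      assume "x \<in> G n p"
      then obtain z b where z: "x = z + b" "z \<in> Zc n \<inter> Fil (int p - 1) n" "b \<in> Bc n"
        unfolding G_def by auto
      have "x - z \<in> Fil (int p) n"
        using x z Fil_mono[of "int p - 1" "int p" n] by (intro F.subspace_diff[OF subspace_Fil]) auto
      then have "b \<in> Fil (int p) n" using z by simp
      then have "b + z \<in> ?B" unfolding Union_pbd using z by blast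
      then show "x \<in> ?B" using z by (simp add: add.commute)
    qed
    then show "id x \<in> ?B \<longleftrightarrow> x \<in> Zc n \<inter> Fil (int p) n \<inter> G n p" using x by simp
  qed auto
  then show ?thesis by blast
qed

text \<open>Every element of \<open>G n (Suc p)\<close> differs by a boundary from a cycle in
  \<open>Fil p n\<close>. Successive quotients of a single chain of subspaces are the form in which
  the filtration can be split.\<close>

lemma presentation_ss_infty_graded:
  assumes "p \<le> n"
  shows "\<exists>\<sigma>. presentation fs (G n (Suc p)) (G n p) \<sigma> (ss_infty R p (n - p))"
proof -
  obtain \<sigma> where "presentation fs (Zc n \<inter> Fil (int p) n) (Zc n \<inter> Fil (int p) n \<inter> G n p) \<sigma>
      (ss_infty R p (n - p))"
    using presentation_ss_infty[OF assms] by auto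
  then show ?thesis
  proof (rule presentation_pushforward[OF _ module_hom_id_fs F.vector_space_scale])
    show "F.subspace (G n (Suc p))" "F.subspace (G n p)" "G n p \<subseteq> G n (Suc p)"
      by (intro subspace_G G_mono)+
    show "id x \<in> G n (Suc p)" if "x \<in> Zc n \<inter> Fil (int p) n" for x
    proof -
      have "x + 0 \<in> G n (Suc p)"
        unfolding G_def add_diff_cancel_right' of_nat_Suc
        using that F.subspace_0[OF subspace_Bc[of n]] by (simp del: add_0_right) blast
      then show ?thesis by simp
    qed
    show "\<exists>x\<in>Zc n \<inter> Fil (int p) n. y - id x \<in> G n p" if y: "y \<in> G n (Suc p)" for y
    proof -
      obtain z b where z: "y = z + b" "z \<in> Zc n \<inter> Fil (int p) n" "b \<in> Bc n"
        using y unfolding G_def by auto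
      have "0 + b \<in> G n p"
        unfolding G_def using z F.subspace_0[OF subspace_Zc] F.subspace_0[OF subspace_Fil]
        by blast
      then show ?thesis using z by (intro bexI[of _ z]) auto
    qed
  qed auto
qed

text \<open>Filter \<open>H n\<close> by the images of the cycles in \<open>Fil p n\<close>.
  Presenting its graded pieces gives exactly the pair of \<open>presentation_ss_infty\<close>, and
  the chain \<open>G n\<close> splits into the same pieces.\<close>

lemma convergence:
  assumes H: "\<And>n. \<exists>\<pi>. presentation fs (Zc n) (Bc n) \<pi> (H n)"
  shows "ss_converges R H"
  unfolding ss_converges_def
proof (intro allI conjI)
  fix n
  obtain \<pi> where pres: "presentation fs (Zc n) (Bc n) \<pi> (H n)" using H by auto
  interpret H: presentation fs "Zc n" "Bc n" \<pi> "H n" by (rule pres)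
  obtain \<sigma> where \<sigma>: "\<And>p. p \<le> n \<Longrightarrow> presentation fs (G n (Suc p)) (G n p) (\<sigma> p) (ss_infty R p (n - p))"
  proof -
    have "\<forall>p. \<exists>\<sigma>. p \<le> n \<longrightarrow> presentation fs (G n (Suc p)) (G n p) \<sigma> (ss_infty R p (n - p))"
      using presentation_ss_infty_graded by blast
    then show thesis using that by metis
  qed
  show "vs_iso (H n) (direct_sum {..n} (\<lambda>p. ss_infty R p (n - p)))"
    using pres
    by (intro vs_iso_direct_sum_graded[of fs "G n", OF subspace_G G_mono _ \<sigma>])
      (auto simp: G_0 G_top)
  show "\<exists>F. (\<forall>p. subspace_of (F p) (H n)) \<and> mono F \<and>
      F (-1) = {\<zero>\<^bsub>H n\<^esub>} \<and> F (int n) = carrier (H n) \<and>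
      (\<forall>p\<le>n. vs_iso (subquotient (H n) (F (int p)) (F (int p - 1))) (ss_infty R p (n - p)))"
  proof (intro exI[of _ "\<lambda>p. \<pi> ` (Zc n \<inter> Fil p n)"] conjI allI impI)
    note sub = F.subspace_inter[OF subspace_Zc subspace_Fil]
    show "subspace_of (\<pi> ` (Zc n \<inter> Fil p n)) (H n)" for p
      by (intro H.subspace_of_image sub) auto
    show "mono (\<lambda>p. \<pi> ` (Zc n \<inter> Fil p n))"
      using Fil_mono by (intro monoI image_mono Int_mono) auto
    have "Zc n \<inter> {0} = {0}" using F.subspace_0[OF subspace_Zc] by auto
    then show "\<pi> ` (Zc n \<inter> Fil (-1) n) = {\<zero>\<^bsub>H n\<^esub>}"
      by (simp add: Fil_neg H.proj_zero)
    have "Zc n \<inter> Fil (int n) n = Zc n" by (auto simp: Fil_large Zc_def)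
    then show "\<pi> ` (Zc n \<inter> Fil (int n) n) = carrier (H n)" by (simp add: H.carrier_eq)
    fix p assume p: "p \<le> n"
    obtain \<tau> where \<tau>: "presentation fs (Zc n \<inter> Fil (int p) n) (Zc n \<inter> Fil (int p) n \<inter> G n p) \<tau>
        (ss_infty R p (n - p))"
      using presentation_ss_infty[OF p] by auto
    show "vs_iso (subquotient (H n) (\<pi> ` (Zc n \<inter> Fil (int p) n)) (\<pi> ` (Zc n \<inter> Fil (int p - 1) n)))
        (ss_infty R p (n - p))"
      using H.presentation_subquotient[OF sub[of n "int p"] Int_lower1 sub[of n "int p - 1"]]
        Fil_mono[of "int p - 1" "int p" n]
      by (intro presentation_same_iso[OF _ \<tau>]) (auto simp: G_def)
  qed
qed

end

section \<open>The second page on representatives\<close>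

context bicomplex
begin

text \<open>Together with \<open>two_boundaries\<close> this is the pair of numerator and
  denominator for the horizontal homology of the vertical homology.\<close>

definition two_cycles :: "nat \<Rightarrow> nat \<Rightarrow> 'v set" where
  "two_cycles p q = {x \<in> C p q. (q = 0 \<or> dv p q x = 0) \<and>
    (p = 0 \<or> dh p q x \<in> dv (p - 1) (Suc q) ` C (p - 1) (Suc q))}"

definition two_boundaries :: "nat \<Rightarrow> nat \<Rightarrow> 'v set" where
  "two_boundaries p q = {dh (Suc p) q y + dv p (Suc q) w |y w.
    y \<in> C (Suc p) q \<and> (q = 0 \<or> dv (Suc p) q y = 0) \<and> w \<in> C p (Suc q)}"

lemma T_single: "x \<in> C i (n - i) \<Longrightarrow> i \<le> n \<Longrightarrow> (\<lambda>j. if j = i then x else 0) \<in> T n"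
  by (auto simp: T_def subspace_0[OF subspace_C])

lemma D_nth: "D (Suc (p + q)) x p = dh (Suc p) q (x (Suc p)) + (-1) ^ p *s dv p (Suc q) (x p)"
  by (simp add: D_def Suc_diff_le)

lemma D_nth_beyond:
  assumes "x (Suc i) = 0" "x i = 0" shows "D n x i = 0"
  using assms by (simp add: D_def)

lemma D_nth_top:
  assumes "x (Suc p) = 0" "q \<noteq> 0" shows "D (p + q) x p = (-1) ^ p *s dv p q (x p)"
  using assms by (simp add: D_def)

text \<open>Elements of \<open>Fil (p - 1)\<close> may be added freely, so only component
  \<open>p\<close> matters. A boundary in \<open>Fil (p - 2)\<close> has vanishing components
  \<open>p\<close> and \<open>p - 1\<close>; in the latter, component \<open>p - 1\<close> of the
  chain can be chosen to cancel the horizontal boundary of component \<open>p\<close>.\<close>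

lemma pcyc_two_iff: "x \<in> pcyc 2 p (p + q) \<longleftrightarrow> x \<in> Fil (int p) (p + q) \<and> x p \<in> two_cycles p q"
proof
  assume "x \<in> pcyc 2 p (p + q)"
  then obtain u v where x: "x = u + v" and u: "u \<in> Fil (int p) (p + q)"
    "D (p + q) u \<in> Fil (int p - 2) (p + q - 1)" and v: "v \<in> Fil (int p - 1) (p + q)"
    by (auto simp: pcyc_def app_def)
  have "v \<in> Fil (int p) (p + q)" using v Fil_mono[of "int p - 1" "int p"] by auto
  then have xF: "x \<in> Fil (int p) (p + q)" unfolding x using u by (intro F.subspace_add[OF subspace_Fil])
  have xp: "x p = u p" using v by (simp add: x Fil_def)
  have up: "u p \<in> C p q" using T_nth[OF Fil_T[OF u(1)], of p] by simp
  have u0: "u (Suc p) = 0" using u(1) by (simp add: Fil_def)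
  have Du: "D (p + q) u i = 0" if "int p - 2 < int i" for i using u(2) that by (simp add: Fil_def)
  have "q = 0 \<or> dv p q (u p) = 0"
    using D_nth_top[of u p q] u0 Du[of p] by auto
  moreover have "p = 0 \<or> dh p q (u p) \<in> dv (p - 1) (Suc q) ` C (p - 1) (Suc q)"
  proof (cases p)
    case (Suc m)
    have um: "u m \<in> C m (Suc q)" using T_nth[OF Fil_T[OF u(1)], of m] Suc by (simp add: Suc_diff_le)
    have "dh (Suc m) q (u (Suc m)) + (-1) ^ m *s dv m (Suc q) (u m) = 0"
      using D_nth[of m q u] Du[of m] Suc by simp
    then have "dh p q (u p) = dv m (Suc q) (- ((-1) ^ m *s u m))"
      by (simp add: Suc dv.neg dv.scale eq_neg_iff_add_eq_0)
    then show ?thesis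
      using um Suc subspace_neg[OF subspace_C] subspace_scale[OF subspace_C] by simp
  qed simp
  ultimately show "x \<in> Fil (int p) (p + q) \<and> x p \<in> two_cycles p q"
    using xF xp up by (simp add: two_cycles_def)
next
  assume "x \<in> Fil (int p) (p + q) \<and> x p \<in> two_cycles p q"
  then have xF: "x \<in> Fil (int p) (p + q)" and xp: "x p \<in> C p q" "q = 0 \<or> dv p q (x p) = 0"
    and h: "p = 0 \<or> dh p q (x p) \<in> dv (p - 1) (Suc q) ` C (p - 1) (Suc q)"
    by (auto simp: two_cycles_def)
  \<comment> \<open>A single \<open>y\<close> covers both cases: for \<open>p = 0\<close> there is
    no column to the left and the correction is zero.\<close>
  have "\<exists>y. (p = 0 \<longrightarrow> y = 0) \<and> (p \<noteq> 0 \<longrightarrow> y \<in> C (p - 1) (Suc q) \<and> dh p q (x p) = dv (p - 1) (Suc q) y)"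
    using h by (cases p) auto
  then obtain y where y: "p = 0 \<Longrightarrow> y = 0" "p \<noteq> 0 \<Longrightarrow> y \<in> C (p - 1) (Suc q)"
    "p \<noteq> 0 \<Longrightarrow> dh p q (x p) = dv (p - 1) (Suc q) y" by auto
  \<comment> \<open>With the sign of the vertical differential in \<open>D\<close>, component
    \<open>p - 1\<close> contributes \<open>- dv y\<close>, which cancels \<open>dh\<close> of
    \<open>x p\<close>.\<close>
  define u where "u = (\<lambda>i. if i = p then x p else if Suc i = p then - ((-1) ^ i *s y) else 0)"
  have uT: "u \<in> T (p + q)"
    using xp(1) y(2) subspace_0[OF subspace_C] subspace_neg[OF subspace_C] subspace_scale[OF subspace_C]
    by (auto simp: T_def u_def Suc_diff_le)
  have "D (p + q) u i = 0" if i: "int p - 2 < int i" for i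
  proof -
    consider "i > p" | "i = p" | "Suc i = p" using i by linarith
    then show ?thesis
    proof cases
      case 2
      show ?thesis
      proof (cases "q = 0")
        case False
        then show ?thesis using 2 xp(2) D_nth_top[of u p q] by (simp add: u_def)
      qed (simp add: D_def 2)
    next
      case 3
      then have "D (p + q) u i = dh p q (x p) + (-1) ^ i *s dv i (Suc q) (- ((-1) ^ i *s y))"
        using D_nth[of i q u] by (auto simp: u_def)
      then show ?thesis using y(3) 3 by (auto simp: dv.neg dv.scale)
    qed (auto simp: u_def intro: D_nth_beyond)
  qed
  then have "u \<in> app (int 2) (int p) (p + q)"
    using uT D_T' by (auto simp: app_def Fil_def u_def)
  moreover have "x - u \<in> Fil (int p - 1) (p + q)"
    using uT xF F.subspace_diff[OF subspace_T] by (auto simp: Fil_def u_def)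
  ultimately have "u + (x - u) \<in> pcyc 2 p (p + q)" unfolding pcyc_def by blast
  then show "x \<in> pcyc 2 p (p + q)" by simp
qed

text \<open>A chain of \<open>Fil (p + 1)\<close> with boundary in \<open>Fil p\<close> has a
  vertical cycle as component \<open>p + 1\<close> and an arbitrary component \<open>p\<close>;
  these two determine component \<open>p\<close> of the boundary.\<close>

lemma pbd_two_iff: "x \<in> pbd 2 p (p + q) \<longleftrightarrow> x \<in> Fil (int p) (p + q) \<and> x p \<in> two_boundaries p q"
proof
  assume "x \<in> pbd 2 p (p + q)"
  then obtain w v where x: "x = D (Suc (p + q)) w + v" and w: "w \<in> Fil (int p + 1) (Suc (p + q))"
    "D (Suc (p + q)) w \<in> Fil (int p) (p + q)" and v: "v \<in> Fil (int p - 1) (p + q)"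
    by (auto simp: pbd_def app_def add.commute)
  have "v \<in> Fil (int p) (p + q)" using v Fil_mono[of "int p - 1" "int p"] by auto
  then have xF: "x \<in> Fil (int p) (p + q)" unfolding x using w by (intro F.subspace_add[OF subspace_Fil])
  have xp: "x p = dh (Suc p) q (w (Suc p)) + dv p (Suc q) ((-1) ^ p *s w p)"
    using v D_nth[of p q w] by (simp add: x Fil_def dv.scale)
  have wC: "w (Suc p) \<in> C (Suc p) q" "w p \<in> C p (Suc q)"
    using T_nth[OF Fil_T[OF w(1)], of "Suc p"] T_nth[OF Fil_T[OF w(1)], of p] by (auto simp: Suc_diff_le)
  have "D (Suc p + q) w (Suc p) = 0" using w(2) by (simp add: Fil_def)
  then have "q = 0 \<or> dv (Suc p) q (w (Suc p)) = 0"
    using D_nth_top[of w "Suc p" q] w(1) by (auto simp: Fil_def)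
  then show "x \<in> Fil (int p) (p + q) \<and> x p \<in> two_boundaries p q"
    using xF xp wC subspace_scale[OF subspace_C] unfolding two_boundaries_def by blast
next
  assume "x \<in> Fil (int p) (p + q) \<and> x p \<in> two_boundaries p q"
  then obtain y w where xF: "x \<in> Fil (int p) (p + q)"
    and xp: "x p = dh (Suc p) q y + dv p (Suc q) w"
    and y: "y \<in> C (Suc p) q" "q = 0 \<or> dv (Suc p) q y = 0" and w: "w \<in> C p (Suc q)"
    by (auto simp: two_boundaries_def)
  \<comment> \<open>The factor \<open>(-1) ^ p\<close> cancels the sign in front of
    \<open>dv\<close> in \<open>D\<close>.\<close>
  define W where "W = (\<lambda>i. if i = Suc p then y else if i = p then (-1) ^ p *s w else 0)"
  have WT: "W \<in> T (Suc (p + q))"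
    using y(1) w subspace_0[OF subspace_C] subspace_scale[OF subspace_C]
    by (auto simp: T_def W_def Suc_diff_le)
  have Dp: "D (Suc (p + q)) W p = x p"
    unfolding D_nth by (simp add: xp W_def dv.scale)
  have "D (Suc (p + q)) W i = 0" if i: "p < i" for i
  proof (cases "i = Suc p")
    case True
    show ?thesis
    proof (cases "q = 0")
      case False
      then show ?thesis using True y(2) D_nth_top[of W "Suc p" q] by (simp add: W_def)
    qed (simp add: D_def True)
  qed (use i in \<open>auto simp: W_def intro: D_nth_beyond\<close>)
  then have DF: "D (Suc (p + q)) W \<in> Fil (int p) (p + q)" using WT D_T by (auto simp: Fil_def)
  then have "W \<in> app (int 2 - 1) (int p + int 2 - 1) (Suc (p + q))"
    using WT by (auto simp: app_def Fil_def W_def)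
  moreover have "x - D (Suc (p + q)) W \<in> Fil (int p - 1) (p + q)"
  proof -
    have F: "x - D (Suc (p + q)) W \<in> Fil (int p) (p + q)"
      using xF DF by (rule F.subspace_diff[OF subspace_Fil])
    have "(x - D (Suc (p + q)) W) i = 0" if "int p - 1 < int i" for i
    proof (cases "i = p")
      case False
      then have "int p < int i" using that by linarith
      then show ?thesis using F unfolding Fil_def by blast
    qed (simp add: Dp)
    then show ?thesis using F unfolding Fil_def by blast
  qed
  ultimately have "D (Suc (p + q)) W + (x - D (Suc (p + q)) W) \<in> pbd 2 p (p + q)"
    unfolding pbd_def by blast
  then show "x \<in> pbd 2 p (p + q)" by simp
qed

end

text \<open>By \<open>pcyc_two_iff\<close> and \<open>pbd_two_iff\<close>, taking component
  \<open>p\<close> induces the isomorphism.\<close>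

lemma (in bicomplex_record) second_page:
  assumes N: "presentation s (two_cycles p q) (two_boundaries p q) \<pi> N"
  shows "vs_iso (ss_page R 2 p q) N"
proof -
  have hom: "module_hom fs s (\<lambda>x. x p)" by unfold_locales auto
  have "presentation fs (pcyc 2 p (p + q)) (pbd 2 p (p + q)) (\<pi> \<circ> (\<lambda>x. x p)) N"
  proof (rule presentation_pullback[OF N hom F.vector_space_scale subspace_pcyc subspace_pbd pbd_pcyc])
    fix y assume y: "y \<in> two_cycles p q"
    then have "(\<lambda>j. if j = p then y else 0) \<in> T (p + q)" by (intro T_single) (auto simp: two_cycles_def)
    then have "(\<lambda>j. if j = p then y else 0) \<in> pcyc 2 p (p + q)"
      using y by (auto simp: pcyc_two_iff Fil_def)
    moreover have "0 \<in> two_boundaries p q"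
      using presentation.subspace_B[OF N] by (rule subspace_0)
    ultimately show "\<exists>x\<in>pcyc 2 p (p + q). y - x p \<in> two_boundaries p q"
      by (intro bexI[of _ "\<lambda>j. if j = p then y else 0"]) auto
  next
    fix x assume "x \<in> pcyc 2 p (p + q)"
    then show "x p \<in> two_cycles p q" "x p \<in> two_boundaries p q \<longleftrightarrow> x \<in> pbd 2 p (p + q)"
      by (auto simp: pcyc_two_iff pbd_two_iff)
  qed
  then show ?thesis using presentation_ss_page presentation_same_iso by blast
qed

text \<open>The rows are chain homotopy equivalent to the bottom row, in such a way that the vertical
  differentials become alternately zero and the identity.\<close>

locale row_contractible = bicomplex s C dh dv
  for s :: "'k::field \<Rightarrow> 'v::ab_group_add \<Rightarrow> 'v" (infixr \<open>*s\<close> 75) and C dh dv +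
  fixes k e H :: "nat \<Rightarrow> nat \<Rightarrow> 'v \<Rightarrow> 'v"
  assumes hom_k: "module_hom s s (k q p)" and hom_e: "module_hom s s (e q p)"
    and k_C: "x \<in> C p 0 \<Longrightarrow> k q p x \<in> C p q"
    and e_C: "x \<in> C p q \<Longrightarrow> e q p x \<in> C p 0"
    and H_C: "x \<in> C p q \<Longrightarrow> H q p x \<in> C (Suc p) q"
    and dh_k: "x \<in> C (Suc p) 0 \<Longrightarrow> dh (Suc p) q (k q (Suc p) x) = k q p (dh (Suc p) 0 x)"
    and dh_e: "x \<in> C (Suc p) q \<Longrightarrow> dh (Suc p) 0 (e q (Suc p) x) = e q p (dh (Suc p) q x)"
    and e_k: "x \<in> C p 0 \<Longrightarrow> e q p (k q p x) = x"
    and dv_k: "x \<in> C p 0 \<Longrightarrow> dv p (Suc q) (k (Suc q) p x) = (if odd q then k q p x else 0)"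
    and homotopy_0: "x \<in> C 0 q \<Longrightarrow> x = k q 0 (e q 0 x) + dh (Suc 0) q (H q 0 x)"
    and homotopy: "\<lbrakk>x \<in> C (Suc p) q; dh (Suc p) q x = 0\<rbrakk> \<Longrightarrow>
      x = k q (Suc p) (e q (Suc p) x) + dh (Suc (Suc p)) q (H q (Suc p) x)"
begin

sublocale k: module_hom s s "k q p" for q p by (rule hom_k)
sublocale e: module_hom s s "e q p" for q p by (rule hom_e)

text \<open>Clears the components of \<open>w\<close> from the left, leaving only the last one,
  which lies in row 0. The boundary of \<open>w\<close> has to vanish only above row 0, so that the
  lemma serves both for cycles and for a chain bounding an element of row 0.\<close>

lemma reduce_to_row_0:
  assumes "i \<le> n" "w \<in> T n" "\<And>j. j < i \<Longrightarrow> w j = 0" "\<And>j. Suc j < n \<Longrightarrow> D n w j = 0"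
  shows "\<exists>u\<in>T (Suc n). \<forall>j<n. (w - D (Suc n) u) j = 0"
  using assms
proof (induction i arbitrary: w rule: inc_induct)
  case base
  have "(w - D (Suc n) 0) j = 0" if "j < n" for j
    using base that unfolding D.zero by simp
  then show ?case using T_0 by blast
next
  case (step i)
  obtain r where n: "n = Suc (i + r)" using step less_imp_Suc_add by blast
  define q where "q = Suc r"
  have nq: "n = i + q" by (simp add: n q_def)
  define x where "x = w i"
  have x: "x \<in> C i q" using T_nth[OF step.prems(1), of i] by (simp add: x_def nq)
  define y where "y = e q i x"
  have y: "y \<in> C i 0" using x by (simp add: y_def e_C)
  have Hx: "H q i x \<in> C (Suc i) q" using x by (rule H_C)
  \<comment> \<open>All components to the left of \<open>i\<close> vanish, so component
    \<open>i - 1\<close> of the boundary of \<open>w\<close> reduces to \<open>dh\<close> of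
    \<open>x\<close>: this is a horizontal cycle, and the row contraction applies.\<close>
  have dy: "i = Suc i' \<Longrightarrow> dh i 0 y = 0" and x_eq: "x = k q i y + dh (Suc i) q (H q i x)" for i'
  proof -
    have 1: "dh i q x = 0" if i': "i = Suc i'" for i'
    proof -
      have "D n w i' = 0" using step.prems(3)[of i'] i' n by simp
      moreover have "w i' = 0" using step.prems(2)[of i'] i' by simp
      ultimately show ?thesis using D_nth[of i' q w] i' n by (simp add: x_def q_def)
    qed
    then show "i = Suc i' \<Longrightarrow> dh i 0 y = 0" using x by (simp add: y_def dh_e)
    show "x = k q i y + dh (Suc i) q (H q i x)"
      using x 1 homotopy_0 homotopy by (cases i) (auto simp: y_def)
  qed
  have "\<exists>u\<in>T (Suc n). (\<forall>j<i. D (Suc n) u j = 0) \<and> D (Suc n) u i = x"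
  \<comment> \<open>For odd \<open>q\<close> the part \<open>k q i y\<close> is the vertical
    boundary of \<open>k (Suc q) i y\<close>. For even \<open>q\<close> the vertical boundary of
    \<open>k q i y\<close> is \<open>k r i y\<close>, and the vanishing of component
    \<open>i\<close> of the boundary of \<open>w\<close> forces \<open>y\<close> to be a horizontal
    boundary in row 0.\<close>
  proof (cases "odd q")
    case True
    define u where "u = (\<lambda>j. if j = Suc i then H q i x else if j = i then (-1) ^ i *s k (Suc q) i y else 0)"
    have uT: "u \<in> T (Suc n)"
      using Hx k_C[OF y, of "Suc q"] subspace_0[OF subspace_C] subspace_scale[OF subspace_C]
      by (auto simp: T_def u_def nq Suc_diff_le)
    have "D (Suc n) u i = dh (Suc i) q (H q i x) + k q i y"
      using D_nth[of i q u] dv_k[OF y, of q] True by (simp add: u_def nq dv.scale)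
    then have "D (Suc n) u i = x" using x_eq by (simp add: add.commute)
    moreover have "D (Suc n) u j = 0" if j: "j < i" for j
    proof (cases "Suc j = i")
      case True
      have "dh (Suc j) (Suc q) (k (Suc q) (Suc j) y) = k (Suc q) j (dh (Suc j) 0 y)"
        using y True by (intro dh_k) simp
      then have "dh (Suc j) (Suc q) (u (Suc j)) = 0"
        using True dy[of j] by (simp add: u_def dh.scale)
      moreover have "u j = 0" using True by (auto simp: u_def)
      ultimately show ?thesis using D_nth[of j "Suc q" u] True nq by auto
    next
      case False
      then show ?thesis using j by (intro D_nth_beyond) (auto simp: u_def)
    qed
    ultimately show ?thesis using uT by blast
  next
    case False
    then obtain r' where r: "r = Suc r'" "odd r" by (cases r) (auto simp: q_def)
    have w1: "w (Suc i) \<in> C (Suc i) r" using T_nth[OF step.prems(1), of "Suc i"] by (simp add: n)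
    \<comment> \<open>Obtained by solving component \<open>i\<close> of the boundary equation for
      \<open>k r i y\<close> and applying \<open>e\<close>, which commutes with \<open>dh\<close>;
      this yields \<open>y = dh (Suc i) 0 m\<close>.\<close>
    define m where "m = - ((-1) ^ i *s e r (Suc i) (w (Suc i))) - e r (Suc i) (dv (Suc i) q (H q i x))"
    have dvH: "dv (Suc i) q (H q i x) \<in> C (Suc i) r" using Hx unfolding q_def by (rule dv_C)
    have m: "m \<in> C (Suc i) 0"
      unfolding m_def
      by (intro subspace_diff[OF subspace_C] subspace_neg[OF subspace_C] subspace_scale[OF subspace_C]
          e_C w1 dvH)
    have "D n w i = 0" using step.prems(3)[of i] n r by simp
    then have "dh (Suc i) r (w (Suc i)) + (-1) ^ i *s dv i q x = 0"
      using D_nth[of i r w] by (simp add: x_def q_def n)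
    then have "(-1) ^ i *s (dh (Suc i) r (w (Suc i)) + (-1) ^ i *s dv i q x) = 0" by simp
    then have "(-1) ^ i *s dh (Suc i) r (w (Suc i)) + dv i q x = 0"
      unfolding scale_right_distrib sign_sign .
    moreover have "dv i q x = k r i y + dh (Suc i) r (dv (Suc i) q (H q i x))"
    proof -
      have "dv i q x = dv i q (k q i y) + dv i q (dh (Suc i) q (H q i x))"
        by (subst x_eq) (simp add: dv.add)
      then show ?thesis using dv_k[OF y, of r] r Hx dh_dv[of "H q i x" i r] by (simp add: q_def)
    qed
    ultimately have "k r i y = - ((-1) ^ i *s dh (Suc i) r (w (Suc i))) - dh (Suc i) r (dv (Suc i) q (H q i x))"
      by (simp add: algebra_simps eq_neg_iff_add_eq_0)
    then have "y = e r i (- ((-1) ^ i *s dh (Suc i) r (w (Suc i))) - dh (Suc i) r (dv (Suc i) q (H q i x)))"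
      using e_k[OF y, of r] by simp
    also have "\<dots> = dh (Suc i) 0 m"
      using w1 dvH by (simp add: m_def e.diff e.neg e.scale dh.diff dh.neg dh.scale dh_e)
    finally have ym: "y = dh (Suc i) 0 m" .
    define u where "u = (\<lambda>j. if j = Suc i then k q (Suc i) m + H q i x else 0)"
    have uT: "u \<in> T (Suc n)"
      unfolding u_def using k_C[OF m, of q] Hx
      by (intro T_single subspace_add[OF subspace_C]) (auto simp: nq)
    have "D (Suc n) u i = dh (Suc i) q (k q (Suc i) m + H q i x)"
      using D_nth[of i q u] by (simp add: u_def nq)
    also have "\<dots> = k q i y + dh (Suc i) q (H q i x)" using m ym by (simp add: dh.add dh_k)
    finally have "D (Suc n) u i = x" using x_eq by simp
    moreover have "D (Suc n) u j = 0" if j: "j < i" for j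
      using j by (intro D_nth_beyond) (auto simp: u_def)
    ultimately show ?thesis using uT by blast
  qed
  then obtain u where u: "u \<in> T (Suc n)" "\<And>j. j < i \<Longrightarrow> D (Suc n) u j = 0" "D (Suc n) u i = x"
    by blast
  define w' where "w' = w - D (Suc n) u"
  have "w' \<in> T n" unfolding w'_def using step.prems u D_T by (intro F.subspace_diff[OF subspace_T]) auto
  moreover have "w' j = 0" if "j < Suc i" for j
    using that u step.prems(2) by (cases "j = i") (auto simp: w'_def x_def)
  moreover have "D n w' j = 0" if "Suc j < n" for j
    using that step.prems(3) u(1) by (simp add: w'_def D.diff D_D)
  ultimately obtain u' where u': "u' \<in> T (Suc n)" "\<forall>j<n. (w' - D (Suc n) u') j = 0"
    using step.IH by blast
  show ?case
  proof (intro bexI)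
    show "\<forall>j<n. (w - D (Suc n) (u + u')) j = 0"
      using u'(2) by (simp add: w'_def D.add diff_diff_eq)
  qed (intro F.subspace_add[OF subspace_T] u u')
qed

text \<open>The comparison map is the inclusion of row 0 as last component. Reducing a cycle to row
  0 gives surjectivity on homology; reducing a bounding chain gives injectivity.\<close>

lemma presentation_total_homology:
  assumes N: "presentation s {x \<in> C n 0. n = 0 \<or> dh n 0 x = 0} (dh (Suc n) 0 ` C (Suc n) 0) \<pi> N"
  shows "\<exists>\<pi>. presentation fs (Zc n) (Bc n) \<pi> N"
proof (rule presentation_pushforward[OF N _ F.vector_space_scale subspace_Zc subspace_Bc Bc_Zc])
  let ?f = "\<lambda>m x i. if i = m then x else (0 :: 'v)"
  show "module_hom s fs (?f n)" by unfold_locales (auto simp: fun_eq_iff)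
  have fT: "?f m x \<in> T m" if "x \<in> C m 0" for m x using that by (intro T_single) auto
  have Df: "D (Suc m) (?f (Suc m) x) = ?f m (dh (Suc m) 0 x)" for m x
    by (auto simp: D_def fun_eq_iff)
  show "?f n x \<in> Zc n" if "x \<in> {x \<in> C n 0. n = 0 \<or> dh n 0 x = 0}" for x
    using that fT by (cases n) (auto simp: Zc_def Df fun_eq_iff)
  show "\<exists>x\<in>{x \<in> C n 0. n = 0 \<or> dh n 0 x = 0}. y - ?f n x \<in> Bc n" if y: "y \<in> Zc n" for y
  proof -
    obtain u where u: "u \<in> T (Suc n)" "\<forall>j<n. (y - D (Suc n) u) j = 0"
      using reduce_to_row_0[of 0 n y] y by (auto simp: Zc_def)
    define z where "z = y - D (Suc n) u"
    have z: "z \<in> T n" "D n z = 0"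
      using y u by (auto simp: Zc_def z_def D.diff D_D intro!: F.subspace_diff[OF subspace_T] D_T)
    have "z i = ?f n (z n) i" for i
      using u z(1) unfolding z_def[symmetric] by (cases i n rule: linorder_cases) (auto simp: T_def)
    then have zf: "z = ?f n (z n)" by (rule ext)
    have "n = 0 \<or> dh n 0 (z n) = 0"
    proof (cases n)
      case (Suc m)
      have "D (Suc m) (?f (Suc m) (z n)) = 0" using z(2) zf Suc by simp
      then show ?thesis using Suc by (simp add: Df fun_eq_iff) metis
    qed simp
    moreover have "z n \<in> C n 0" using T_nth[OF z(1), of n] by simp
    moreover have "y - ?f n (z n) = D (Suc n) u" unfolding zf[symmetric] by (simp add: z_def)
    ultimately show ?thesis using u by (intro bexI[of _ "z n"]) (auto simp: Bc_def)
  qed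
  show "?f n x \<in> Bc n \<longleftrightarrow> x \<in> dh (Suc n) 0 ` C (Suc n) 0" if x: "x \<in> {x \<in> C n 0. n = 0 \<or> dh n 0 x = 0}" for x
  proof
    assume "x \<in> dh (Suc n) 0 ` C (Suc n) 0"
    then obtain y where y: "y \<in> C (Suc n) 0" "x = dh (Suc n) 0 y" by auto
    have "?f n x = D (Suc n) (?f (Suc n) y)" unfolding y(2) Df ..
    then show "?f n x \<in> Bc n" unfolding Bc_def using fT[OF y(1)] by blast
  next
    assume "?f n x \<in> Bc n"
    then obtain w where w: "w \<in> T (Suc n)" "?f n x = D (Suc n) w" by (auto simp: Bc_def)
    \<comment> \<open>The boundary of \<open>w\<close> is concentrated in its last component, in row
      0, which is all that \<open>reduce_to_row_0\<close> asks.\<close>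
    have "D (Suc n) w j = 0" if "Suc j < Suc n" for j using that by (simp flip: w(2))
    then obtain u where u: "u \<in> T (Suc (Suc n))" "\<forall>j<Suc n. (w - D (Suc (Suc n)) u) j = 0"
      using reduce_to_row_0[of 0 "Suc n" w] w by auto
    define z where "z = w - D (Suc (Suc n)) u"
    have z: "z \<in> T (Suc n)"
      using w u by (auto simp: z_def intro!: F.subspace_diff[OF subspace_T] D_T)
    have "z i = ?f (Suc n) (z (Suc n)) i" for i
      using u z unfolding z_def[symmetric] by (cases i "Suc n" rule: linorder_cases) (auto simp: T_def)
    then have zf: "z = ?f (Suc n) (z (Suc n))" by (rule ext)
    have "?f n x = D (Suc n) z" using w u by (simp add: z_def D.diff D_D)
    also have "\<dots> = ?f n (dh (Suc n) 0 (z (Suc n)))" by (subst zf) (rule Df)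
    finally have "x = dh (Suc n) 0 (z (Suc n))" by (simp add: fun_eq_iff) metis
    moreover have "z (Suc n) \<in> C (Suc n) 0" using T_nth[OF z, of "Suc n"] by simp
    ultimately show "x \<in> dh (Suc n) 0 ` C (Suc n) 0" by blast
  qed
qed

end

section \<open>Bisimplicial sets\<close>

definition free_bd :: "'a sset \<Rightarrow> nat \<Rightarrow> ('a \<Rightarrow>\<^sub>0 'k::field) \<Rightarrow> ('a \<Rightarrow>\<^sub>0 'k)" where
  "free_bd X n x = (\<Sum>i\<le>n. pscale ((-1) ^ i) (free_map (face X n i) x))"

interpretation free_bd: module_hom pscale pscale "free_bd X n" for X n
  by unfold_locales
    (auto simp: free_bd_def free_map.add free_map.scale pscale.scale_right_distrib sum.distrib
      pscale.scale_sum_right mult.commute)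

lemma supportedD: "x \<in> supported S \<Longrightarrow> a \<in> Poly_Mapping.keys x \<Longrightarrow> a \<in> S"
  by (auto simp: supported_def)

lemma bdry_sset_chains:
  fixes K :: "'k::field itself" and x :: "'a \<Rightarrow>\<^sub>0 'k"
  assumes "simplicial_set X" "x \<in> supported (cells X (Suc n))"
  shows "bdry (sset_chains K X) (Suc n) x = free_bd X (Suc n) x"
proof -
  interpret simplicial_set X by fact
  interpret P: presentation pscale "supported (cells X n)" "{0}" id "free_vs K (cells X n)"
    by (rule presentation_free_vs)
  have "free_map (face X (Suc n) i) x \<in> supported (cells X n)" if "i \<in> {..Suc n}" for i
    using that assms(2) by (auto intro!: free_map_supported face_closed)
  from P.finsum_proj[OF finite_atMost this, where c = "\<lambda>i. (-1) ^ i"] show ?thesis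
    by (simp add: sset_chains_def moore_complex_def free_simplicial_vs_def free_bd_def)
qed

lemma (in simplicial_set) free_bd_supported:
  assumes "x \<in> supported (cells X (Suc n))"
  shows "free_bd X (Suc n) x \<in> supported (cells X n)"
  unfolding free_bd_def using assms
  by (intro pscale.subspace_sum[OF subspace_supported] pscale.subspace_scale[OF subspace_supported])
    (auto intro!: free_map_supported face_closed)

lemma (in simplicial_set) free_bd_free_bd:
  assumes x: "x \<in> supported (cells X (Suc (Suc n)))"
  shows "free_bd X (Suc n) (free_bd X (Suc (Suc n)) x) = 0"
proof -
  let ?T = "\<lambda>i j. free_map (face X (Suc n) i) (free_map (face X (Suc (Suc n)) j) x)"
  have "free_bd X (Suc n) (free_bd X (Suc (Suc n)) x)
      = (\<Sum>i\<le>Suc n. \<Sum>j\<le>Suc (Suc n). pscale ((-1) ^ (i + j)) (?T i j))"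
    unfolding free_bd_def free_map.sum free_map.scale pscale.scale_sum_right
    by (simp only: pscale.scale_scale power_add)
  also have "\<dots> = 0"
  proof (rule pscale.alternating_sum_zero)
    fix i j :: nat assume "i < j" "j \<le> Suc (Suc n)"
    then show "?T i j = ?T (j - 1) i"
      unfolding free_map_free_map using x by (intro free_map_cong face_face) (auto dest: supportedD)
  qed
  finally show ?thesis .
qed

lemma cells_bisset_row [simp]: "cells (bisset_row B q) p = bicells B p q"
  and face_bisset_row [simp]: "face (bisset_row B q) p = hface B p q"
  and degen_bisset_row [simp]: "degen (bisset_row B q) p = hdegen B p q"
  and cells_bisset_column [simp]: "cells (bisset_column B p) q = bicells B p q"
  and face_bisset_column [simp]: "face (bisset_column B p) q = vface B p q"
  and degen_bisset_column [simp]: "degen (bisset_column B p) q = vdegen B p q"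
  by (simp_all add: bisset_row_def bisset_column_def)

locale bisimplicial_set =
  fixes B :: "'b bisset" and K :: "'k::field itself"
  assumes row: "simplicial_set (bisset_row B q)"
    and column: "simplicial_set (bisset_column B p)"
    and hface_vface: "\<lbrakk>x \<in> bicells B (Suc p) (Suc q); i \<le> Suc p; j \<le> Suc q\<rbrakk> \<Longrightarrow>
      hface B (Suc p) q i (vface B (Suc p) (Suc q) j x) = vface B p (Suc q) j (hface B (Suc p) (Suc q) i x)"
    and hdegen_vface: "\<lbrakk>x \<in> bicells B p (Suc q); i \<le> p; j \<le> Suc q\<rbrakk> \<Longrightarrow>
      hdegen B p q i (vface B p (Suc q) j x) = vface B (Suc p) (Suc q) j (hdegen B p (Suc q) i x)"
begin

sublocale row: simplicial_set "bisset_row B q" for q by (rule row)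
sublocale col: simplicial_set "bisset_column B p" for p by (rule column)

definition C :: "nat \<Rightarrow> nat \<Rightarrow> ('b \<Rightarrow>\<^sub>0 'k) set" where
  "C p q = supported (bicells B p q)"

definition dh :: "nat \<Rightarrow> nat \<Rightarrow> ('b \<Rightarrow>\<^sub>0 'k) \<Rightarrow> ('b \<Rightarrow>\<^sub>0 'k)" where
  "dh p q = free_bd (bisset_row B q) p"

definition dv :: "nat \<Rightarrow> nat \<Rightarrow> ('b \<Rightarrow>\<^sub>0 'k) \<Rightarrow> ('b \<Rightarrow>\<^sub>0 'k)" where
  "dv p q = free_bd (bisset_column B p) q"

lemma dv_hface:
  assumes "x \<in> C (Suc p) (Suc q)" "i \<le> Suc p"
  shows "free_map (hface B (Suc p) q i) (dv (Suc p) (Suc q) x)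
    = dv p (Suc q) (free_map (hface B (Suc p) (Suc q) i) x)"
  unfolding dv_def free_bd_def free_map.sum free_map.scale free_map_free_map using assms
  by (intro sum.cong refl arg_cong[where f = "pscale _"] free_map_cong)
    (auto simp: C_def intro!: hface_vface dest: supportedD)

lemma dv_hdegen:
  assumes "x \<in> C p (Suc q)" "i \<le> p"
  shows "free_map (hdegen B p q i) (dv p (Suc q) x)
    = dv (Suc p) (Suc q) (free_map (hdegen B p (Suc q) i) x)"
  unfolding dv_def free_bd_def free_map.sum free_map.scale free_map_free_map using assms
  by (intro sum.cong refl arg_cong[where f = "pscale _"] free_map_cong)
    (auto simp: C_def intro!: hdegen_vface dest: supportedD)

sublocale bicomplex_record pscale C dh dv "bisset_double_complex K B"
proof (intro bicomplex_record.intro bicomplex.intro bicomplex_axioms.intro bicomplex_record_axioms.intro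
    pscale.vector_space_scale, goal_cases)
  case (1 p q)
  then show ?case unfolding C_def by (rule subspace_supported)
next
  case (4 x p q)
  then show ?case using row.free_bd_supported[of x q p] by (simp add: C_def dh_def)
next
  case (5 x p q)
  then show ?case using col.free_bd_supported[of x p q] by (simp add: C_def dv_def)
next
  case (6 x p q)
  then show ?case using row.free_bd_free_bd[of x q p] by (simp add: C_def dh_def)
next
  case (7 x p q)
  then show ?case using col.free_bd_free_bd[of x p q] by (simp add: C_def dv_def)
next
  case (8 x p q)
  have dh_eq: "dh (Suc p) r y = (\<Sum>i\<le>Suc p. pscale ((-1) ^ i) (free_map (hface B (Suc p) r i) y))" for r y
    by (simp only: dh_def free_bd_def face_bisset_row)
  have "dh (Suc p) q (dv (Suc p) (Suc q) x)
      = (\<Sum>i\<le>Suc p. pscale ((-1) ^ i) (dv p (Suc q) (free_map (hface B (Suc p) (Suc q) i) x)))"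
    unfolding dh_eq using 8 by (intro sum.cong) (auto simp: dv_hface)
  also have "\<dots> = dv p (Suc q) (dh (Suc p) (Suc q) x)"
    by (simp only: dh_eq dv_def free_bd.sum free_bd.scale)
  finally show ?case .
next
  case (9 p q)
  then show ?case
    unfolding C_def bisset_double_complex_def double_complex.simps by (rule presentation_free_vs)
next
  case (10 x p q)
  then show ?case
    unfolding C_def dh_def bisset_double_complex_def double_complex.simps
    by (intro bdry_sset_chains row) simp
next
  case (11 x p q)
  then show ?case
    unfolding C_def dv_def bisset_double_complex_def double_complex.simps
    by (intro bdry_sset_chains column) simp
qed (auto simp: dh_def[abs_def] dv_def[abs_def] intro!: free_bd.module_hom_axioms)

section \<open>Homology of the columns and its normalization\<close>

text \<open>The vertical index comes first so that \<open>colcyc q\<close> is a sequence in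
  \<open>p\<close>, the shape of a simplicial vector space.\<close>

definition colcyc :: "nat \<Rightarrow> nat \<Rightarrow> ('b \<Rightarrow>\<^sub>0 'k) set" where
  "colcyc q p = {x \<in> C p q. q = 0 \<or> dv p q x = 0}"

definition colbd :: "nat \<Rightarrow> nat \<Rightarrow> ('b \<Rightarrow>\<^sub>0 'k) set" where
  "colbd q p = dv p (Suc q) ` C p (Suc q)"

abbreviation col_chains :: "nat \<Rightarrow> ('k, 'b \<Rightarrow>\<^sub>0 'k) chain_complex" where
  "col_chains p \<equiv> sset_chains K (bisset_column B p)"

definition col_proj :: "nat \<Rightarrow> nat \<Rightarrow> ('b \<Rightarrow>\<^sub>0 'k) \<Rightarrow> ('b \<Rightarrow>\<^sub>0 'k) set" where
  "col_proj q p x = colbd q p +>\<^bsub>chains (col_chains p) q\<^esub> x"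

lemma chains_col_chains: "chains (col_chains p) q = free_vs K (bicells B p q)"
  by (simp add: sset_chains_def moore_complex_def free_simplicial_vs_def)

lemma
  shows presentation_column: "presentation pscale (colcyc q p) (colbd q p) (col_proj q p) (homology (col_chains p) q)"
    and boundaries_column: "boundaries (col_chains p) q = colbd q p"
proof -
  note hom = presentation_homology[of pscale "C p" "\<lambda>_. {0}" "\<lambda>_. id" "col_chains p" "dv p" q]
  have pres: "presentation pscale (C p n) {0} id (chains (col_chains p) n)" for n
    unfolding chains_col_chains C_def by (rule presentation_free_vs)
  have d_eq: "bdry (col_chains p) (Suc n) (id x) = id (dv p (Suc n) x)" if "x \<in> C p (Suc n)" for n x
    using that bdry_sset_chains[OF column, of x p n K] by (simp add: C_def dv_def)
  note hom = hom[OF pres hom_dv dv_C d_eq]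
  show bd: "boundaries (col_chains p) q = colbd q p"
    using hom(2) by (simp add: colbd_def dv_dv)
  have "sumset (dv p (Suc q) ` C p (Suc q)) {0} = colbd q p"
    by (auto simp: colbd_def)
  then show "presentation pscale (colcyc q p) (colbd q p) (col_proj q p) (homology (col_chains p) q)"
    using hom(1) unfolding bd by (simp add: colcyc_def col_proj_def[abs_def] dv_dv)
qed

lemma free_map_hface_C: "x \<in> C (Suc p) q \<Longrightarrow> i \<le> Suc p \<Longrightarrow> free_map (hface B (Suc p) q i) x \<in> C p q"
  unfolding C_def using row.face_closed[of _ q p i] by (intro free_map_supported) auto

lemma free_map_hdegen_C: "x \<in> C p q \<Longrightarrow> i \<le> p \<Longrightarrow> free_map (hdegen B p q i) x \<in> C (Suc p) q"
  unfolding C_def using row.degen_closed[of _ q p i] by (intro free_map_supported) auto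

lemma keys_colcyc: "x \<in> colcyc q p \<Longrightarrow> a \<in> Poly_Mapping.keys x \<Longrightarrow> a \<in> bicells B p q"
  unfolding colcyc_def C_def by (auto dest: supportedD)

lemmas row_rules = row.face_face row.face_degen_less row.face_degen_same row.face_degen_Suc
  row.face_degen_greater row.degen_degen

lemmas row_bicell_rules = row_rules[unfolded cells_bisset_row face_bisset_row degen_bisset_row]

text \<open>Horizontal operators commute with \<open>dv\<close>, hence preserve vertical cycles and
  boundaries. The simplicial identities hold before passing to homology and are checked on the
  simplices in the support.\<close>

lemma simplicial_quotient_columns:
  "simplicial_quotient pscale (colcyc q) (colbd q) (\<lambda>p i. free_map (hface B p q i)) (\<lambda>p j. free_map (hdegen B p q j))"
proof (intro simplicial_quotient.intro simplicial_quotient_axioms.intro pscale.vector_space_scale, goal_cases)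
  case (1 p)
  then show ?case by (rule presentation.subspace_A[OF presentation_column])
next
  case (2 p)
  then show ?case by (rule presentation.subspace_B[OF presentation_column])
next
  case (3 p)
  then show ?case by (rule presentation.B_subset[OF presentation_column])
next
  case (6 x p i)
  then show ?case
    using dv_hface[of x p "q - 1" i] by (cases q) (auto simp: colcyc_def intro: free_map_hface_C)
next
  case (7 x p i)
  then show ?case
    by (auto simp: colbd_def dv_hface intro!: imageI free_map_hface_C)
next
  case (8 x p j)
  then show ?case
    using dv_hdegen[of x p "q - 1" j] by (cases q) (auto simp: colcyc_def intro: free_map_hdegen_C)
next
  case (9 x p j)
  then show ?case
    by (auto simp: colbd_def dv_hdegen intro!: imageI free_map_hdegen_C)
qed ((rule module_hom_free_map)+,
    (unfold free_map_free_map, intro free_map_cong free_map_ident row_bicell_rules; auto dest: keys_colcyc)+)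

sublocale Q: simplicial_quotient pscale "colcyc q" "colbd q" "\<lambda>p i. free_map (hface B p q i)"
  "\<lambda>p j. free_map (hdegen B p q j)" for q
  by (rule simplicial_quotient_columns)

lemma Q_bd: "Q.bd q p = dh p q"
  by (simp add: Q.bd_def dh_def free_bd_def fun_eq_iff)

abbreviation V :: "nat \<Rightarrow> ('k, ('b \<Rightarrow>\<^sub>0 'k) set) simplicial_vs" where
  "V q \<equiv> column_homology K B q"

lemma vspace_column_homology: "vspace (V q) p = homology (col_chains p) q"
  by (simp add: column_homology_def)

lemma induced_map_column:
  assumes "\<And>x. x \<in> C m q \<Longrightarrow> free_map f x \<in> C m' q"
    and "\<And>x. x \<in> colbd q m \<Longrightarrow> free_map f x \<in> colbd q m'" and "x \<in> C m q"
  shows "induced_map (chains (col_chains m') q) (boundaries (col_chains m') q) (free_map f) (col_proj q m x)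
    = col_proj q m' (free_map f x)"
proof -
  have pres: "presentation pscale (C n q) {0} id (chains (col_chains n) q)" for n
    unfolding chains_col_chains C_def by (rule presentation_free_vs)
  have sub: "colbd q n \<subseteq> C n q" for n by (auto simp: colbd_def dv_C)
  have "induced_map (chains (col_chains m') q) (id ` colbd q m') (free_map f)
      (id ` colbd q m +>\<^bsub>chains (col_chains m) q\<^esub> id x)
    = id ` colbd q m' +>\<^bsub>chains (col_chains m') q\<^esub> id (free_map f x)"
    using assms
    by (intro induced_map_proj[OF pres pres module_hom_free_map subset_refl Q.subspace_B sub Q.subspace_B sub]) auto
  then show ?thesis by (simp add: boundaries_column col_proj_def)
qed

lemma vs_face_column_homology:
  "\<lbrakk>x \<in> colcyc q (Suc p); i \<le> Suc p\<rbrakk> \<Longrightarrow>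
    vs_face (V q) (Suc p) i (col_proj q (Suc p) x) = col_proj q p (free_map (hface B (Suc p) q i) x)"
  using induced_map_column[of "Suc p" q "hface B (Suc p) q i" p x] Q.d_B[of _ q p i] free_map_hface_C[of _ p q i]
  by (simp add: column_homology_def colcyc_def)

lemma vs_degen_column_homology:
  "\<lbrakk>x \<in> colcyc q p; j \<le> p\<rbrakk> \<Longrightarrow>
    vs_degen (V q) p j (col_proj q p x) = col_proj q (Suc p) (free_map (hdegen B p q j) x)"
  using induced_map_column[of p q "hdegen B p q j" "Suc p" x] Q.t_B[of _ q p j] free_map_hdegen_C[of _ p q j]
  by (simp add: column_homology_def colcyc_def)

lemma moore_bdry_column_homology:
  assumes x: "x \<in> colcyc q (Suc p)"
  shows "bdry (moore_complex (V q)) (Suc p) (col_proj q (Suc p) x)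
    = col_proj q p (dh (Suc p) q x)"
proof -
  interpret P: presentation pscale "colcyc q m" "colbd q m" "col_proj q m" "vspace (V q) m" for m
    unfolding vspace_column_homology by (rule presentation_column)
  interpret G: abelian_group "vspace (V q) m" for m by (rule P.abelian_group_M)
  have c: "(-1) ^ i \<odot>\<^bsub>vspace (V q) p\<^esub>
      col_proj q p (free_map (hface B (Suc p) q i) x) \<in> carrier (vspace (V q) p)"
    if "i \<le> Suc p" for i
  proof -
    have y: "free_map (hface B (Suc p) q i) x \<in> colcyc q p" by (intro Q.d_A x that)
    show ?thesis
      unfolding P.carrier_eq P.proj_scale[OF y, symmetric]
      by (intro imageI pscale.subspace_scale[OF Q.subspace_A] y)
  qed
  have "bdry (moore_complex (V q)) (Suc p) (col_proj q (Suc p) x)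
    = (\<Oplus>\<^bsub>vspace (V q) p\<^esub> i \<in> {..Suc p}. (-1) ^ i \<odot>\<^bsub>vspace (V q) p\<^esub>
        col_proj q p (free_map (hface B (Suc p) q i) x))"
    unfolding moore_complex_def chain_complex.simps diff_Suc_1 using c x
    by (intro G.finsum_cong') (auto simp: vs_face_column_homology)
  also have "\<dots> = col_proj q p (\<Sum>i\<in>{..Suc p}. pscale ((-1) ^ i) (free_map (hface B (Suc p) q i) x))"
    using x Q.d_A[of x q p] by (intro P.finsum_proj) auto
  finally show ?thesis by (simp add: dh_def free_bd_def)
qed

text \<open>\<open>Q.degens\<close> contains the vertical boundaries along with the degenerate
  cycles; projection to homology kills the former, so both spans have the same image.\<close>

lemma degenerate_part_column_homology:
  "degenerate_part (V q) p = col_proj q p ` Q.degens q p p"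
proof -
  interpret P: presentation pscale "colcyc q m" "colbd q m" "col_proj q m" "vspace (V q) m" for m
    unfolding vspace_column_homology by (rule presentation_column)
  \<comment> \<open>The doubled condition is the shape that \<open>Q.degens_def\<close> takes for
    equal arguments.\<close>
  let ?U = "\<Union>j\<in>{j. j < p \<and> j < p}. free_map (hdegen B (p - 1) q j) ` colcyc q (p - 1)"
  have U: "?U \<subseteq> colcyc q p" using Q.t_A[of _ q "p - 1"] by (cases p) auto
  have "(\<Union>j<p. vs_degen (V q) (p - 1) j ` carrier (vspace (V q) (p - 1)))
      = (\<Union>j<p. col_proj q p ` free_map (hdegen B (p - 1) q j) ` colcyc q (p - 1))"
    unfolding P.carrier_eq image_image
    by (intro SUP_cong image_cong refl) (use vs_degen_column_homology[of _ q "p - 1"] in auto)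
  also have "\<dots> = col_proj q p ` ?U" by auto
  finally have "degenerate_part (V q) p = col_proj q p ` pscale.span ?U"
    unfolding degenerate_part_def using P.span_in_image[OF U] by simp
  also have "\<dots> = col_proj q p ` Q.degens q p p"
  proof
    have "pscale.span ?U \<subseteq> Q.degens q p p"
      unfolding Q.degens_def by (intro pscale.span_mono) auto
    then show "col_proj q p ` pscale.span ?U \<subseteq> col_proj q p ` Q.degens q p p" by auto
    show "col_proj q p ` Q.degens q p p \<subseteq> col_proj q p ` pscale.span ?U"
    proof
      fix z assume "z \<in> col_proj q p ` Q.degens q p p"
      then obtain y where y: "y \<in> Q.degens q p p" "z = col_proj q p y" by auto
      have span: "pscale.span (colbd q p) = colbd q p" using Q.subspace_B by simp
      obtain b u where bu: "y = b + u" "b \<in> colbd q p" "u \<in> pscale.span ?U"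
        using y(1) unfolding Q.degens_def pscale.span_Un span by blast
      have "u \<in> colcyc q p" using bu(3) pscale.span_minimal[OF U Q.subspace_A] by blast
      moreover have "y \<in> colcyc q p" using y(1) Q.degens_subset by blast
      moreover have "y - u \<in> colbd q p" using bu by simp
      ultimately have "z = col_proj q p u" using y(2) by (simp add: P.proj_eq_iff)
      then show "z \<in> col_proj q p ` pscale.span ?U" using bu by blast
    qed
  qed
  finally show ?thesis by simp
qed

text \<open>Vertical cycles themselves serve as representatives, so that the comparison with the
  second page can be the identity on chains.\<close>

lemma presentation_normalized_homology:
  "\<exists>\<pi>. presentation pscale {x \<in> colcyc q p. p = 0 \<or> dh p q x \<in> Q.degens q (p - 1) (p - 1)}
    (sumset (dh (Suc p) q ` colcyc q (Suc p)) (Q.degens q p p)) \<pi>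
    (homology (normalized_complex (V q)) p)"
proof -
  interpret P: presentation pscale "colcyc q m" "colbd q m" "col_proj q m" "vspace (V q) m" for m
    unfolding vspace_column_homology by (rule presentation_column)
  let ?pr = "\<lambda>p x. col_proj q p ` Q.degens q p p +>\<^bsub>vspace (V q) p\<^esub> col_proj q p x"
  have pres: "presentation pscale (colcyc q p) (Q.degens q p p) (?pr p) (chains (normalized_complex (V q)) p)" for p
  proof -
    have "colcyc q p \<inter> sumset (Q.degens q p p) (colbd q p) = Q.degens q p p"
      using Q.degens_subset[of q p p] Q.B_degens[of _ q p p]
        pscale.subspace_add[OF Q.subspace_degens[of q p p]] pscale.subspace_0[OF Q.subspace_B[of q p]]
      by (auto simp: subset_eq) (metis add.right_neutral)
    then show ?thesis
      using P.presentation_subquotient[OF Q.subspace_A subset_refl Q.subspace_degens Q.degens_subset, of p p]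
      by (simp add: normalized_complex_def degenerate_part_column_homology P.carrier_eq)
  qed
  have bdry: "bdry (normalized_complex (V q)) (Suc n) (?pr (Suc n) x) = ?pr n (dh (Suc n) q x)"
    if x: "x \<in> colcyc q (Suc n)" for n x
  proof -
    have g: "dh (Suc n) q y \<in> colcyc q n" if "y \<in> colcyc q (Suc n)" for y
      using Q.bd_A[OF that] by (simp add: Q_bd)
    have g2: "dh (Suc n) q y \<in> Q.degens q n n" if "y \<in> Q.degens q (Suc n) (Suc n)" for y
    proof -
      have "Q.bd q (Suc n) y \<in> Q.degens q (Suc n) n" using that by (rule Q.bd_degens)
      \<comment> \<open>In degree \<open>n\<close> only indices below \<open>n\<close> exist, so
        admitting the index \<open>n\<close> adds nothing.\<close>
      also have "Q.degens q (Suc n) n = Q.degens q n n"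
      proof -
        have "{i. i < Suc n \<and> i < n} = {i. i < n \<and> i < n}" by auto
        then show ?thesis by (simp only: Q.degens_def)
      qed
      finally show ?thesis by (simp add: Q_bd)
    qed
    show ?thesis
      unfolding normalized_complex_def chain_complex.simps diff_Suc_1 degenerate_part_column_homology
      using x by (intro induced_map_proj[OF P.presentation_axioms P.presentation_axioms hom_dh subset_refl
            Q.subspace_degens Q.degens_subset Q.subspace_degens Q.degens_subset]
          moore_bdry_column_homology g g2)
  qed
  have dA: "dh (Suc n) q x \<in> colcyc q n" if "x \<in> colcyc q (Suc n)" for n x
    using Q.bd_A[OF that] by (simp add: Q_bd)
  have dd: "dh (Suc n) q (dh (Suc (Suc n)) q x) \<in> Q.degens q n n" if "x \<in> colcyc q (Suc (Suc n))" for n x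
    using Q.bd_bd[OF that] pscale.subspace_0[OF Q.subspace_degens] by (simp add: Q_bd)
  show ?thesis
    by (intro exI, rule presentation_homology(1)[OF pres hom_dh]) (fact dA, fact bdry, fact dd)
qed

text \<open>Both sides are represented by vertical cycles; the denominator contains
  \<open>colbd\<close> for the page and all of \<open>Q.degens\<close> for the normalized complex.
  Normalization says that the identity on representatives induces an isomorphism.\<close>

theorem second_page_bisimplicial:
  "vs_iso (ss_page (bisset_double_complex K B) 2 p q) (homology (normalized_complex (V q)) p)"
proof -
  obtain \<pi> where \<pi>: "presentation pscale {x \<in> colcyc q p. p = 0 \<or> dh p q x \<in> Q.degens q (p - 1) (p - 1)}
    (sumset (dh (Suc p) q ` colcyc q (Suc p)) (Q.degens q p p)) \<pi>
    (homology (normalized_complex (V q)) p)" (is "presentation _ ?Z ?B _ _")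
    using presentation_normalized_homology by blast
  have Z: "two_cycles p q = {x \<in> colcyc q p. p = 0 \<or> dh p q x \<in> colbd q (p - 1)}"
    by (auto simp: two_cycles_def colcyc_def colbd_def)
  have B: "two_boundaries p q = sumset (dh (Suc p) q ` colcyc q (Suc p)) (colbd q p)"
    unfolding two_boundaries_def colcyc_def colbd_def by blast
  have hom_id: "module_hom pscale pscale id" by unfold_locales auto
  have "presentation pscale (two_cycles p q) (two_boundaries p q) (\<pi> \<circ> id)
    (homology (normalized_complex (V q)) p)"
  proof (rule presentation_pullback[OF \<pi> hom_id pscale.vector_space_scale])
    show "pscale.subspace (two_cycles p q)"
    proof (cases p)
      case 0
      then show ?thesis unfolding Z using Q.subspace_A by simp
    next
      case (Suc m)
      have "two_cycles p q = colcyc q p \<inter> {x. dh p q x \<in> colbd q m}" unfolding Z using Suc by auto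
      then show ?thesis
        using pscale.subspace_inter[OF Q.subspace_A dh.subspace_linear_preimage[OF Q.subspace_B]] by simp
    qed
    show "pscale.subspace (two_boundaries p q)"
      unfolding B by (intro pscale.subspace_sums dh.subspace_image Q.subspace_A Q.subspace_B)
    show "two_boundaries p q \<subseteq> two_cycles p q"
    proof
      fix x assume "x \<in> two_boundaries p q"
      then obtain y b where x: "x = dh (Suc p) q y + b" "y \<in> colcyc q (Suc p)" "b \<in> colbd q p"
        unfolding B by blast
      have "x \<in> colcyc q p"
        using x Q.bd_A[of y q p] Q.B_subset[of q p] by (auto simp: Q_bd intro!: pscale.subspace_add[OF Q.subspace_A])
      moreover have "p = 0 \<or> dh p q x \<in> colbd q (p - 1)"
        using x Q.bd_bd[of y q "p - 1"] Q.bd_B[of b q "p - 1"] by (cases p) (auto simp: Q_bd dh.add)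
      ultimately show "x \<in> two_cycles p q" unfolding Z by blast
    qed
    show "id x \<in> ?Z" if "x \<in> two_cycles p q" for x
      using that Q.B_degens unfolding Z by auto
    show "\<exists>x\<in>two_cycles p q. y - id x \<in> ?B" if y: "y \<in> ?Z" for y
    proof -
      obtain x where x: "x \<in> colcyc q p" "p = 0 \<or> dh p q x \<in> colbd q (p - 1)" "y - x \<in> Q.degens q p p"
        using Q.normalization_surj[of y q p] y by (auto simp: Q_bd)
      have "dh (Suc p) q 0 + (y - x) \<in> ?B" using x pscale.subspace_0[OF Q.subspace_A] by blast
      then show ?thesis using x unfolding Z by (intro bexI[of _ x]) (auto simp: dh.zero)
    qed
    show "id x \<in> ?B \<longleftrightarrow> x \<in> two_boundaries p q" if x: "x \<in> two_cycles p q" for x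
    proof
      assume "id x \<in> ?B"
      then obtain y e where "x = dh (Suc p) q y + e" "y \<in> colcyc q (Suc p)" "e \<in> Q.degens q p p"
        by auto
      then obtain y' b where "y' \<in> colcyc q (Suc p)" "b \<in> colbd q p" "x = dh (Suc p) q y' + b"
        using Q.normalization_inj[of x q p y e] x unfolding Z by (auto simp: Q_bd)
      then show "x \<in> two_boundaries p q" unfolding B by blast
    next
      assume "x \<in> two_boundaries p q"
      then obtain y b where "x = y + b" "y \<in> dh (Suc p) q ` colcyc q (Suc p)" "b \<in> colbd q p"
        unfolding B by blast
      then show "id x \<in> ?B" using Q.B_degens[of b q p p] by (simp only: id_apply) blast
    qed
  qed
  then show ?thesis by (rule second_page)
qed

end

section \<open>The section complex\<close>

lemma sorted_wrt_nth_mono: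
  fixes s :: "'a::order list"
  assumes "sorted_wrt (\<le>) s" "i \<le> j" "j < length s"
  shows "s ! i \<le> s ! j"
  using assms by (cases "i = j") (auto simp: sorted_wrt_iff_nth_less)

lemma nth_le: "set s \<subseteq> {..p} \<Longrightarrow> i < length s \<Longrightarrow> s ! i \<le> p"
  using nth_mem[of i s] by blast

lemma nerve_face_closed:
  assumes "xs \<in> cells (nerve A) (Suc n)" "i \<le> Suc n"
  shows "take i xs @ drop (Suc i) xs \<in> cells (nerve A) n"
proof -
  have xs: "length xs = Suc (Suc n)" "set xs \<subseteq> A" "sorted_wrt (\<le>) xs"
    using assms(1) by (auto simp: nerve_def)
  have "sorted_wrt (\<le>) (take i xs @ drop (Suc i) xs)"
    unfolding sorted_wrt_append using xs sorted_wrt_nth_mono[OF xs(3)]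
    by (auto simp: sorted_wrt_take sorted_wrt_drop in_set_conv_nth)
  then show ?thesis
    using xs assms(2) set_take_subset[of i xs] set_drop_subset[of "Suc i" xs]
    by (auto simp: nerve_def)
qed

lemma nerve_degen_closed:
  assumes "xs \<in> cells (nerve A) n" "j \<le> n"
  shows "take (Suc j) xs @ drop j xs \<in> cells (nerve A) (Suc n)"
proof -
  have xs: "length xs = Suc n" "set xs \<subseteq> A" "sorted_wrt (\<le>) xs"
    using assms(1) by (auto simp: nerve_def)
  have "sorted_wrt (\<le>) (take (Suc j) xs @ drop j xs)"
    unfolding sorted_wrt_append using xs sorted_wrt_nth_mono[OF xs(3)]
    by (auto simp: sorted_wrt_take sorted_wrt_drop in_set_conv_nth)
  then show ?thesis
    using xs assms(2) set_take_subset[of "Suc j" xs] set_drop_subset[of j xs]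
    by (auto simp: nerve_def)
qed

lemma prism_cells_iff:
  "(s, t) \<in> cells (prism p q) n \<longleftrightarrow>
    length s = Suc n \<and> set s \<subseteq> {..p} \<and> sorted_wrt (\<le>) s \<and>
    length t = Suc n \<and> set t \<subseteq> {..q} \<and> sorted_wrt (\<le>) t"
  by (auto simp: sset_prod_def std_simplex_def nerve_def)

lemma prism_face: "face (prism p q) n i (s, t) = (take i s @ drop (Suc i) s, take i t @ drop (Suc i) t)"
  and prism_degen: "degen (prism p q) n j (s, t) = (take (Suc j) s @ drop j s, take (Suc j) t @ drop j t)"
  by (simp_all add: sset_prod_def std_simplex_def nerve_def)

lemma prism_face_closed:
  "\<lbrakk>x \<in> cells (prism p q) (Suc n); i \<le> Suc n\<rbrakk> \<Longrightarrow> face (prism p q) (Suc n) i x \<in> cells (prism p q) n"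
  using nerve_face_closed[of _ "{..p}" n i] nerve_face_closed[of _ "{..q}" n i]
  by (cases x) (auto simp: sset_prod_def std_simplex_def, auto simp: nerve_def)

lemma prism_degen_closed:
  "\<lbrakk>x \<in> cells (prism p q) n; j \<le> n\<rbrakk> \<Longrightarrow> degen (prism p q) n j x \<in> cells (prism p q) (Suc n)"
  using nerve_degen_closed[of _ "{..p}" n j] nerve_degen_closed[of _ "{..q}" n j]
  by (cases x) (auto simp: sset_prod_def std_simplex_def, auto simp: nerve_def)

text \<open>Monotone maps $[p'] \times [q'] \to [p] \times [q]$ over a monotone map $[p'] \to [p]$. All
  operators needed on sections are precompositions with such maps.\<close>

definition admissible ::
  "nat \<Rightarrow> nat \<Rightarrow> nat \<Rightarrow> nat \<Rightarrow> (nat \<Rightarrow> nat) \<Rightarrow> (nat \<Rightarrow> nat \<Rightarrow> nat) \<Rightarrow> bool" where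
  "admissible p q p' q' u w \<longleftrightarrow>
    (\<forall>x x'. x \<le> x' \<longrightarrow> x' \<le> p' \<longrightarrow> u x \<le> u x' \<and> u x' \<le> p) \<and>
    (\<forall>x x' y y'. x \<le> x' \<longrightarrow> x' \<le> p' \<longrightarrow> y \<le> y' \<longrightarrow> y' \<le> q' \<longrightarrow> w x y \<le> w x' y' \<and> w x' y' \<le> q)"

definition reindex ::
  "(nat \<Rightarrow> nat) \<Rightarrow> (nat \<Rightarrow> nat \<Rightarrow> nat) \<Rightarrow> nat \<Rightarrow> nat list \<times> nat list \<Rightarrow> nat list \<times> nat list" where
  "reindex u w n = (\<lambda>(s, t). (map u s, map2 w s t))"

text \<open>The second index function also takes the first coordinate because the prism homotopy
  switches from \<open>y\<close> to the last vertex along the first factor.\<close>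

definition pull ::
  "nat \<Rightarrow> nat \<Rightarrow> (nat \<Rightarrow> nat) \<Rightarrow> (nat \<Rightarrow> nat \<Rightarrow> nat) \<Rightarrow>
    real list \<times> (nat \<Rightarrow> nat list \<times> nat list \<Rightarrow> 'a) \<Rightarrow> real list \<times> (nat \<Rightarrow> nat list \<times> nat list \<Rightarrow> 'a)" where
  "pull p' q' u w = (\<lambda>(a, \<rho>). (map (\<lambda>i. a ! u i) [0..<Suc p'], sset_comp (prism p' q') \<rho> (reindex u w)))"

lemma reindex_cells:
  assumes adm: "admissible p q p' q' u w" and x: "x \<in> cells (prism p' q') n"
  shows "reindex u w n x \<in> cells (prism p q) n"
proof -
  obtain s t where st: "x = (s, t)" by (cases x)
  note x = x[unfolded st prism_cells_iff]
  have s: "s ! i \<le> s ! j" "s ! j \<le> p'" if "i \<le> j" "j < Suc n" for i j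
    using x that sorted_wrt_nth_mono[of s i j] nth_le[of s p' j] by auto
  have t: "t ! i \<le> t ! j" "t ! j \<le> q'" if "i \<le> j" "j < Suc n" for i j
    using x that sorted_wrt_nth_mono[of t i j] nth_le[of t q' j] by auto
  have u: "u (s ! i) \<le> u (s ! j)" "u (s ! j) \<le> p" if "i \<le> j" "j < Suc n" for i j
    using adm s[OF that] unfolding admissible_def by blast+
  have w: "w (s ! i) (t ! i) \<le> w (s ! j) (t ! j)" "w (s ! j) (t ! j) \<le> q" if "i \<le> j" "j < Suc n" for i j
    using adm s[OF that] t[OF that] unfolding admissible_def by blast+
  have "set (map u s) \<subseteq> {..p}" "set (map2 w s t) \<subseteq> {..q}"
    using u(2)[OF order.refl] w(2)[OF order.refl] x by (auto simp: in_set_conv_nth)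
  moreover have "sorted_wrt (\<le>) (map u s)" "sorted_wrt (\<le>) (map2 w s t)"
    using u w x by (auto simp: sorted_wrt_iff_nth_less)
  ultimately show ?thesis using x by (simp add: st reindex_def prism_cells_iff)
qed

lemma reindex_face:
  assumes "x \<in> cells (prism p' q') m"
  shows "reindex u w n (face (prism p' q') k i x) = face (prism p q) k i (reindex u w n x)"
  using assms by (cases x)
    (simp add: prism_cells_iff prism_face reindex_def take_map drop_map take_zip drop_zip)

lemma reindex_degen:
  assumes "x \<in> cells (prism p' q') m"
  shows "reindex u w n (degen (prism p' q') k i x) = degen (prism p q) k i (reindex u w n' x)"
  using assms by (cases x)
    (simp add: prism_cells_iff prism_degen reindex_def take_map drop_map take_zip drop_zip)

lemma sset_comp_apply: "x \<in> cells Y n \<Longrightarrow> sset_comp Y g f n x = g n (f n x)"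
  by (simp add: sset_comp_def)

lemma sset_comp_cong:
  assumes "\<And>n x. x \<in> cells Y n \<Longrightarrow> g n (f n x) = g' n (f' n x)"
  shows "sset_comp Y g f = sset_comp Y g' f'"
  using assms by (auto simp: sset_comp_def fun_eq_iff restrict_def)

text \<open>With \<open>pull_cong\<close>, this turns identities between operators, including those
  of the prism homotopy, into equations between index functions.\<close>

lemma pull_pull:
  assumes "admissible p' q' p'' q'' u2 w2"
  shows "pull p'' q'' u2 w2 (pull p' q' u1 w1 x)
    = pull p'' q'' (\<lambda>i. u1 (u2 i)) (\<lambda>x y. w1 (u2 x) (w2 x y)) x"
proof -
  obtain a \<rho> where x: "x = (a, \<rho>)" by (cases x)
  have "u2 i \<le> p'" if "i \<le> p''" for i using assms that unfolding admissible_def by blast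
  then have "map (\<lambda>i. map (\<lambda>i. a ! u1 i) [0..<Suc p'] ! u2 i) [0..<Suc p'']
      = map (\<lambda>i. a ! u1 (u2 i)) [0..<Suc p'']"
    by (intro map_cong refl) (auto simp: nth_append less_Suc_eq_le simp del: upt_Suc)
  moreover have "sset_comp (prism p'' q'') (sset_comp (prism p' q') \<rho> (reindex u1 w1)) (reindex u2 w2)
      = sset_comp (prism p'' q'') \<rho> (reindex (\<lambda>i. u1 (u2 i)) (\<lambda>x y. w1 (u2 x) (w2 x y)))"
  proof (rule sset_comp_cong)
    fix n y assume y: "y \<in> cells (prism p'' q'') n"
    obtain s t where st: "y = (s, t)" by (cases y)
    have "map2 w1 (map u2 s) (map2 w2 s t) = map2 (\<lambda>x y. w1 (u2 x) (w2 x y)) s t"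
      by (rule nth_equalityI) auto
    then have "reindex u1 w1 n (reindex u2 w2 n y)
        = reindex (\<lambda>i. u1 (u2 i)) (\<lambda>x y. w1 (u2 x) (w2 x y)) n y"
      by (simp add: st reindex_def)
    then show "sset_comp (prism p' q') \<rho> (reindex u1 w1) n (reindex u2 w2 n y)
        = \<rho> n (reindex (\<lambda>i. u1 (u2 i)) (\<lambda>x y. w1 (u2 x) (w2 x y)) n y)"
      using reindex_cells[OF assms y] by (simp add: sset_comp_apply)
  qed
  ultimately show ?thesis by (simp add: x pull_def)
qed

lemma pull_cong:
  assumes u: "\<And>i. i \<le> p' \<Longrightarrow> u i = u' i"
    and w: "\<And>x y. \<lbrakk>x \<le> p'; y \<le> q'\<rbrakk> \<Longrightarrow> w x y = w' x y"
  shows "pull p' q' u w x = pull p' q' u' w' x"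
proof -
  obtain a \<rho> where x: "x = (a, \<rho>)" by (cases x)
  have "reindex u w n y = reindex u' w' n y" if "y \<in> cells (prism p' q') n" for n y
  proof -
    obtain s t where st: "y = (s, t)" by (cases y)
    note y = that[unfolded st prism_cells_iff]
    have "s ! i \<le> p'" "t ! i \<le> q'" if "i < Suc n" for i
      using y that nth_le[of s p' i] nth_le[of t q' i] by auto
    then have "map u s = map u' s" "map2 w s t = map2 w' s t"
      using y by (auto simp: list_eq_iff_nth_eq u w)
    then show ?thesis by (simp add: st reindex_def)
  qed
  then have "sset_comp (prism p' q') \<rho> (reindex u w) = sset_comp (prism p' q') \<rho> (reindex u' w')"
    by (intro sset_comp_cong) simp
  moreover have "map (\<lambda>i. a ! u i) [0..<Suc p'] = map (\<lambda>i. a ! u' i) [0..<Suc p']"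
    by (intro map_cong refl) (auto simp: u simp del: upt_Suc)
  ultimately show ?thesis by (simp add: x pull_def)
qed

lemma map2_snd: "length s = length t \<Longrightarrow> map2 (\<lambda>x y. f y) s t = map f t"
  by (rule nth_equalityI) auto

locale height_space = simplicial_set X for X :: "'a sset" +
  fixes h :: "nat \<Rightarrow> 'a \<Rightarrow> real list"
  assumes height: "height_function X h"
begin

abbreviation S :: "(real list \<times> (nat \<Rightarrow> nat list \<times> nat list \<Rightarrow> 'a)) bisset" where
  "S \<equiv> section_complex X h"

lemma bicells_iff: "(a, \<rho>) \<in> bicells S p q \<longleftrightarrow> a \<in> cells real_line p \<and> \<rho> \<in> sections X h p a q"
  by (simp add: section_complex_def)

lemma cells_real_line: "a \<in> cells real_line p \<longleftrightarrow> length a = Suc p \<and> sorted_wrt (\<le>) a"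
  by (simp add: real_line_def nerve_def)

text \<open>The new first coordinate is \<open>u\<close> of the old one alone, so the height of the
  reindexed simplex is read off from \<open>a\<close> composed with \<open>u\<close>. This is why
  admissible maps lie over a map of the first factor.\<close>

lemma pull_closed:
  assumes x: "x \<in> bicells S p q" and adm: "admissible p q p' q' u w"
  shows "pull p' q' u w x \<in> bicells S p' q'"
proof -
  obtain a \<rho> where ar: "x = (a, \<rho>)" by (cases x)
  have a: "length a = Suc p" "sorted_wrt (\<le>) a"
    and \<rho>: "simplicial_map (prism p q) X \<rho>"
    and h: "\<And>n s t. (s, t) \<in> cells (prism p q) n \<Longrightarrow> h n (\<rho> n (s, t)) = map ((!) a) s"
    using x unfolding ar bicells_iff cells_real_line sections_def sset_hom_def by auto
  let ?a = "map (\<lambda>i. a ! u i) [0..<Suc p']" and ?\<rho> = "sset_comp (prism p' q') \<rho> (reindex u w)"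
  have u: "u i \<le> u j" "u j \<le> p" if "i \<le> j" "j \<le> p'" for i j
    using adm that unfolding admissible_def by blast+
  have "a ! u i \<le> a ! u j" if "i < j" "j \<le> p'" for i j
    using a u[of i j] that by (intro sorted_wrt_nth_mono[OF a(2)]) auto
  then have "?a \<in> cells real_line p'"
    by (auto simp: cells_real_line sorted_wrt_iff_nth_less less_Suc_eq_le simp del: upt_Suc)
  moreover have "simplicial_map (prism p' q') X ?\<rho>"
    unfolding simplicial_map_def
  proof (intro conjI allI ballI impI)
    note rc = reindex_cells[OF adm]
    show "?\<rho> n y \<in> cells X n" if "y \<in> cells (prism p' q') n" for n y
      using \<rho> rc[OF that] that by (simp add: sset_comp_apply simplicial_map_def)
    show "?\<rho> n (face (prism p' q') (Suc n) i y) = face X (Suc n) i (?\<rho> (Suc n) y)"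
      if "y \<in> cells (prism p' q') (Suc n)" "i \<le> Suc n" for n y i
    proof -
      have "?\<rho> n (face (prism p' q') (Suc n) i y) = \<rho> n (face (prism p q) (Suc n) i (reindex u w n y))"
        using prism_face_closed[OF that] by (simp add: sset_comp_apply reindex_face[OF that(1), where p = p and q = q])
      also have "reindex u w n y = reindex u w (Suc n) y" by (simp add: reindex_def)
      also have "\<rho> n (face (prism p q) (Suc n) i (reindex u w (Suc n) y))
          = face X (Suc n) i (\<rho> (Suc n) (reindex u w (Suc n) y))"
        using \<rho> rc[OF that(1)] that(2) by (simp add: simplicial_map_def)
      finally show ?thesis using that(1) by (simp add: sset_comp_apply)
    qed
    show "?\<rho> (Suc n) (degen (prism p' q') n j y) = degen X n j (?\<rho> n y)"
      if "y \<in> cells (prism p' q') n" "j \<le> n" for n y j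
    proof -
      have "?\<rho> (Suc n) (degen (prism p' q') n j y) = \<rho> (Suc n) (degen (prism p q) n j (reindex u w n y))"
        using prism_degen_closed[OF that] by (simp add: sset_comp_apply reindex_degen[OF that(1), where p = p and q = q and n' = n])
      also have "\<dots> = degen X n j (\<rho> n (reindex u w n y))"
        using \<rho> rc[OF that(1)] that(2) by (simp add: simplicial_map_def)
      finally show ?thesis using that(1) by (simp add: sset_comp_apply)
    qed
  qed
  moreover have "?\<rho> n \<in> extensional (cells (prism p' q') n)" for n
    by (simp add: sset_comp_def)
  moreover have "h n (?\<rho> n (s, t)) = map ((!) ?a) s" if st: "(s, t) \<in> cells (prism p' q') n" for n s t
  proof -
    have "h n (?\<rho> n (s, t)) = map ((!) a) (map u s)"
      using h reindex_cells[OF adm st] st by (simp add: sset_comp_apply reindex_def)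
    also have "\<dots> = map ((!) ?a) s"
      using st unfolding prism_cells_iff by (auto simp: less_Suc_eq_le subset_eq simp del: upt_Suc)
    finally show ?thesis .
  qed
  ultimately show ?thesis
    by (auto simp: ar pull_def bicells_iff sections_def sset_hom_def)
qed

lemma pull_ident:
  assumes x: "x \<in> bicells S p q" and u: "\<And>i. i \<le> p \<Longrightarrow> u i = i"
    and w: "\<And>i j. i \<le> p \<Longrightarrow> j \<le> q \<Longrightarrow> w i j = j"
  shows "pull p q u w x = x"
proof -
  obtain a \<rho> where ar: "x = (a, \<rho>)" by (cases x)
  have a: "length a = Suc p" and exten: "\<And>n. \<rho> n \<in> extensional (cells (prism p q) n)"
    using x unfolding ar bicells_iff cells_real_line sections_def sset_hom_def by auto
  have "map (\<lambda>i. a ! i) [0..<Suc p] = a" using a by (metis map_nth)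
  moreover have "sset_comp (prism p q) \<rho> (reindex (\<lambda>i. i) (\<lambda>i j. j)) = \<rho>"
  proof (intro ext)
    fix n y
    show "sset_comp (prism p q) \<rho> (reindex (\<lambda>i. i) (\<lambda>i j. j)) n y = \<rho> n y"
    proof (cases "y \<in> cells (prism p q) n")
      case True
      then have "reindex (\<lambda>i. i) (\<lambda>i j. j) n y = y"
        by (cases y) (simp add: prism_cells_iff reindex_def map2_snd)
      then show ?thesis using True by (simp add: sset_comp_apply)
    next
      \<comment> \<open>Off the cells of the prism both functions are \<open>undefined\<close>,
        since sections are extensional.\<close>
      case False
      then show ?thesis using extensional_arb[OF exten[of n]] by (simp add: sset_comp_def)
    qed
  qed
  moreover have "pull p q u w x = pull p q (\<lambda>i. i) (\<lambda>i j. j) x" by (rule pull_cong) (auto simp: u w)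
  ultimately show ?thesis by (simp add: ar pull_def)
qed

lemma pull_eqI:
  assumes "(a, \<rho>) \<in> bicells S p q \<Longrightarrow> length a = Suc p \<Longrightarrow> a' = map (\<lambda>k. a ! u k) [0..<Suc p']"
    and "\<And>s t. length s = length t \<Longrightarrow> g (s, t) = (map u s, map2 w s t)"
    and "(a, \<rho>) \<in> bicells S p q"
  shows "(a', sset_comp (prism p' q') \<rho> (\<lambda>n. g)) = pull p' q' u w (a, \<rho>)"
proof -
  have "length a = Suc p" using assms(3) unfolding bicells_iff cells_real_line by simp
  moreover have "sset_comp (prism p' q') \<rho> (\<lambda>n. g) = sset_comp (prism p' q') \<rho> (reindex u w)"
    using assms(2) by (intro sset_comp_cong) (auto simp: prism_cells_iff reindex_def)
  ultimately show ?thesis using assms(1,3) by (simp add: pull_def del: upt_Suc)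
qed

lemma hface_pull:
  assumes "x \<in> bicells S (Suc p) q" "i \<le> Suc p"
  shows "hface S (Suc p) q i x = pull p q (coface i) (\<lambda>x y. y) x"
proof -
  obtain a \<rho> where x: "x = (a, \<rho>)" by (cases x)
  have "take i a @ drop (Suc i) a = map (\<lambda>k. a ! coface i k) [0..<Suc p]" if "length a = Suc (Suc p)"
    using that assms(2) by (intro nth_equalityI) (auto simp: nth_append coface_def simp del: upt_Suc)
  then show ?thesis
    using pull_eqI[OF _ _ assms(1)[unfolded x]]
    by (simp add: x section_complex_def real_line_def nerve_def map2_snd del: upt_Suc)
qed

lemma hdegen_pull:
  assumes "x \<in> bicells S p q" "j \<le> p"
  shows "hdegen S p q j x = pull (Suc p) q (codegen j) (\<lambda>x y. y) x"
proof -
  obtain a \<rho> where x: "x = (a, \<rho>)" by (cases x)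
  have "take (Suc j) a @ drop j a = map (\<lambda>k. a ! codegen j k) [0..<Suc (Suc p)]" if "length a = Suc p"
    using that assms(2)
    by (intro nth_equalityI) (auto simp: nth_append codegen_def min_def simp del: upt_Suc)
  then show ?thesis
    using pull_eqI[OF _ _ assms(1)[unfolded x]]
    by (simp add: x section_complex_def real_line_def nerve_def map2_snd del: upt_Suc)
qed

lemma vface_pull:
  assumes "x \<in> bicells S p (Suc q)"
  shows "vface S p (Suc q) j x = pull p q (\<lambda>i. i) (\<lambda>x y. coface j y) x"
proof -
  obtain a \<rho> where x: "x = (a, \<rho>)" by (cases x)
  have "a = map (\<lambda>i. a ! i) [0..<Suc p]" if "length a = Suc p"
    using that map_nth[of a] by simp
  then show ?thesis
    using pull_eqI[OF _ _ assms[unfolded x]]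
    by (simp add: x section_complex_def real_line_def nerve_def map2_snd del: upt_Suc)
qed

lemma vdegen_pull:
  assumes "x \<in> bicells S p q"
  shows "vdegen S p q j x = pull p (Suc q) (\<lambda>i. i) (\<lambda>x y. codegen j y) x"
proof -
  obtain a \<rho> where x: "x = (a, \<rho>)" by (cases x)
  have "a = map (\<lambda>i. a ! i) [0..<Suc p]" if "length a = Suc p"
    using that map_nth[of a] by simp
  then show ?thesis
    using pull_eqI[OF _ _ assms[unfolded x]]
    by (simp add: x section_complex_def real_line_def nerve_def map2_snd del: upt_Suc)
qed

lemma admissible_hface: "i \<le> Suc p \<Longrightarrow> admissible (Suc p) q p q (coface i) (\<lambda>x y. y)"
  and admissible_hdegen: "i \<le> p \<Longrightarrow> admissible p q (Suc p) q (codegen i) (\<lambda>x y. y)"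
  and admissible_vface: "j \<le> Suc q \<Longrightarrow> admissible p (Suc q) p q (\<lambda>i. i) (\<lambda>x y. coface j y)"
  and admissible_vdegen: "j \<le> q \<Longrightarrow> admissible p q p (Suc q) (\<lambda>i. i) (\<lambda>x y. codegen j y)"
  by (auto simp: admissible_def coface_def codegen_def)

lemmas operators = hface_pull hdegen_pull vface_pull vdegen_pull

lemma operators_closed:
  "\<lbrakk>x \<in> bicells S (Suc p) q; i \<le> Suc p\<rbrakk> \<Longrightarrow> hface S (Suc p) q i x \<in> bicells S p q"
  "\<lbrakk>x \<in> bicells S p q; i \<le> p\<rbrakk> \<Longrightarrow> hdegen S p q i x \<in> bicells S (Suc p) q"
  "\<lbrakk>x \<in> bicells S p (Suc q); j \<le> Suc q\<rbrakk> \<Longrightarrow> vface S p (Suc q) j x \<in> bicells S p q"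
  "\<lbrakk>x \<in> bicells S p q; j \<le> q\<rbrakk> \<Longrightarrow> vdegen S p q j x \<in> bicells S p (Suc q)"
  by (simp_all add: operators pull_closed[OF _ admissible_hface] pull_closed[OF _ admissible_hdegen]
      pull_closed[OF _ admissible_vface] pull_closed[OF _ admissible_vdegen])

lemma pull_operators:
  "i \<le> Suc p \<Longrightarrow> pull p q (coface i) (\<lambda>x y. y) (pull (Suc p) q u w x) = pull p q (\<lambda>k. u (coface i k)) (\<lambda>x y. w (coface i x) y) x"
  "i \<le> p \<Longrightarrow> pull (Suc p) q (codegen i) (\<lambda>x y. y) (pull p q u w x) = pull (Suc p) q (\<lambda>k. u (codegen i k)) (\<lambda>x y. w (codegen i x) y) x"
  "j \<le> Suc q \<Longrightarrow> pull p q (\<lambda>i. i) (\<lambda>x y. coface j y) (pull p (Suc q) u w x) = pull p q u (\<lambda>x y. w x (coface j y)) x"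
  "j \<le> q \<Longrightarrow> pull p (Suc q) (\<lambda>i. i) (\<lambda>x y. codegen j y) (pull p q u w x) = pull p (Suc q) u (\<lambda>x y. w x (codegen j y)) x"
  by (simp_all add: pull_pull[OF admissible_hface] pull_pull[OF admissible_hdegen]
      pull_pull[OF admissible_vface] pull_pull[OF admissible_vdegen])

text \<open>Once every operator is a \<open>pull\<close>, each simplicial identity is a case
  distinction on \<open>coface\<close> and \<open>codegen\<close>.\<close>

lemma simplicial_set_row: "simplicial_set (bisset_row S q)"
  by (unfold_locales;
      simp add: operators_closed operators(1,2) pull_closed[OF _ admissible_hface]
        pull_closed[OF _ admissible_hdegen] pull_operators;
      (intro pull_cong pull_ident)?; auto simp: coface_def codegen_def)

lemma simplicial_set_column: "simplicial_set (bisset_column S p)"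
  by (unfold_locales;
      simp add: operators_closed operators(3,4) pull_closed[OF _ admissible_vface]
        pull_closed[OF _ admissible_vdegen] pull_operators;
      (intro pull_cong pull_ident)?; auto simp: coface_def codegen_def)

lemma bisimplicial_set_section_complex: "bisimplicial_set S"
  by (intro bisimplicial_set.intro simplicial_set_row simplicial_set_column)
    (simp_all add: operators operators_closed pull_closed[OF _ admissible_hface]
      pull_closed[OF _ admissible_hdegen] pull_closed[OF _ admissible_vface] pull_operators)

end

section \<open>Contraction of the rows\<close>

locale section_bicomplex = height_space X h for X :: "'a sset" and h +
  fixes K :: "'k::field itself"
begin

sublocale bisimplicial_set S K
  by (rule bisimplicial_set_section_complex)

lemma free_map_pull_C:
  assumes "x \<in> C p q" "admissible p q p' q' u w"
  shows "free_map (pull p' q' u w) x \<in> C p' q'"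
  using assms unfolding C_def by (intro free_map_supported pull_closed)

lemma free_map_pull_pull:
  "admissible p' q' p'' q'' u2 w2 \<Longrightarrow> free_map (pull p'' q'' u2 w2) (free_map (pull p' q' u1 w1) x)
    = free_map (pull p'' q'' (\<lambda>i. u1 (u2 i)) (\<lambda>x y. w1 (u2 x) (w2 x y))) x"
  by (simp add: free_map_free_map pull_pull)

lemma free_map_pull_cong:
  assumes "\<And>i. i \<le> p' \<Longrightarrow> u i = u' i" "\<And>x y. \<lbrakk>x \<le> p'; y \<le> q'\<rbrakk> \<Longrightarrow> w x y = w' x y"
  shows "free_map (pull p' q' u w) x = free_map (pull p' q' u' w') x"
  by (rule free_map_cong) (rule pull_cong[OF assms])

lemma free_map_pull_ident:
  assumes "x \<in> C p q" "\<And>i. i \<le> p \<Longrightarrow> u i = i" "\<And>i j. i \<le> p \<Longrightarrow> j \<le> q \<Longrightarrow> w i j = j"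
  shows "free_map (pull p q u w) x = x"
  using assms unfolding C_def by (intro free_map_ident pull_ident) (auto dest: supportedD)

lemma dh_pull:
  assumes "x \<in> C (Suc p) q"
  shows "dh (Suc p) q x = (\<Sum>i\<le>Suc p. pscale ((-1) ^ i) (free_map (pull p q (coface i) (\<lambda>x y. y)) x))"
  unfolding dh_def free_bd_def face_bisset_row using assms
  by (intro sum.cong refl arg_cong[where f = "pscale _"] free_map_cong hface_pull)
    (auto simp: C_def dest: supportedD)

lemma dv_pull:
  assumes "x \<in> C p (Suc q)"
  shows "dv p (Suc q) x = (\<Sum>j\<le>Suc q. pscale ((-1) ^ j) (free_map (pull p q (\<lambda>i. i) (\<lambda>x y. coface j y)) x))"
  unfolding dv_def free_bd_def face_bisset_column using assms
  by (intro sum.cong refl arg_cong[where f = "pscale _"] free_map_cong vface_pull)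
    (auto simp: C_def dest: supportedD)

text \<open>Pullback along the projection that forgets the second factor, \<open>0\<close> being the
  only vertex of \<Delta>^0; \<open>last_vertex\<close> is restriction to \<Delta>^p times the
  vertex \<open>q\<close>.\<close>

definition const_section :: "nat \<Rightarrow> nat \<Rightarrow> (_ \<Rightarrow>\<^sub>0 'k) \<Rightarrow> (_ \<Rightarrow>\<^sub>0 'k)" where
  "const_section q p = free_map (pull p q (\<lambda>i. i) (\<lambda>x y. 0))"

definition last_vertex :: "nat \<Rightarrow> nat \<Rightarrow> (_ \<Rightarrow>\<^sub>0 'k) \<Rightarrow> (_ \<Rightarrow>\<^sub>0 'k)" where
  "last_vertex q p = free_map (pull p 0 (\<lambda>i. i) (\<lambda>x y. q))"

text \<open>The chain homotopy of the contraction of the second factor $\Delta^q$ onto its last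
  vertex. The contraction leaves the first factor fixed, hence stays within sections.\<close>

definition prism_op :: "nat \<Rightarrow> nat \<Rightarrow> (_ \<Rightarrow>\<^sub>0 'k) \<Rightarrow> (_ \<Rightarrow>\<^sub>0 'k)" where
  "prism_op q p x = (\<Sum>j\<le>p. pscale ((-1) ^ j)
    (free_map (pull (Suc p) q (codegen j) (\<lambda>i y. if i \<le> j then y else q)) x))"

text \<open>Monotonicity of the third map is the reason for contracting to the last vertex: when
  \<open>i\<close> passes beyond \<open>j\<close>, \<open>y\<close> is replaced by \<open>q\<close>,
  which is never smaller.\<close>

lemma adm_const: "admissible p 0 p q (\<lambda>i. i) (\<lambda>x y. 0)"
  and adm_last: "admissible p q p 0 (\<lambda>i. i) (\<lambda>x y. q)"
  and adm_prism: "j \<le> p \<Longrightarrow> admissible p q (Suc p) q (codegen j) (\<lambda>i y. if i \<le> j then y else q)"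
  by (auto simp: admissible_def codegen_def)

lemma prism_op_C: "x \<in> C p q \<Longrightarrow> prism_op q p x \<in> C (Suc p) q"
  unfolding prism_op_def
  by (intro pscale.subspace_sum[OF subspace_C] pscale.subspace_scale[OF subspace_C]
      free_map_pull_C[OF _ adm_prism]) auto

lemma sum_signs: "(\<Sum>j\<le>n. (-1) ^ j) = (if even n then 1 else (0 :: 'k))"
  by (induction n) auto

text \<open>On the diagonals the prism faces keep \<open>y\<close> for first coordinates below a
  threshold and send it to \<open>q\<close> from there on. Their differences telescope, from the
  full contraction at threshold \<open>0\<close> to the identity at \<open>Suc p\<close>.\<close>

lemma dh_prism_op:
  assumes x: "x \<in> C p q"
  shows "dh (Suc p) q (prism_op q p x) = const_section q p (last_vertex q p x) - x
    - (\<Sum>i\<le>p. \<Sum>j<p. pscale ((-1) ^ (i + j)) (free_map (pull p q (\<lambda>k. coface i (codegen j k))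
        (\<lambda>k y. if k \<le> j then y else q)) x))"
proof -
  let ?T = "\<lambda>i j. free_map (pull p q (\<lambda>k. codegen j (coface i k))
      (\<lambda>k y. if coface i k \<le> j then y else q)) x"
  let ?U = "\<lambda>i j. free_map (pull p q (\<lambda>k. coface i (codegen j k)) (\<lambda>k y. if k \<le> j then y else q)) x"
  let ?\<theta> = "\<lambda>j. free_map (pull p q (\<lambda>k. k) (\<lambda>k y. if k < j then y else q)) x"
  have "dh (Suc p) q (prism_op q p x) = (\<Sum>i\<le>Suc p. \<Sum>j\<le>p. pscale ((-1) ^ (i + j)) (?T i j))"
    unfolding dh_pull[OF prism_op_C[OF x]]
    unfolding prism_op_def free_map.sum free_map.scale pscale.scale_sum_right
    by (intro sum.cong refl) (simp add: power_add free_map_pull_pull[OF admissible_hface])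
  also have "\<dots> = (\<Sum>j\<le>p. ?T j j - ?T (Suc j) j) - (\<Sum>i\<le>p. \<Sum>j<p. pscale ((-1) ^ (i + j)) (?U i j))"
  proof (rule pscale.alternating_sum_homotopy)
    show "?T i j = ?U i (j - 1)" if "i < j" "j \<le> p" for i j
      using that by (intro free_map_pull_cong) (auto simp: coface_def codegen_def)
    show "?T i j = ?U (i - 1) j" if "Suc j < i" "i \<le> Suc p" for i j
      using that by (intro free_map_pull_cong) (auto simp: coface_def codegen_def)
  qed
  also have "(\<Sum>j\<le>p. ?T j j - ?T (Suc j) j) = (\<Sum>j\<le>p. ?\<theta> j - ?\<theta> (Suc j))"
    by (intro sum.cong refl arg_cong2[where f = "(-)"] free_map_pull_cong)
      (auto simp: coface_def codegen_def)
  also have "\<dots> = ?\<theta> 0 - ?\<theta> (Suc p)"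
    by (rule sum_telescope)
  also have "?\<theta> 0 = const_section q p (last_vertex q p x)"
    by (simp add: const_section_def last_vertex_def free_map_pull_pull[OF adm_const])
  also have "?\<theta> (Suc p) = x"
    by (rule free_map_pull_ident[OF x]) auto
  finally show ?thesis .
qed

text \<open>This is the correction term of \<open>dh_prism_op\<close> one degree higher, which
  therefore vanishes on horizontal cycles.\<close>

lemma prism_op_dh:
  assumes x: "x \<in> C (Suc p) q"
  shows "prism_op q p (dh (Suc p) q x) = (\<Sum>i\<le>Suc p. \<Sum>j<Suc p. pscale ((-1) ^ (i + j))
    (free_map (pull (Suc p) q (\<lambda>k. coface i (codegen j k)) (\<lambda>k y. if k \<le> j then y else q)) x))"
proof -
  have "prism_op q p (dh (Suc p) q x) = (\<Sum>j\<le>p. \<Sum>i\<le>Suc p. pscale ((-1) ^ (i + j))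
    (free_map (pull (Suc p) q (\<lambda>k. coface i (codegen j k)) (\<lambda>k y. if k \<le> j then y else q)) x))"
    unfolding prism_op_def dh_pull[OF x] free_map.sum free_map.scale pscale.scale_sum_right
    by (intro sum.cong refl) (simp add: power_add mult.commute free_map_pull_pull[OF adm_prism])
  then show ?thesis
    by (subst sum.swap) (simp only: lessThan_Suc_atMost)
qed

text \<open>The prism formula yields contraction minus identity, whence the minus sign in front of
  \<open>prism_op\<close>.\<close>

sublocale row_contractible pscale C dh dv const_section last_vertex "\<lambda>q p x. - prism_op q p x"
proof (intro row_contractible.intro row_contractible_axioms.intro)
  show "bicomplex pscale C dh dv" by (rule bicomplex_axioms)
  show "module_hom pscale pscale (const_section q p)" for q p
    unfolding const_section_def by (rule module_hom_free_map)
  show "module_hom pscale pscale (last_vertex q p)" for q p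
    unfolding last_vertex_def by (rule module_hom_free_map)
  show "const_section q p x \<in> C p q" if "x \<in> C p 0" for x p q
    using that unfolding const_section_def by (rule free_map_pull_C[OF _ adm_const])
  show "last_vertex q p x \<in> C p 0" if "x \<in> C p q" for x p q
    using that unfolding last_vertex_def by (rule free_map_pull_C[OF _ adm_last])
  show "- prism_op q p x \<in> C (Suc p) q" if "x \<in> C p q" for x p q
    using prism_op_C[OF that] by (rule pscale.subspace_neg[OF subspace_C])
  show "dh (Suc p) q (const_section q (Suc p) x) = const_section q p (dh (Suc p) 0 x)"
    if x: "x \<in> C (Suc p) 0" for x p q
  proof -
    have c: "const_section q (Suc p) x \<in> C (Suc p) q"
      using x unfolding const_section_def by (rule free_map_pull_C[OF _ adm_const])
    show ?thesis
      unfolding dh_pull[OF c] dh_pull[OF x] unfolding const_section_def free_map.sum free_map.scale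
      by (intro sum.cong refl)
        (simp add: free_map_pull_pull[OF admissible_hface] free_map_pull_pull[OF adm_const])
  qed
  show "dh (Suc p) 0 (last_vertex q (Suc p) x) = last_vertex q p (dh (Suc p) q x)"
    if x: "x \<in> C (Suc p) q" for x p q
  proof -
    have c: "last_vertex q (Suc p) x \<in> C (Suc p) 0"
      using x unfolding last_vertex_def by (rule free_map_pull_C[OF _ adm_last])
    show ?thesis
      unfolding dh_pull[OF c] dh_pull[OF x] unfolding last_vertex_def free_map.sum free_map.scale
      by (intro sum.cong refl)
        (simp add: free_map_pull_pull[OF admissible_hface] free_map_pull_pull[OF adm_last])
  qed
  show "last_vertex q p (const_section q p x) = x" if "x \<in> C p 0" for x p q
    unfolding last_vertex_def const_section_def free_map_pull_pull[OF adm_last]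
    using that by (rule free_map_pull_ident) auto
  show "dv p (Suc q) (const_section (Suc q) p x) = (if odd q then const_section q p x else 0)"
    if x: "x \<in> C p 0" for x p q
  proof -
    have c: "const_section (Suc q) p x \<in> C p (Suc q)"
      using x unfolding const_section_def by (rule free_map_pull_C[OF _ adm_const])
    \<comment> \<open>Every vertical face of a section constant along the second factor is the
      constant section in row \<open>q\<close>; what remains is a sum of \<open>q + 2\<close>
      alternating signs.\<close>
    have "dv p (Suc q) (const_section (Suc q) p x) = (\<Sum>j\<le>Suc q. pscale ((-1) ^ j) (const_section q p x))"
      unfolding dv_pull[OF c] unfolding const_section_def
      by (intro sum.cong refl) (simp add: free_map_pull_pull[OF admissible_vface])
    also have "\<dots> = pscale (\<Sum>j\<le>Suc q. (-1) ^ j) (const_section q p x)"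
      by (rule pscale.scale_sum_left[symmetric])
    finally show ?thesis by (simp only: sum_signs) auto
  qed
  show "x = const_section q 0 (last_vertex q 0 x) + dh (Suc 0) q (- prism_op q 0 x)"
    if "x \<in> C 0 q" for x q
    unfolding dh.neg dh_prism_op[OF that] by simp
  show "x = const_section q (Suc p) (last_vertex q (Suc p) x) + dh (Suc (Suc p)) q (- prism_op q (Suc p) x)"
    if x: "x \<in> C (Suc p) q" and "dh (Suc p) q x = 0" for x p q
  proof -
    have "prism_op q p (dh (Suc p) q x) = 0" using that by (simp add: prism_op_def)
    then show ?thesis
      unfolding dh.neg dh_prism_op[OF x] prism_op_dh[OF x] by simp
  qed
qed

end

section \<open>The Yoneda lemma for simplices\<close>

text \<open>A monotone map $[n] \to [p]$ is encoded by the list \<open>cs\<close> of the sizes of its fibres, as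
  \<open>expand 0 cs\<close> is the list of its values. It acts on a \<open>p\<close>-simplex by processing the values
  from \<open>p\<close> down to \<open>0\<close>: a value with empty fibre is omitted by a face operator, and a value with
  fibre of size \<open>m + 1\<close> is repeated by \<open>m\<close> degeneracies. In \<open>act X v cs\<close> the values below \<open>v\<close> are not
  yet processed.\<close>

fun expand :: "nat \<Rightarrow> nat list \<Rightarrow> nat list" where
  "expand v [] = []"
| "expand v (c # cs) = replicate c v @ expand (Suc v) cs"

text \<open>Omitting position \<open>i\<close> from the list of values shrinks the fibre containing
  that position, found by subtracting the sizes of the earlier fibres. Likewise \<open>inc\<close>
  for repeating an entry.\<close>

fun dec :: "nat list \<Rightarrow> nat \<Rightarrow> nat list" where
  "dec [] i = []"
| "dec (c # cs) i = (if i < c then (c - 1) # cs else c # dec cs (i - c))"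

fun inc :: "nat list \<Rightarrow> nat \<Rightarrow> nat list" where
  "inc [] i = []"
| "inc (c # cs) i = (if i < c then Suc c # cs else c # inc cs (i - c))"

fun degen_pow :: "'a sset \<Rightarrow> nat \<Rightarrow> nat \<Rightarrow> nat \<Rightarrow> 'a \<Rightarrow> 'a" where
  "degen_pow X n v 0 x = x"
| "degen_pow X n v (Suc m) x = degen X (n + m) v (degen_pow X n v m x)"

fun block :: "'a sset \<Rightarrow> nat \<Rightarrow> nat \<Rightarrow> nat \<Rightarrow> 'a \<Rightarrow> 'a" where
  "block X n v 0 x = face X n v x"
| "block X n v (Suc m) x = degen_pow X n v m x"

fun act :: "'a sset \<Rightarrow> nat \<Rightarrow> nat list \<Rightarrow> 'a \<Rightarrow> 'a" where
  "act X v [] x = x"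
| "act X v (c # cs) x = block X (v + sum_list cs) v c (act X (Suc v) cs x)"

lemma length_expand: "length (expand v cs) = sum_list cs"
  by (induction cs arbitrary: v) auto

lemma set_expand: "set (expand v cs) \<subseteq> {v..<v + length cs}"
proof (induction cs arbitrary: v)
  case (Cons c cs)
  show ?case using Cons[of "Suc v"] by auto
qed simp

lemma length_dec [simp]: "length (dec cs i) = length cs"
  by (induction cs arbitrary: i) auto

lemma length_inc [simp]: "length (inc cs i) = length cs"
  by (induction cs arbitrary: i) auto

lemma sum_list_dec: "i < sum_list cs \<Longrightarrow> Suc (sum_list (dec cs i)) = sum_list cs"
  by (induction cs arbitrary: i) auto

lemma sum_list_inc: "i < sum_list cs \<Longrightarrow> sum_list (inc cs i) = Suc (sum_list cs)"
  by (induction cs arbitrary: i) auto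

lemma expand_dec:
  "i < sum_list cs \<Longrightarrow> expand v (dec cs i) = take i (expand v cs) @ drop (Suc i) (expand v cs)"
proof (induction cs arbitrary: v i)
  case (Cons c cs)
  show ?case
  proof (cases "i < c")
    case True
    then have "c - 1 = i + (c - Suc i)" by simp
    then have "replicate (c - 1) v = replicate i v @ replicate (c - Suc i) v"
      by (metis replicate_add)
    then show ?thesis using True by (simp add: min_def)
  next
    case False
    then show ?thesis using Cons by (simp add: Suc_diff_le)
  qed
qed simp

lemma expand_inc:
  "i < sum_list cs \<Longrightarrow> expand v (inc cs i) = take (Suc i) (expand v cs) @ drop i (expand v cs)"
proof (induction cs arbitrary: v i)
  case (Cons c cs)
  show ?case
  proof (cases "i < c")
    case True
    then have "Suc c = Suc i + (c - i)" by simp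
    then have "replicate (Suc c) v = replicate (Suc i) v @ replicate (c - i) v"
      by (metis replicate_add)
    then show ?thesis using True by (simp add: min_def del: replicate_Suc)
  next
    case False
    then show ?thesis using Cons by (simp add: Suc_diff_le)
  qed
qed simp

lemma expand_ones: "expand v (replicate k 1) = [v..<v + k]"
  by (induction k arbitrary: v) (simp_all add: upt_conv_Cons)

lemma count_expand: "i < length cs \<Longrightarrow> count_list (expand v cs) (v + i) = cs ! i"
proof (induction cs arbitrary: v i)
  case (Cons c cs)
  have z: "count_list (expand (Suc v) cs) v = 0"
    using set_expand[of "Suc v" cs] by (auto simp: count_list_0_iff)
  have r: "count_list (replicate c v) w = (if v = w then c else 0)" for w
    by (induction c) auto
  show ?case using Cons.IH[of "i - 1" "Suc v"] Cons.prems z r by (cases i) auto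
qed simp

lemma map_count_expand: "length cs = n \<Longrightarrow> map (count_list (expand 0 cs)) [0..<n] = cs"
  using count_expand[of _ cs 0] by (intro nth_equalityI) auto

text \<open>The initial run of \<open>v\<close> is the first fibre; monotonicity puts the remaining
  values above \<open>v\<close>.\<close>

lemma exists_expand:
  assumes "sorted_wrt (\<le>) s" "set s \<subseteq> {v..<v + k}"
  shows "\<exists>cs. length cs = k \<and> s = expand v cs"
  using assms
proof (induction k arbitrary: s v)
  case (Suc k)
  let ?t = "takeWhile (\<lambda>x. x = v) s" and ?d = "dropWhile (\<lambda>x. x = v) s"
  have "replicate (length ?t) v = ?t"
    by (rule replicate_length_same) (auto dest: set_takeWhileD)
  moreover have s: "s = ?t @ ?d" by simp
  moreover have sd: "sorted_wrt (\<le>) ?d" using Suc.prems(1) by (metis s sorted_wrt_append)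
  moreover have "set ?d \<subseteq> {Suc v..<Suc v + k}"
  proof
    fix y assume y: "y \<in> set ?d"
    then have ne: "?d \<noteq> []" by (metis length_greater_0_conv length_pos_if_in_set)
    have "hd ?d \<noteq> v" using hd_dropWhile[OF ne] by simp
    moreover have "hd ?d \<in> set s" using ne by (metis hd_in_set set_dropWhileD)
    ultimately have "v < hd ?d" using Suc.prems(2) by auto
    moreover have "hd ?d \<le> y" using sd y by (cases ?d) auto
    moreover have "y < v + Suc k" using y set_dropWhileD[OF y] Suc.prems(2) by auto
    ultimately show "y \<in> {Suc v..<Suc v + k}" by simp
  qed
  ultimately obtain cs where "length cs = k" "?d = expand (Suc v) cs" using Suc.IH by blast
  then show ?case
    using s \<open>replicate (length ?t) v = ?t\<close> by (intro exI[of _ "length ?t # cs"]) simp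
qed simp

lemma act_ones: "act X v (replicate k 1) x = x"
  by (induction k arbitrary: v) simp_all

lemma degen_pow_cells:
  assumes degen: "\<And>n j x. \<lbrakk>x \<in> cells X n; j \<le> n\<rbrakk> \<Longrightarrow> degen X n j x \<in> cells X (Suc n)"
    and "x \<in> cells X n" "v \<le> n"
  shows "degen_pow X n v m x \<in> cells X (n + m)"
  using assms(2,3) by (induction m) (auto intro!: degen)

lemma act_cells:
  assumes face: "\<And>n i x. \<lbrakk>x \<in> cells X (Suc n); i \<le> Suc n\<rbrakk> \<Longrightarrow> face X (Suc n) i x \<in> cells X n"
    and degen: "\<And>n j x. \<lbrakk>x \<in> cells X n; j \<le> n\<rbrakk> \<Longrightarrow> degen X n j x \<in> cells X (Suc n)"
    and "x \<in> cells X p" "Suc p = v + length cs" "Suc n = v + sum_list cs"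
  shows "act X v cs x \<in> cells X n"
  using assms(3-)
proof (induction cs arbitrary: v n)
  case (Cons c cs)
  have y: "act X (Suc v) cs x \<in> cells X (v + sum_list cs)" using Cons by auto
  show ?case
  proof (cases c)
    case 0
    then have "v + sum_list cs = Suc n" using Cons.prems by simp
    then show ?thesis using face[of _ n v] y 0 by simp
  next
    case (Suc m)
    then have "n = v + sum_list cs + m" using Cons.prems by simp
    then show ?thesis using degen_pow_cells[OF degen y, of v m] Suc by simp
  qed
qed auto

text \<open>Holds because \<open>act\<close> is a composite of faces and degeneracies. The source is
  only assumed closed under the operators, which is what has been shown for
  \<open>prism\<close>.\<close>

lemma act_natural:
  assumes face: "\<And>n i x. \<lbrakk>x \<in> cells X (Suc n); i \<le> Suc n\<rbrakk> \<Longrightarrow> face X (Suc n) i x \<in> cells X n"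
    and degen: "\<And>n j x. \<lbrakk>x \<in> cells X n; j \<le> n\<rbrakk> \<Longrightarrow> degen X n j x \<in> cells X (Suc n)"
    and f: "simplicial_map X Y f"
    and "x \<in> cells X p" "Suc p = v + length cs" "Suc n = v + sum_list cs"
  shows "f n (act X v cs x) = act Y v cs (f p x)"
  using assms(4-)
proof (induction cs arbitrary: v n)
  case (Cons c cs)
  let ?y = "act X (Suc v) cs x" and ?n = "v + sum_list cs"
  have y: "?y \<in> cells X ?n" using Cons.prems by (intro act_cells[OF face degen]) auto
  have IH: "f ?n ?y = act Y (Suc v) cs (f p x)" using Cons by auto
  show ?case
  proof (cases c)
    case 0
    then have "?n = Suc n" using Cons.prems by simp
    then show ?thesis using f y 0 IH unfolding simplicial_map_def by auto
  next
    case (Suc m)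
    have "f (?n + m) (degen_pow X ?n v m ?y) = degen_pow Y ?n v m (f ?n ?y)" for m
    proof (induction m)
      case (Suc m)
      have "degen_pow X ?n v m ?y \<in> cells X (?n + m)" by (rule degen_pow_cells[OF degen y]) auto
      then show ?case using f Suc unfolding simplicial_map_def by auto
    qed simp
    moreover have "n = ?n + m" using Suc Cons.prems by simp
    ultimately show ?thesis using Suc IH by simp
  qed
qed auto

text \<open>The unprocessed entries form an untouched prefix, so at \<open>v = 0\<close> the result
  is \<open>a\<close> composed with the encoded monotone map.\<close>

lemma act_nerve:
  assumes "length a = v + length cs"
  shows "act (nerve A) v cs a = take v a @ map ((!) a) (expand v cs)"
  using assms
proof (induction cs arbitrary: v)
  case (Cons c cs)
  let ?E = "map ((!) a) (expand (Suc v) cs)"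
  have y: "act (nerve A) (Suc v) cs a = take v a @ a ! v # ?E"
    using Cons by (simp add: take_Suc_conv_app_nth)
  show ?case
  proof (cases c)
    case 0
    then show ?thesis using Cons.prems unfolding act.simps y by (simp add: nerve_def)
  next
    case (Suc m)
    have "degen_pow (nerve A) n v m (take v a @ a ! v # ?E) = take v a @ replicate (Suc m) (a ! v) @ ?E" for n m
      using Cons.prems by (induction m) (simp_all add: nerve_def)
    then show ?thesis using Suc unfolding act.simps y by simp
  qed
qed simp

context simplicial_set
begin

lemma degen_pow_closed: "\<lbrakk>y \<in> cells X n; v \<le> n\<rbrakk> \<Longrightarrow> degen_pow X n v m y \<in> cells X (n + m)"
  by (rule degen_pow_cells[OF degen_closed])

lemma act_closed:
  "\<lbrakk>x \<in> cells X p; Suc p = v + length cs; Suc n = v + sum_list cs\<rbrakk> \<Longrightarrow> act X v cs x \<in> cells X n"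
  by (rule act_cells[OF face_closed degen_closed])

text \<open>The degeneracies repeat vertex \<open>v\<close>, so the positions from \<open>v\<close>
  to \<open>v + Suc m\<close> carry equal vertices and omitting any of them has the same
  effect.\<close>

lemma face_degen_pow_inside:
  assumes "y \<in> cells X n" "v \<le> n" "i \<le> Suc m"
  shows "face X (n + Suc m) (v + i) (degen_pow X n v (Suc m) y) = degen_pow X n v m y"
  using assms
proof (induction m arbitrary: i)
  case 0
  then show ?case using face_degen_same[of y n v] face_degen_Suc[of y n v] by (cases i) auto
next
  case (Suc m)
  let ?z = "degen_pow X n v (Suc m) y"
  have z: "?z \<in> cells X (Suc (n + m))" using degen_pow_closed[OF Suc.prems(1,2), of "Suc m"] by simp
  consider "i = 0" | "i = 1" | "i \<ge> 2" by linarith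
  then show ?case
  proof cases
    case 3
    have "face X (n + Suc (Suc m)) (v + i) (degen_pow X n v (Suc (Suc m)) y)
        = degen X (n + m) v (face X (Suc (n + m)) (v + i - 1) ?z)"
      using face_degen_greater[OF z, of v "v + i"] 3 Suc.prems by simp
    also have "face X (Suc (n + m)) (v + i - 1) ?z = degen_pow X n v m y"
      using Suc.IH[of "i - 1"] Suc.prems 3 by simp
    finally show ?thesis by simp
  qed (use z Suc.prems face_degen_same[OF z, of v] face_degen_Suc[OF z, of v] in auto)
qed

text \<open>Positions beyond the repeated vertex are shifted by \<open>m\<close> and belong to the
  original simplex.\<close>

lemma face_degen_pow_outside:
  assumes "y \<in> cells X (Suc n)" "v \<le> n" "v < j" "j \<le> Suc n"
  shows "face X (Suc n + m) (j + m) (degen_pow X (Suc n) v m y) = degen_pow X n v m (face X (Suc n) j y)"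
proof (induction m)
  case (Suc m)
  have z: "degen_pow X (Suc n) v m y \<in> cells X (Suc (n + m))"
    using degen_pow_closed[OF assms(1), of v m] assms by simp
  show ?case using face_degen_greater[OF z, of v "j + Suc m"] assms Suc by simp
qed simp

lemma degen_degen_pow_inside:
  assumes "y \<in> cells X n" "v \<le> n" "i \<le> m"
  shows "degen X (n + m) (v + i) (degen_pow X n v m y) = degen_pow X n v (Suc m) y"
  using assms
proof (induction m arbitrary: i)
  case (Suc m)
  show ?case
  proof (cases i)
    case i: (Suc i')
    have z: "degen_pow X n v m y \<in> cells X (n + m)" using degen_pow_closed[OF Suc.prems(1,2)] .
    have "degen X (Suc (n + m)) (Suc (v + i')) (degen X (n + m) v (degen_pow X n v m y))
        = degen X (Suc (n + m)) v (degen X (n + m) (v + i') (degen_pow X n v m y))"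
      using degen_degen[OF z, of v "v + i'"] i Suc.prems by simp
    then show ?thesis using Suc.IH[of i'] Suc.prems i by simp
  qed simp
qed simp

lemma degen_degen_pow_outside:
  assumes "y \<in> cells X n" "v < j" "j \<le> n"
  shows "degen X (n + m) (j + m) (degen_pow X n v m y) = degen_pow X (Suc n) v m (degen X n j y)"
proof (induction m)
  case (Suc m)
  have z: "degen_pow X n v m y \<in> cells X (n + m)" using degen_pow_closed[OF assms(1), of v m] assms by simp
  show ?case using degen_degen[OF z, of v "j + m"] assms Suc by simp
qed simp

text \<open>Inside the fibre of \<open>v\<close> the face shortens a run of repetitions; otherwise
  it slips past the block to the later values, where the induction hypothesis applies.\<close>

lemma face_act:
  assumes "x \<in> cells X p" "Suc p = v + length cs" "Suc (Suc n) = v + sum_list cs" "i < sum_list cs"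
  shows "face X (Suc n) (v + i) (act X v cs x) = act X v (dec cs i) x"
  using assms
proof (induction cs arbitrary: v n i)
  case (Cons c cs)
  let ?y = "act X (Suc v) cs x" and ?n = "v + sum_list cs"
  have y: "?y \<in> cells X ?n" using Cons.prems by (intro act_closed) auto
  show ?case
  proof (cases "i < c")
    case True
    then obtain m where c: "c = Suc m" by (cases c) auto
    then have n: "Suc n = ?n + m" using Cons.prems by simp
    show ?thesis
    proof (cases m)
      \<comment> \<open>A fibre of size one becomes empty, and the block for an empty fibre is
        exactly this face.\<close>
      case 0
      then show ?thesis using n c True by simp
    next
      case (Suc m')
      then show ?thesis
        using face_degen_pow_inside[OF y, of v i m'] n c True by simp
    qed
  next
    case False
    then have i: "i - c < sum_list cs" using Cons.prems by simp
    then obtain n' where n': "?n = Suc n'" "v \<le> n'" by (cases "sum_list cs") auto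
    have IH: "face X (Suc n') (Suc v + (i - c)) ?y = act X (Suc v) (dec cs (i - c)) x"
      using Cons.prems n' i by (intro Cons.IH) auto
    have s: "v + sum_list (dec cs (i - c)) = n'" using sum_list_dec[OF i] n' by simp
    show ?thesis
    proof (cases c)
      \<comment> \<open>The block is itself the face at \<open>v\<close>; exchanging it with the
        other face raises the index of the latter by one, which is the offset between
        \<open>v\<close> and \<open>Suc v\<close>.\<close>
      case 0
      then have n: "n' = Suc n" using Cons.prems n' by simp
      have "face X (Suc n) v (face X (Suc (Suc n)) (Suc (v + i)) ?y) = face X (Suc n) (v + i) (face X (Suc (Suc n)) v ?y)"
        using face_face[of ?y n v "Suc (v + i)"] y n' n i 0 by simp
      then show ?thesis using 0 IH n n' s by simp
    next
      case (Suc m)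
      then have n: "Suc n = Suc n' + m" using Cons.prems n' by simp
      have "face X (Suc n' + m) (Suc v + (i - c) + m) (degen_pow X (Suc n') v m ?y)
          = degen_pow X n' v m (face X (Suc n') (Suc v + (i - c)) ?y)"
        using y n' i by (intro face_degen_pow_outside) auto
      moreover have "Suc v + (i - c) + m = v + i" using Suc False by simp
      ultimately show ?thesis using Suc False IH n n' s by simp
    qed
  qed
qed simp

lemma degen_act:
  assumes "x \<in> cells X p" "Suc p = v + length cs" "Suc n = v + sum_list cs" "i < sum_list cs"
  shows "degen X n (v + i) (act X v cs x) = act X v (inc cs i) x"
  using assms
proof (induction cs arbitrary: v n i)
  case (Cons c cs)
  let ?y = "act X (Suc v) cs x" and ?n = "v + sum_list cs"
  have y: "?y \<in> cells X ?n" using Cons.prems by (intro act_closed) auto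
  show ?case
  proof (cases "i < c")
    case True
    then obtain m where c: "c = Suc m" by (cases c) auto
    then have n: "n = ?n + m" using Cons.prems by simp
    then show ?thesis
      using degen_degen_pow_inside[OF y, of v i m] c True by simp
  next
    case False
    then have i: "i - c < sum_list cs" using Cons.prems by simp
    have IH: "degen X ?n (Suc v + (i - c)) ?y = act X (Suc v) (inc cs (i - c)) x"
      using Cons.prems i by (intro Cons.IH) auto
    have s: "v + sum_list (inc cs (i - c)) = Suc ?n" using sum_list_inc[OF i] by simp
    show ?thesis
    proof (cases c)
      case 0
      then have n: "?n = Suc n" using Cons.prems by simp
      have "face X (Suc (Suc n)) v (degen X (Suc n) (Suc (v + i)) ?y) = degen X n (v + i) (face X (Suc n) v ?y)"
        using face_degen_less[of ?y n v "Suc (v + i)"] y n i 0 by simp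
      then show ?thesis using 0 IH n s by simp
    next
      case (Suc m)
      then have n: "n = ?n + m" using Cons.prems by simp
      have "degen X (?n + m) (Suc v + (i - c) + m) (degen_pow X ?n v m ?y)
          = degen_pow X (Suc ?n) v m (degen X ?n (Suc v + (i - c)) ?y)"
        using y i by (intro degen_degen_pow_outside) auto
      moreover have "Suc v + (i - c) + m = v + i" using Suc False by simp
      ultimately show ?thesis using Suc False IH n s by simp
    qed
  qed
qed simp

end

lemma act_prod: "act (sset_prod X Y) v cs (x, y) = (act X v cs x, act Y v cs y)"
proof (induction cs arbitrary: v)
  case (Cons c cs)
  have "degen_pow (sset_prod X Y) n v m (x, y) = (degen_pow X n v m x, degen_pow Y n v m y)" for n m x y
    by (induction m) (simp_all add: sset_prod_def)
  then show ?case using Cons by (cases c) (simp_all add: sset_prod_def)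
qed simp

section \<open>Row 0 is the simplicial set itself\<close>

context section_bicomplex
begin

text \<open>The universal simplex of \<Delta>^p times \<Delta>^0: by Yoneda a map out of this prism
  is determined by its value here.\<close>

definition top_cell :: "nat \<Rightarrow> nat list \<times> nat list" where
  "top_cell p = ([0..<Suc p], replicate (Suc p) 0)"

definition simplex_of :: "nat \<Rightarrow> real list \<times> (nat \<Rightarrow> nat list \<times> nat list \<Rightarrow> 'a) \<Rightarrow> 'a" where
  "simplex_of p x = snd x p (top_cell p)"

text \<open>Recovers the fibre sizes from a list of values, inverting
  \<open>expand 0\<close>.\<close>

definition fibres :: "nat \<Rightarrow> nat list \<Rightarrow> nat list" where
  "fibres p s = map (count_list s) [0..<Suc p]"

definition section_of :: "nat \<Rightarrow> 'a \<Rightarrow> real list \<times> (nat \<Rightarrow> nat list \<times> nat list \<Rightarrow> 'a)" where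
  "section_of p x = (h p x, \<lambda>n. \<lambda>y\<in>cells (prism p 0) n. act X 0 (fibres p (fst y)) x)"

lemma top_cell: "top_cell p \<in> cells (prism p 0) p"
  unfolding top_cell_def prism_cells_iff
  by (auto simp: sorted_wrt_iff_nth_less simp del: upt_Suc replicate_Suc)

lemma cells_prism_0:
  assumes "y \<in> cells (prism p 0) n"
  obtains cs where "length cs = Suc p" "sum_list cs = Suc n" "fibres p (fst y) = cs"
    "y = (expand 0 cs, replicate (Suc n) 0)"
proof -
  obtain s t where y: "y = (s, t)" by (cases y)
  note st = assms[unfolded y prism_cells_iff]
  have "set s \<subseteq> {0..<0 + Suc p}" using st by auto
  then obtain cs where cs: "length cs = Suc p" "s = expand 0 cs" using exists_expand st by blast
  have "t = replicate (Suc n) 0"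
    using st replicate_length_same[of t 0] by (metis atMost_0 singletonD subsetD)
  moreover have "sum_list cs = Suc n" using st cs length_expand[of 0 cs] by simp
  moreover have "fibres p (fst y) = cs"
    using cs map_count_expand[OF cs(1)] by (simp add: y fibres_def del: upt_Suc)
  ultimately show ?thesis using that cs y by simp
qed

lemma expand_cell:
  assumes "length cs = Suc p" "sum_list cs = Suc n"
  shows "fibres p (expand 0 cs) = cs"
  using map_count_expand[OF assms(1)] by (simp add: fibres_def del: upt_Suc)

text \<open>Compatibility with the operators is \<open>face_act\<close> and
  \<open>degen_act\<close>; the height condition follows by carrying the action through
  \<open>h\<close> into the nerve, where it is composition.\<close>

lemma section_of_bicells:
  assumes x: "x \<in> cells X p"
  shows "section_of p x \<in> bicells S p 0"
proof -
  let ?\<rho> = "\<lambda>n. \<lambda>y\<in>cells (prism p 0) n. act X 0 (fibres p (fst y)) x"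
  have hm: "simplicial_map X real_line h" using height by (simp add: height_function_def)
  have "simplicial_map (prism p 0) X ?\<rho>"
    unfolding simplicial_map_def
  proof (intro conjI allI ballI impI)
    show "?\<rho> n y \<in> cells X n" if y: "y \<in> cells (prism p 0) n" for n y
    proof -
      obtain cs where "length cs = Suc p" "sum_list cs = Suc n" "fibres p (fst y) = cs"
        using cells_prism_0[OF y] by metis
      then show ?thesis using y x by (auto intro: act_closed)
    qed
    show "?\<rho> n (face (prism p 0) (Suc n) i y) = face X (Suc n) i (?\<rho> (Suc n) y)"
      if y: "y \<in> cells (prism p 0) (Suc n)" "i \<le> Suc n" for n y i
    proof -
      obtain cs where cs: "length cs = Suc p" "sum_list cs = Suc (Suc n)" "fibres p (fst y) = cs"
        "y = (expand 0 cs, replicate (Suc (Suc n)) 0)"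
        using cells_prism_0[OF y(1)] by metis
      have i: "i < sum_list cs" using y(2) cs by simp
      have "fst (face (prism p 0) (Suc n) i y) = expand 0 (dec cs i)"
        using expand_dec[OF i, of 0] by (simp add: cs(4) prism_face)
      moreover have "fibres p (expand 0 (dec cs i)) = dec cs i"
        using cs sum_list_dec[OF i] by (intro expand_cell[of _ _ n]) auto
      moreover have "face X (Suc n) (0 + i) (act X 0 cs x) = act X 0 (dec cs i) x"
        using x cs i by (intro face_act) auto
      ultimately show ?thesis using y prism_face_closed[OF y] cs(3) by simp
    qed
    show "?\<rho> (Suc n) (degen (prism p 0) n i y) = degen X n i (?\<rho> n y)"
      if y: "y \<in> cells (prism p 0) n" "i \<le> n" for n y i
    proof -
      obtain cs where cs: "length cs = Suc p" "sum_list cs = Suc n" "fibres p (fst y) = cs"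
        "y = (expand 0 cs, replicate (Suc n) 0)"
        using cells_prism_0[OF y(1)] by metis
      have i: "i < sum_list cs" using y(2) cs by simp
      have "fst (degen (prism p 0) n i y) = expand 0 (inc cs i)"
        using expand_inc[OF i, of 0] by (simp add: cs(4) prism_degen)
      moreover have "fibres p (expand 0 (inc cs i)) = inc cs i"
        using cs sum_list_inc[OF i] by (intro expand_cell[of _ _ "Suc n"]) auto
      moreover have "degen X n (0 + i) (act X 0 cs x) = act X 0 (inc cs i) x"
        using x cs i by (intro degen_act) auto
      ultimately show ?thesis using y prism_degen_closed[OF y] cs(3) by simp
    qed
  qed
  moreover have hx: "h p x \<in> cells real_line p" using hm x by (simp add: simplicial_map_def)
  moreover have "h n (?\<rho> n (s, t)) = map ((!) (h p x)) s" if y: "(s, t) \<in> cells (prism p 0) n" for n s t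
  proof -
    obtain cs where cs: "length cs = Suc p" "sum_list cs = Suc n" "fibres p s = cs" "s = expand 0 cs"
      using cells_prism_0[OF y] by (metis fst_conv)
    have "h n (act X 0 cs x) = act real_line 0 cs (h p x)"
      using x cs by (intro act_natural[OF face_closed degen_closed hm]) auto
    also have "\<dots> = map ((!) (h p x)) s"
      using hx cs act_nerve[of "h p x" 0 cs UNIV] by (simp add: cells_real_line real_line_def[symmetric])
    finally show ?thesis using y cs(3) by simp
  qed
  ultimately show ?thesis
    by (auto simp: section_of_def bicells_iff sections_def sset_hom_def)
qed

lemma simplex_of_section_of: "simplex_of p (section_of p x) = x"
proof -
  have "[0..<Suc p] = expand 0 (replicate (Suc p) 1)" using expand_ones[of 0 "Suc p"] by simp
  then have "fibres p (fst (top_cell p)) = replicate (Suc p) 1"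
    unfolding top_cell_def using expand_cell[of "replicate (Suc p) 1" p p]
    by (simp add: sum_list_replicate del: upt_Suc replicate_Suc)
  then show ?thesis
    using top_cell act_ones by (simp add: simplex_of_def section_of_def del: replicate_Suc)
qed

lemma simplex_of_cells:
  assumes "x \<in> bicells S p 0" shows "simplex_of p x \<in> cells X p"
  using assms top_cell
  by (cases x) (auto simp: simplex_of_def bicells_iff sections_def sset_hom_def simplicial_map_def)

text \<open>Every cell of the prism arises from \<open>top_cell\<close> by the action of its fibre
  list, so naturality determines a section from its value there.\<close>

lemma section_of_simplex_of:
  assumes x: "x \<in> bicells S p 0"
  shows "section_of p (simplex_of p x) = x"
proof -
  obtain a \<rho> where ar: "x = (a, \<rho>)" by (cases x)
  have a: "length a = Suc p"
    and \<rho>: "simplicial_map (prism p 0) X \<rho>" and exten: "\<And>n. \<rho> n \<in> extensional (cells (prism p 0) n)"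
    and h: "\<And>n s t. (s, t) \<in> cells (prism p 0) n \<Longrightarrow> h n (\<rho> n (s, t)) = map ((!) a) s"
    using x unfolding ar bicells_iff cells_real_line sections_def sset_hom_def by auto
  have "act X 0 (fibres p (fst y)) (simplex_of p x) = \<rho> n y" if y: "y \<in> cells (prism p 0) n" for n y
  proof -
    obtain cs where cs: "length cs = Suc p" "sum_list cs = Suc n" "fibres p (fst y) = cs"
      "y = (expand 0 cs, replicate (Suc n) 0)"
      using cells_prism_0[OF y] by metis
    have "\<rho> n (act (prism p 0) 0 cs (top_cell p)) = act X 0 cs (\<rho> p (top_cell p))"
      using cs top_cell by (intro act_natural[OF prism_face_closed prism_degen_closed \<rho>]) auto
    moreover have "act (prism p 0) 0 cs (top_cell p) = y"
    proof -
      have e: "k < Suc p" if "k \<in> set (expand 0 cs)" for k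
        using that set_expand[of 0 cs] cs(1) by auto
      have "map ((!) [0..<Suc p]) (expand 0 cs) = expand 0 cs"
        using e by (intro map_idI) (auto simp del: upt_Suc)
      moreover have "map ((!) (replicate (Suc p) (0::nat))) (expand 0 cs) = replicate (Suc n) 0"
        using e cs(2) length_expand[of 0 cs]
        by (simp add: map_replicate_const del: replicate_Suc cong: map_cong)
      ultimately show ?thesis
        using cs act_nerve[of "[0..<Suc p]" 0 cs] act_nerve[of "replicate (Suc p) (0::nat)" 0 cs]
        by (simp add: top_cell_def act_prod std_simplex_def del: upt_Suc replicate_Suc)
    qed
    ultimately show ?thesis using cs(3) by (simp add: simplex_of_def ar)
  qed
  then have "(\<lambda>y\<in>cells (prism p 0) n. act X 0 (fibres p (fst y)) (simplex_of p x)) = \<rho> n" for n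
    using exten[of n] by (intro extensionalityI[of _ "cells (prism p 0) n"]) auto
  moreover have "h p (simplex_of p x) = a"
  proof -
    have "h p (simplex_of p x) = map ((!) a) [0..<Suc p]"
      using h[of "[0..<Suc p]" "replicate (Suc p) 0" p] top_cell
      by (simp add: simplex_of_def ar top_cell_def del: upt_Suc replicate_Suc)
    then show ?thesis using a by (metis map_nth)
  qed
  ultimately show ?thesis by (simp add: section_of_def ar fun_eq_iff)
qed

lemma simplex_of_hface:
  assumes x: "x \<in> bicells S (Suc p) 0" and i: "i \<le> Suc p"
  shows "simplex_of p (hface S (Suc p) 0 i x) = face X (Suc p) i (simplex_of (Suc p) x)"
proof -
  obtain a \<rho> where ar: "x = (a, \<rho>)" by (cases x)
  have \<rho>: "simplicial_map (prism (Suc p) 0) X \<rho>"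
    using x unfolding ar bicells_iff sections_def sset_hom_def by auto
  have "map (coface i) [0..<Suc p] = take i [0..<Suc (Suc p)] @ drop (Suc i) [0..<Suc (Suc p)]"
    using i by (intro nth_equalityI) (auto simp: nth_append coface_def simp del: upt_Suc)
  moreover have "replicate (Suc p) (0::nat)
      = take i (replicate (Suc (Suc p)) 0) @ drop (Suc i) (replicate (Suc (Suc p)) 0)"
    using i by (simp add: min_def Suc_diff_le flip: replicate_add del: replicate_Suc)
  \<comment> \<open>The coface inclusion sends the universal simplex to the \<open>i\<close>-th face
    of the larger one; simpliciality of \<open>\<rho>\<close> does the rest.\<close>
  ultimately have top: "map_prod (map (coface i)) id (top_cell p) = face (prism (Suc p) 0) (Suc p) i (top_cell (Suc p))"
    unfolding top_cell_def prism_face by (simp del: upt_Suc replicate_Suc)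
  have "simplex_of p (hface S (Suc p) 0 i x) = \<rho> p (map_prod (map (coface i)) id (top_cell p))"
    using top_cell by (simp add: simplex_of_def ar section_complex_def sset_comp_apply)
  then show ?thesis
    using \<rho> top_cell i unfolding top simplicial_map_def by (simp add: simplex_of_def ar)
qed

abbreviation to_X :: "nat \<Rightarrow> (_ \<Rightarrow>\<^sub>0 'k) \<Rightarrow> ('a \<Rightarrow>\<^sub>0 'k)" where
  "to_X p \<equiv> free_map (simplex_of p)"

lemma to_X_supported: "x \<in> C p 0 \<Longrightarrow> to_X p x \<in> supported (cells X p)"
  unfolding C_def by (erule free_map_supported) (rule simplex_of_cells)

lemma of_X_C: "x \<in> supported (cells X p) \<Longrightarrow> free_map (section_of p) x \<in> C p 0"
  unfolding C_def by (erule free_map_supported) (rule section_of_bicells)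

lemma to_X_of_X: "to_X p (free_map (section_of p) x) = x"
  unfolding free_map_free_map by (rule free_map_ident) (rule simplex_of_section_of)

lemma of_X_to_X: "x \<in> C p 0 \<Longrightarrow> free_map (section_of p) (to_X p x) = x"
  unfolding free_map_free_map C_def
  by (rule free_map_ident) (auto intro: section_of_simplex_of dest: supportedD)

lemma to_X_dh:
  assumes "x \<in> C (Suc p) 0"
  shows "to_X p (dh (Suc p) 0 x) = free_bd X (Suc p) (to_X (Suc p) x)"
  unfolding dh_def free_bd_def free_map.sum free_map.scale free_map_free_map face_bisset_row
  using assms
  by (intro sum.cong refl arg_cong[where f = "pscale _"] free_map_cong simplex_of_hface)
    (auto simp: C_def dest: supportedD)

text \<open>Evaluation at \<open>top_cell\<close> is an isomorphism from row 0 to the chains of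
  \<open>X\<close> that commutes with the boundaries, so it carries the presentation over.\<close>

lemma presentation_homology_X:
  "\<exists>\<pi>. presentation pscale {x \<in> C n 0. n = 0 \<or> dh n 0 x = 0} (dh (Suc n) 0 ` C (Suc n) 0) \<pi>
    (homology (sset_chains K X) n)"
proof -
  let ?A = "\<lambda>n. supported (cells X n) :: ('a \<Rightarrow>\<^sub>0 'k) set"
  have "presentation pscale (?A m) {0} id (chains (sset_chains K X) m)" for m
    using presentation_free_vs by (simp add: sset_chains_def moore_complex_def free_simplicial_vs_def)
  then have "presentation pscale {x \<in> ?A n. n = 0 \<or> free_bd X n x \<in> {0}}
      (sumset (free_bd X (Suc n) ` ?A (Suc n)) {0})
      (\<lambda>x. boundaries (sset_chains K X) n +>\<^bsub>chains (sset_chains K X) n\<^esub> id x) (homology (sset_chains K X) n)"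
    by (rule presentation_homology(1)[OF _ free_bd.module_hom_axioms])
      (auto simp: free_bd_supported free_bd_free_bd intro!: bdry_sset_chains simplicial_set_axioms)
  moreover have "sumset (free_bd X (Suc n) ` ?A (Suc n)) {0} = free_bd X (Suc n) ` ?A (Suc n)"
    by auto
  ultimately obtain \<pi> where \<pi>: "presentation pscale {x \<in> ?A n. n = 0 \<or> free_bd X n x = 0}
      (free_bd X (Suc n) ` ?A (Suc n)) \<pi> (homology (sset_chains K X) n)"
    by auto
  have cycle_iff: "n = 0 \<or> dh n 0 x = 0 \<longleftrightarrow> n = 0 \<or> free_bd X n (to_X n x) = 0" if x: "x \<in> C n 0" for x
  proof (cases n)
    case (Suc m)
    have "dh n 0 x \<in> C m 0" using x Suc dh_C by simp
    then have "dh n 0 x = 0 \<longleftrightarrow> to_X m (dh n 0 x) = 0"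
      using of_X_to_X[of "dh n 0 x" m] by auto
    then show ?thesis using to_X_dh[of x m] x Suc by simp
  qed simp
  have "presentation pscale {x \<in> C n 0. n = 0 \<or> dh n 0 x = 0} (dh (Suc n) 0 ` C (Suc n) 0) (\<pi> \<circ> to_X n)
    (homology (sset_chains K X) n)"
  proof (rule presentation_pullback[OF \<pi> module_hom_free_map pscale.vector_space_scale])
    show "pscale.subspace {x \<in> C n 0. n = 0 \<or> dh n 0 x = 0}"
    proof (cases n)
      case 0
      then show ?thesis using subspace_C[of 0 0] by simp
    next
      case (Suc m)
      then have "{x \<in> C n 0. n = 0 \<or> dh n 0 x = 0} = C n 0 \<inter> {x. dh n 0 x = 0}" by auto
      then show ?thesis using pscale.subspace_inter[OF subspace_C dh.subspace_kernel] by simp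
    qed
    show "pscale.subspace (dh (Suc n) 0 ` C (Suc n) 0)"
      by (rule dh.subspace_image[OF subspace_C])
    show "dh (Suc n) 0 ` C (Suc n) 0 \<subseteq> {x \<in> C n 0. n = 0 \<or> dh n 0 x = 0}"
      by (cases n) (auto simp: dh_C dh_dh)
    show "to_X n x \<in> {x \<in> ?A n. n = 0 \<or> free_bd X n x = 0}"
      if "x \<in> {x \<in> C n 0. n = 0 \<or> dh n 0 x = 0}" for x
      using that cycle_iff to_X_supported by blast
    show "\<exists>x\<in>{x \<in> C n 0. n = 0 \<or> dh n 0 x = 0}. y - to_X n x \<in> free_bd X (Suc n) ` ?A (Suc n)"
      if y: "y \<in> {x \<in> ?A n. n = 0 \<or> free_bd X n x = 0}" for y
    proof
      have "0 \<in> free_bd X (Suc n) ` ?A (Suc n)"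
        using presentation.subspace_B[OF \<pi>] by (rule pscale.subspace_0)
      then show "y - to_X n (free_map (section_of n) y) \<in> free_bd X (Suc n) ` ?A (Suc n)"
        by (simp only: to_X_of_X diff_self)
      show "free_map (section_of n) y \<in> {x \<in> C n 0. n = 0 \<or> dh n 0 x = 0}"
        using y of_X_C[of y n] cycle_iff[of "free_map (section_of n) y"] by (simp add: to_X_of_X)
    qed
    show "to_X n x \<in> free_bd X (Suc n) ` ?A (Suc n) \<longleftrightarrow> x \<in> dh (Suc n) 0 ` C (Suc n) 0"
      if x: "x \<in> {x \<in> C n 0. n = 0 \<or> dh n 0 x = 0}" for x
    proof
      assume "to_X n x \<in> free_bd X (Suc n) ` ?A (Suc n)"
      then obtain z where z: "z \<in> ?A (Suc n)" "to_X n x = free_bd X (Suc n) z" by auto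
      let ?w = "free_map (section_of (Suc n)) z"
      have w: "?w \<in> C (Suc n) 0" using z by (intro of_X_C)
      then have "to_X n x = to_X n (dh (Suc n) 0 ?w)" using z by (simp add: to_X_dh to_X_of_X)
      then have "x = dh (Suc n) 0 ?w"
        using of_X_to_X[of x n] of_X_to_X[of "dh (Suc n) 0 ?w" n] x dh_C[OF w] by simp
      then show "x \<in> dh (Suc n) 0 ` C (Suc n) 0" using w by blast
    next
      assume "x \<in> dh (Suc n) 0 ` C (Suc n) 0"
      then show "to_X n x \<in> free_bd X (Suc n) ` ?A (Suc n)"
        using to_X_supported by (auto simp: to_X_dh)
    qed
  qed
  then show ?thesis by blast
qed

lemma section_spectral_sequence_converges:
  "ss_converges (bisset_double_complex K S) (homology (sset_chains K X))"
  by (rule convergence) (use presentation_homology_X presentation_total_homology in blast)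

end

theorem proposition1p2:
  fixes X :: "'a sset" and h :: "nat \<Rightarrow> 'a \<Rightarrow> real list"
  assumes "simplicial_set X"
    and "height_function X h"
  shows "(\<forall>p q. vs_iso (ss_page (section_double_complex TYPE('k::field) X h) 2 p q)
                       (homology (reeb_complex TYPE('k) X h q) p))
       \<and> ss_converges (section_double_complex TYPE('k) X h) (homology (sset_chains TYPE('k) X))"
proof -
  interpret section_bicomplex X h "TYPE('k)"
    using assms by (intro section_bicomplex.intro height_space.intro height_space_axioms.intro)
  show ?thesis
    unfolding section_double_complex_def reeb_complex_def
    using second_page_bisimplicial section_spectral_sequence_converges by blast
qed

end
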